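(* Let $\mathrm{d}=(d_1,\dots,d_n)$ be any degree sequence with $\sigma_{\mathrm{d}}>0$, let $\mathrm{T}$ be a uniformly random element of $\mathcal{T}_{\mathrm{d}}$, and define $\sigma'\ge 0$ by $(\sigma')^2=\frac{n}{n-n_1(\mathrm{d})}\sigma_{\mathrm{d}}^2$. Then for all $x\ge 2^{15}$, $$\mathbf{P}\left(\mathrm{ht}(\mathrm{T})\ge x n^{1/2}\,\frac{\log(\sigma'+1)}{\sigma_{\mathrm{d}}}\right)<4\exp\left(-x\log(\sigma'+1)/2^{14}\right).$$
   Context: A degree sequence is a sequence of non-negative integers $\mathrm{d}=(d_1,\dots,d_n)$ with $\sum_{i=1}^n d_i=n-1$. In a rooted tree, the degree of a vertex is its number of children. $\mathcal{T}_{\mathrm{d}}$ is the set of rooted labeled trees with vertex set $[n]=\{1,\dots,n\}$ in which, for each $i\in[n]$, vertex $i$ has degree (number of children) $d_i$. For $i\ge 0$, $n_i(\mathrm{d})=|\{j\in[n]:d_j=i\}|$. $\sigma_{\mathrm{d}}\ge 0$ is defined by $\sigma_{\mathrm{d}}^2=\frac1n\sum_{i=1}^n d_i(d_i-1)$. The height $\mathrm{ht}(\mathrm{t})$ is the maximum graph distance from the root to a vertex. $\log$ is the natural logarithm. *)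

theory Defs
  imports "HOL-Probability.Probability" "Graph_Theory.Graph_Theory"
begin

text \<open>
  A finite simple undirected graph is a \<^const>\<open>pair_graph\<close>: every edge is present as the two
  opposite arcs. For such graphs \<^const>\<open>forest\<close> and \<^const>\<open>tree\<close> are unsuitable, as a pair of
  opposite arcs already counts as a \<^const>\<open>pre_digraph.cycle\<close> (of length two). The cycles of the
  undirected graph are the arc cycles of length at least three.
\<close>

definition undirected_tree :: "'a pair_pre_digraph \<Rightarrow> bool" where
  "undirected_tree G \<longleftrightarrow>
     pair_graph G \<and>
     Digraph_Component.connected (with_proj G) \<and>
     \<not> (\<exists>p. pre_digraph.cycle (with_proj G) p \<and> length p \<ge> 3)"

definition graph_dist :: "'a pair_pre_digraph \<Rightarrow> 'a \<Rightarrow> 'a \<Rightarrow> nat" where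
  "graph_dist G u v = (LEAST k. \<exists>p. pre_digraph.awalk (with_proj G) u p v \<and> length p = k)"

text \<open>A rooted tree is a pair consisting of a tree and its root.\<close>

type_synonym 'a rooted_tree = "'a pair_pre_digraph \<times> 'a"

definition is_rooted_tree :: "'a rooted_tree \<Rightarrow> bool" where
  "is_rooted_tree t \<longleftrightarrow> undirected_tree (fst t) \<and> snd t \<in> pverts (fst t)"

definition children :: "'a rooted_tree \<Rightarrow> 'a \<Rightarrow> 'a set" where
  "children t u =
     {v. (u, v) \<in> parcs (fst t) \<and> graph_dist (fst t) (snd t) v = graph_dist (fst t) (snd t) u + 1}"

definition tree_height :: "'a rooted_tree \<Rightarrow> nat" where
  "tree_height t = Max (graph_dist (fst t) (snd t) ` pverts (fst t))"

text \<open>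
  The sequence \<open>(d\<^sub>1, \<dots>, d\<^sub>n)\<close> is given by a function on the naturals, of which only the values
  on \<open>{1..n}\<close> matter. The condition on the sum is written without truncated subtraction;
  it excludes \<open>n = 0\<close>.
\<close>

definition degree_sequence :: "nat \<Rightarrow> (nat \<Rightarrow> nat) \<Rightarrow> bool" where
  "degree_sequence n d \<longleftrightarrow> (\<Sum>i=1..n. d i) + 1 = n"

definition trees_with_degrees :: "nat \<Rightarrow> (nat \<Rightarrow> nat) \<Rightarrow> nat rooted_tree set" where
  "trees_with_degrees n d =
     {t. is_rooted_tree t \<and> pverts (fst t) = {1..n} \<and> (\<forall>i\<in>{1..n}. card (children t i) = d i)}"

definition num_degree :: "nat \<Rightarrow> (nat \<Rightarrow> nat) \<Rightarrow> nat \<Rightarrow> nat" where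
  "num_degree n d i = card {j \<in> {1..n}. d j = i}"

definition deg_sigma :: "nat \<Rightarrow> (nat \<Rightarrow> nat) \<Rightarrow> real" where
  "deg_sigma n d = sqrt (1 / real n * (\<Sum>i=1..n. real (d i) * (real (d i) - 1)))"

definition deg_sigma' :: "nat \<Rightarrow> (nat \<Rightarrow> nat) \<Rightarrow> real" where
  "deg_sigma' n d = sqrt (real n / (real n - real (num_degree n d 1)) * (deg_sigma n d)\<^sup>2)"

end

theory Submission
  imports Defs
begin

text \<open>
  For every order of the leaves, the trees with given degrees correspond to the words in which each
  vertex occurs as often as its degree says. Read from the root, a word lists the paths that attach
  the leaves one after the other to the tree spanned by their predecessors, and a new path starts
  whenever a letter is repeated. Hence the distance of any given leaf from the subtree spanned by
  the root and any \<open>K\<close> other leaves is distributed like the gap after the \<open>K\<close>-th repeat in a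
  uniformly random word. This gap is short: by that time many letters are pending, that is, further
  occurrences of vertices already seen, and each of them would end the gap.

  Let \<open>S = \<Sum>d\<^sub>i(d\<^sub>i - 1)\<close>. A union bound over the first \<open>K\<^sub>1\<close> leaves, \<open>K\<^sub>1\<close> being of the order of
  \<open>y(1 + \<sigma>'\<^sup>2)\<close>, shows that their depth is \<open>O(y n / \<surd>S)\<close>. Multiplying the number of leaves by four
  in each further stage, the distance that each stage adds decays geometrically. Here \<open>y\<close> is the
  exponent \<open>x log(\<sigma>' + 1) / 2\<^sup>1\<^sup>4\<close>, and \<open>e\<^sup>y \<ge> 1 + \<sigma>'\<^sup>2\<close> makes the union bounds affordable.
\<close>

section \<open>Trees and words\<close>

text \<open>As the leaf order is free, the union bounds need no joint law: each leaf can be placed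
  directly after the chosen base leaves, and only one gap of one random word is estimated. The
  obstacle is that a word is sampled without replacement. Words are therefore lifted to permutations
  of distinguishable occurrences, of which two facts are used: a prefix contains, or avoids, a fixed
  set with at most the probability that independent sampling would give. The exponential moments of
  the number of repeats and of the excess seen so far are expanded into such probabilities. One
  function, \<open>energy\<close>, controls both, so a single time t can be found before which K
  repeats are unlikely and by which much is pending. What is pending then has order
  sqrt(\<open>\<alpha>\<close> K), where \<open>\<alpha> + 1\<close> is the number of leaves. Now
  \<open>\<alpha>\<close> is at least a third of the number of vertices of degree other than 1, so K
  of order sigma'^2 makes \<open>\<alpha>\<close> K of order S, which is already the scale of the
  first gap. Quadrupling K halves the next gap up to a logarithm, which the ratio 3/4
  absorbs.\<close>

text \<open>Given unique parents, the level function excludes cycles, so every vertex is reached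
  from the root. Levels are existential and not normalised, which makes the definition easy to
  preserve when a leaf is added or removed.\<close>

definition arborescence :: "'a set \<Rightarrow> 'a \<Rightarrow> ('a \<times> 'a) set \<Rightarrow> bool" where
  "arborescence V r E \<longleftrightarrow>
     finite V \<and> r \<in> V \<and> E \<subseteq> V \<times> V \<and> (\<forall>v\<in>V - {r}. \<exists>!u. (u, v) \<in> E) \<and> (\<forall>u. (u, r) \<notin> E) \<and>
     (\<exists>\<delta>::'a \<Rightarrow> nat. \<forall>(u, v)\<in>E. \<delta> v = Suc (\<delta> u))"

definition arborescences :: "'a set \<Rightarrow> ('a \<Rightarrow> nat) \<Rightarrow> ('a \<times> ('a \<times> 'a) set) set" where
  "arborescences V d = {(r, E). arborescence V r E \<and> (\<forall>u\<in>V. card (E `` {u}) = d u)}"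

definition depth :: "'a \<times> ('a \<times> 'a) set \<Rightarrow> 'a \<Rightarrow> nat" where
  "depth t v = (LEAST k. (fst t, v) \<in> snd t ^^ k)"

definition leaves :: "'a set \<Rightarrow> ('a \<Rightarrow> nat) \<Rightarrow> 'a set" where
  "leaves V d = {v \<in> V. d v = 0}"

definition words :: "'a set \<Rightarrow> ('a \<Rightarrow> nat) \<Rightarrow> 'a list set" where
  "words V d = {xs. set xs \<subseteq> V \<and> (\<forall>v\<in>V. count_list xs v = d v)}"

text \<open>
  Words and leaf lists are reversed with respect to the order of construction. The word of a tree is
  read off by repeatedly deleting the first leaf of the list and recording its parent, which takes
  the place of the deleted leaf in the list if it has become a leaf itself.
\<close>

fun tree_of_word :: "'a list \<Rightarrow> 'a list \<Rightarrow> 'a \<times> ('a \<times> 'a) set" where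
  "tree_of_word [] ls = (hd ls, {})"
| "tree_of_word (x # xs) ls =
     (let t = tree_of_word xs (if x \<in> set xs then tl ls else x # tl ls)
      in (fst t, insert (x, hd ls) (snd t)))"

definition repeats :: "'a list \<Rightarrow> nat" where
  "repeats xs = length xs - card (set xs)"

text \<open>
  The gap between the \<open>K\<close>-th and the next repeat of the word \<open>rev xs\<close>, that is, the length of the
  path that attaches the \<open>(K + 1)\<close>-st leaf.
\<close>

fun gap :: "nat \<Rightarrow> 'a list \<Rightarrow> nat" where
  "gap K [] = 0"
| "gap K (x # xs) =
     (if repeats (x # xs) > K then gap K xs else if x \<in> set xs then 1 else Suc (gap K xs))"

lemma repeats_Nil [simp]: "repeats [] = 0"
  by (simp add: repeats_def)

lemma words_length:
  assumes "finite V" "xs \<in> words V d"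
  shows "length xs = sum d V"
proof -
  have "length xs = sum (count_list xs) V"
    using assms by (intro sum_count_set[symmetric]) (auto simp: words_def)
  then show ?thesis using assms by (simp add: words_def)
qed

lemma words_Cons_iff:
  "x # xs \<in> words V d \<longleftrightarrow> x \<in> V \<and> 0 < d x \<and> xs \<in> words V (d(x := d x - 1))"
  by (auto simp: words_def)

lemma words_in_set_iff:
  "xs \<in> words V d \<Longrightarrow> x \<in> V \<Longrightarrow> x \<in> set xs \<longleftrightarrow> 0 < d x"
  using count_list_0_iff[of xs x] by (auto simp: words_def)

lemma words_remove_leaf:
  assumes "l \<in> V" "d l = 0"
  shows "xs \<in> words V d \<longleftrightarrow> xs \<in> words (V - {l}) d"
  using assms count_list_0_iff[of xs l] by (auto simp: words_def)

section \<open>Arborescences: levels, depth, adding and removing leaves\<close>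

lemma arborescenceD:
  assumes "arborescence V r E"
  shows "finite V" "r \<in> V" "E \<subseteq> V \<times> V" "(u, r) \<notin> E"
  using assms by (simp_all add: arborescence_def)

lemma arborescence_parent:
  assumes "arborescence V r E" "v \<in> V" "v \<noteq> r"
  obtains u where "(u, v) \<in> E" "u \<in> V"
proof -
  have "\<exists>!u. (u, v) \<in> E" using assms by (simp add: arborescence_def)
  then obtain u where u: "(u, v) \<in> E" by blast
  then have "u \<in> V" using assms by (auto simp: arborescence_def)
  then show ?thesis using that u by blast
qed

lemma arborescence_parent_unique:
  assumes "arborescence V r E" "(u, v) \<in> E" "(w, v) \<in> E"
  shows "u = w"
proof -
  have "v \<in> V - {r}" using assms(1,2) by (auto simp: arborescence_def)
  then have "\<exists>!u. (u, v) \<in> E" using assms(1) by (simp add: arborescence_def)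
  then show ?thesis using assms by blast
qed

lemma arborescence_finite: "arborescence V r E \<Longrightarrow> finite E"
  using finite_subset[of E "V \<times> V"] by (simp add: arborescence_def)

text \<open>Levels drop along parents until the root is reached, so the root has the least level and
  its value can be subtracted from all others.\<close>

lemma arborescence_level:
  assumes "arborescence V r E"
  obtains \<delta> :: "'a \<Rightarrow> nat" where "\<And>u v. (u, v) \<in> E \<Longrightarrow> \<delta> v = Suc (\<delta> u)" "\<delta> r = 0"
proof -
  obtain \<delta> :: "'a \<Rightarrow> nat" where d: "\<forall>(u, v)\<in>E. \<delta> v = Suc (\<delta> u)"
    using assms by (auto simp: arborescence_def)
  have "\<delta> r \<le> \<delta> v" if "v \<in> V" for v
    using that
  proof (induction "\<delta> v" arbitrary: v rule: less_induct)
    case less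
    show ?case
    proof (cases "v = r")
      case False
      then obtain u where u: "(u, v) \<in> E" "u \<in> V" using arborescence_parent assms less by metis
      then have "\<delta> v = Suc (\<delta> u)" using d by auto
      then show ?thesis using less.hyps[of u] u by simp
    qed simp
  qed
  then have "\<delta> v - \<delta> r = Suc (\<delta> u - \<delta> r)" if "(u, v) \<in> E" for u v
  proof -
    have "u \<in> V" using that assms by (auto simp: arborescence_def)
    moreover have "\<delta> v = Suc (\<delta> u)" using that d by auto
    ultimately show ?thesis using \<open>\<And>v. v \<in> V \<Longrightarrow> \<delta> r \<le> \<delta> v\<close>[of u] by simp
  qed
  then show ?thesis using that[of "\<lambda>v. \<delta> v - \<delta> r"] by simp
qed

lemma level_relpow:
  assumes "\<And>u v. (u, v) \<in> E \<Longrightarrow> \<delta> v = Suc (\<delta> u)" "\<delta> r = 0" "(r, v) \<in> E ^^ k"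
  shows "\<delta> v = k"
  using assms(3) by (induction k arbitrary: v) (auto simp: assms)

lemma arborescence_relpow:
  assumes a: "arborescence V r E" and d: "\<And>u v. (u, v) \<in> E \<Longrightarrow> \<delta> v = Suc (\<delta> u)" "\<delta> r = 0"
    and "v \<in> V"
  shows "(r, v) \<in> E ^^ \<delta> v"
  using \<open>v \<in> V\<close>
proof (induction "\<delta> v" arbitrary: v rule: less_induct)
  case less
  show ?case
  proof (cases "v = r")
    case False
    then obtain u where u: "(u, v) \<in> E" "u \<in> V" using arborescence_parent a less by metis
    then have "\<delta> v = Suc (\<delta> u)" using d by auto
    then show ?thesis using less.hyps[of u] u by auto
  qed (simp add: d)
qed

lemma depth_level:
  assumes "arborescence V r E" "\<And>u v. (u, v) \<in> E \<Longrightarrow> \<delta> v = Suc (\<delta> u)" "\<delta> r = 0" "v \<in> V"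
  shows "depth (r, E) v = \<delta> v"
  unfolding depth_def fst_conv snd_conv
proof (rule Least_equality)
  show "(r, v) \<in> E ^^ \<delta> v" by (rule arborescence_relpow[of V r E \<delta>, OF assms])
next
  fix k assume "(r, v) \<in> E ^^ k"
  then show "\<delta> v \<le> k" using level_relpow[of E \<delta> r, OF assms(2,3)] by simp
qed

lemma depth_root: "arborescence V r E \<Longrightarrow> depth (r, E) r = 0"
  by (auto simp: depth_def intro!: Least_equality)

lemma depth_edge:
  assumes "arborescence V r E" "(u, v) \<in> E"
  shows "depth (r, E) v = Suc (depth (r, E) u)"
proof -
  obtain \<delta> :: "'a \<Rightarrow> nat" where d: "\<And>u v. (u, v) \<in> E \<Longrightarrow> \<delta> v = Suc (\<delta> u)" "\<delta> r = 0"
    using arborescence_level[OF assms(1)] by blast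
  have "u \<in> V" "v \<in> V" using assms by (auto simp: arborescence_def)
  then show ?thesis using depth_level[of V r E \<delta>, OF assms(1) d] d assms by simp
qed

lemma arborescence_insert_leaf:
  assumes a: "arborescence V r E" and "l \<notin> V" "x \<in> V"
  shows "arborescence (insert l V) r (insert (x, l) E)"
proof -
  obtain \<delta> :: "'a \<Rightarrow> nat" where d: "\<forall>(u, v)\<in>E. \<delta> v = Suc (\<delta> u)"
    using a by (auto simp: arborescence_def)
  have E: "u \<in> V" "v \<in> V" if "(u, v) \<in> E" for u v using a that by (auto simp: arborescence_def)
  have "\<forall>(u, v)\<in>insert (x, l) E. (\<delta>(l := Suc (\<delta> x))) v = Suc ((\<delta>(l := Suc (\<delta> x))) u)"
    using d E assms by fastforce
  moreover have "\<exists>!u. (u, v) \<in> insert (x, l) E" if "v \<in> insert l V - {r}" for v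
  proof (cases "v = l")
    case True
    then show ?thesis using E assms by blast
  next
    case False
    then show ?thesis using that a by (auto simp: arborescence_def)
  qed
  ultimately show ?thesis using assms E unfolding arborescence_def by blast
qed

lemma arborescence_remove_leaf:
  assumes a: "arborescence V r E" and "l \<in> V" "l \<noteq> r" "(x, l) \<in> E" "E `` {l} = {}"
  shows "arborescence (V - {l}) r (E - {(x, l)})"
proof -
  have u: "u = x" if "(u, l) \<in> E" for u using arborescence_parent_unique[OF a that assms(4)] .
  have "E \<subseteq> V \<times> V" using a by (simp add: arborescence_def)
  then have "E - {(x, l)} \<subseteq> (V - {l}) \<times> (V - {l})" using u assms(5) by blast
  moreover have "\<exists>!u. (u, v) \<in> E - {(x, l)}" if "v \<in> V - {l} - {r}" for v
  proof -
    have "\<exists>!u. (u, v) \<in> E" using that a by (simp add: arborescence_def)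
    then show ?thesis using that by auto
  qed
  moreover obtain \<delta> :: "'a \<Rightarrow> nat" where "\<forall>(u, v)\<in>E. \<delta> v = Suc (\<delta> u)"
    using a by (auto simp: arborescence_def)
  then have "\<exists>\<delta> :: 'a \<Rightarrow> nat. \<forall>(u, v)\<in>E - {(x, l)}. \<delta> v = Suc (\<delta> u)" by blast
  ultimately show ?thesis using assms by (simp add: arborescence_def)
qed

lemma arborescences_insert_leaf:
  assumes "(r, E) \<in> arborescences V d" "l \<notin> V" "x \<in> V" "d' l = 0" "d' x = Suc (d x)"
    "\<And>v. v \<in> V - {x} \<Longrightarrow> d' v = d v"
  shows "(r, insert (x, l) E) \<in> arborescences (insert l V) d'"
proof -
  have a: "arborescence V r E" using assms by (simp add: arborescences_def)
  then have E: "E \<subseteq> V \<times> V" "finite V" by (auto simp: arborescence_def)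
  have "card (insert (x, l) E `` {u}) = d' u" if "u \<in> insert l V" for u
  proof (cases "u = x")
    case True
    have "insert (x, l) E `` {x} = insert l (E `` {x})" by auto
    moreover have "l \<notin> E `` {x}" "finite (E `` {x})"
      using E assms arborescence_finite[OF a] by (auto simp: finite_Image)
    ultimately show ?thesis using True assms by (simp add: arborescences_def)
  next
    case False
    then have *: "insert (x, l) E `` {u} = E `` {u}" by auto
    show ?thesis
    proof (cases "u = l")
      case True
      then have "E `` {u} = {}" using E assms by auto
      then show ?thesis using * True assms by simp
    next
      case u: False
      then show ?thesis using * False that assms by (simp add: arborescences_def)
    qed
  qed
  then show ?thesis using arborescence_insert_leaf[OF a assms(2,3)] by (simp add: arborescences_def)
qed

lemma arborescences_remove_leaf:
  assumes "(r, E) \<in> arborescences V d" "l \<in> V" "d l = 0" "l \<noteq> r"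
  obtains x where "(x, l) \<in> E" "x \<in> V" "x \<noteq> l" "0 < d x"
    "(r, E - {(x, l)}) \<in> arborescences (V - {l}) (d(x := d x - 1))"
proof -
  have a: "arborescence V r E" using assms by (simp add: arborescences_def)
  then have E: "E \<subseteq> V \<times> V" "finite E"
    using arborescence_finite[OF a] by (simp_all add: arborescence_def)
  obtain x where x: "(x, l) \<in> E" by (rule arborescence_parent[OF a assms(2,4)])
  have fin: "finite (E `` {u})" for u using E by (simp add: finite_Image)
  have card: "card (E `` {u}) = d u" if "u \<in> V" for u using assms that by (simp add: arborescences_def)
  have l: "E `` {l} = {}" using card[of l] assms fin by simp
  have xV: "x \<in> V" "x \<noteq> l" using x E l by auto
  have "l \<in> E `` {x}" using x by simp
  then have "0 < card (E `` {x})" by (intro card_gt_0_iff[THEN iffD2] conjI fin) blast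
  then have dx: "0 < d x" using card[of x] xV by simp
  have "card ((E - {(x, l)}) `` {u}) = (d(x := d x - 1)) u" if "u \<in> V - {l}" for u
  proof (cases "u = x")
    case True
    have "(E - {(x, l)}) `` {x} = E `` {x} - {l}" by auto
    then show ?thesis using True x fin card[of x] xV by simp
  next
    case False
    then have "(E - {(x, l)}) `` {u} = E `` {u}" by auto
    then show ?thesis using False card that by simp
  qed
  then have "(r, E - {(x, l)}) \<in> arborescences (V - {l}) (d(x := d x - 1))"
    using arborescence_remove_leaf[OF a assms(2,4) x l] by (simp add: arborescences_def)
  from that[OF x xV dx this] show thesis .
qed

lemma arborescence_singleton: "arborescence {r} r' E \<longleftrightarrow> r' = r \<and> E = {}"
proof
  assume a: "arborescence {r} r' E"
  then have "r' \<in> {r}" "E \<subseteq> {r} \<times> {r}" "(r, r') \<notin> E" using arborescenceD by metis+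
  then show "r' = r \<and> E = {}" by auto
next
  assume "r' = r \<and> E = {}"
  then show "arborescence {r} r' E" by (simp add: arborescence_def)
qed

text \<open>Every vertex ends a walk from the root, and a childless root starts only the empty one.
  Hence a leaf that is deleted is never the root, except in the one-vertex tree.\<close>

lemma arborescence_root_not_leaf:
  assumes "(r, E) \<in> arborescences V d" "d r = 0" "r \<in> V"
  shows "V = {r}"
proof -
  have a: "arborescence V r E" using assms by (simp add: arborescences_def)
  then have "finite E" by (rule arborescence_finite)
  then have "finite (E `` {r})" by (simp add: finite_Image)
  moreover have "card (E `` {r}) = 0" using assms by (simp add: arborescences_def)
  ultimately have "E `` {r} = {}" by simp
  obtain \<delta> :: "'a \<Rightarrow> nat" where d: "\<And>u v. (u, v) \<in> E \<Longrightarrow> \<delta> v = Suc (\<delta> u)" "\<delta> r = 0"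
    using arborescence_level[OF a] by blast
  have "v = r" if "v \<in> V" for v
  proof -
    have "(r, v) \<in> E ^^ \<delta> v" using arborescence_relpow[of V r E \<delta>, OF a d that] by simp
    then show ?thesis using \<open>E `` {r} = {}\<close> by (cases "\<delta> v") (use relpow_Suc_D2[of r v _ E] in auto)
  qed
  then show ?thesis using assms(3) by blast
qed

section \<open>The bijection between words and arborescences\<close>

lemma tree_of_word_Cons:
  assumes "tree_of_word xs (if x \<in> set xs then ls else x # ls) = (r, E)"
  shows "tree_of_word (x # xs) (l # ls) = (r, insert (x, l) E)"
  using assms by (simp add: Let_def cong: if_cong)

declare tree_of_word.simps(2) [simp del]

text \<open>The invariant for induction along a word: after deletion of the first leaf, the
  remaining word and the updated list fit the smaller tree. The letter \<open>x\<close> is absent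
  from \<open>xs\<close> exactly when \<open>d x = 1\<close>, that is, when \<open>x\<close> has
  just lost its last child.\<close>

lemma leaf_list_step:
  assumes "x # xs \<in> words V d" "finite V" "distinct (l # ls)" "set (l # ls) = leaves V d"
  defines "V' \<equiv> V - {l}" and "d' \<equiv> d(x := d x - 1)"
    and "ls' \<equiv> if x \<in> set xs then ls else x # ls"
  shows "l \<in> V" "d l = 0" "x \<in> V'" "0 < d x" "xs \<in> words V' d'" "distinct ls'" "set ls' = leaves V' d'"
proof -
  have x: "x \<in> V" "0 < d x" "xs \<in> words V d'" using assms by (auto simp: words_Cons_iff)
  have l: "l \<in> V" "d l = 0" using assms by (auto simp: leaves_def)
  have xl: "x \<noteq> l" using x l by auto
  show "l \<in> V" "d l = 0" "x \<in> V'" "0 < d x" using l x xl by (auto simp: V'_def)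
  show "xs \<in> words V' d'" using x xl l words_remove_leaf[of l V d' xs] by (simp add: d'_def V'_def)
  have xin: "x \<in> set xs \<longleftrightarrow> 1 < d x" using words_in_set_iff[OF x(3,1)] by (auto simp: d'_def)
  have "x \<notin> leaves V d" using x by (auto simp: leaves_def)
  then have "x \<notin> set ls" using assms(4) by auto
  then show "distinct ls'" using assms by (auto simp: ls'_def)
  show "set ls' = leaves V' d'"
  proof (cases "x \<in> set xs")
    case True
    then show ?thesis using assms(3,4) x xin l by (auto simp: ls'_def leaves_def V'_def d'_def)
  next
    case False
    then have "d x = 1" using x xin by auto
    then show ?thesis using assms(3,4) x xl l False by (auto simp: ls'_def leaves_def V'_def d'_def)
  qed
qed

text \<open>If all degrees were positive, their sum would be at least \<open>card V\<close>.\<close>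

lemma leaves_nonempty:
  assumes "finite V" "card V = Suc (sum d V)"
  shows "leaves V d \<noteq> {}"
proof
  assume "leaves V d = {}"
  then have "sum (\<lambda>_. 1) V \<le> sum d V" by (intro sum_mono) (auto simp: leaves_def Suc_le_eq)
  then show False using assms by simp
qed

lemma tree_of_word_in_arborescences:
  assumes "xs \<in> words V d" "finite V" "card V = Suc (length xs)" "distinct ls" "set ls = leaves V d"
  shows "tree_of_word xs ls \<in> arborescences V d"
  using assms
proof (induction xs arbitrary: V d ls)
  case Nil
  then obtain r where r: "V = {r}" by (auto simp: card_1_singleton_iff)
  then have "d r = 0" using Nil by (auto simp: words_def)
  then have "leaves V d = {r}" using r by (auto simp: leaves_def)
  then have "ls = [r]" using Nil by (cases ls) (auto simp: subset_singleton_iff)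
  then show ?case using r \<open>d r = 0\<close> by (auto simp: arborescences_def arborescence_singleton)
next
  case (Cons x xs)
  have "sum d V = Suc (length xs)" using words_length[OF Cons.prems(2,1)] by simp
  then have "leaves V d \<noteq> {}" using Cons.prems by (intro leaves_nonempty) auto
  then obtain l ls0 where ls: "ls = l # ls0" using Cons.prems by (cases ls) auto
  note step = leaf_list_step[OF Cons.prems(1,2), of l ls0, folded ls, OF Cons.prems(4,5)]
  obtain r E where t: "tree_of_word xs (if x \<in> set xs then ls0 else x # ls0) = (r, E)"
    by fastforce
  have "(r, E) \<in> arborescences (V - {l}) (d(x := d x - 1))"
    unfolding t[symmetric]
    by (rule Cons.IH[OF step(5) _ _ step(6,7)]) (use step(1) Cons.prems in simp_all)
  then have "(r, insert (x, l) E) \<in> arborescences (insert l (V - {l})) d"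
    by (rule arborescences_insert_leaf) (use step in auto)
  then show ?case using step(1) tree_of_word_Cons[OF t, of l] by (simp add: ls insert_absorb)
qed

text \<open>Decoding is forced: the first letter must be the parent of the first leaf of the list,
  and the rest must be the word of the tree without that leaf. The induction is on the degree sum
  because vertices, degrees and leaf list all change.\<close>

lemma arborescence_ex1_word:
  assumes "(r, E) \<in> arborescences V d" "finite V" "card V = Suc N" "sum d V = N"
    "distinct ls" "set ls = leaves V d"
  shows "\<exists>!xs. xs \<in> words V d \<and> tree_of_word xs ls = (r, E)"
  using assms
proof (induction N arbitrary: V d ls E)
  case 0
  then obtain v where v: "V = {v}" by (auto simp: card_1_singleton_iff)
  then have d: "d v = 0" using 0 by simp
  then have "leaves V d = {v}" using v by (auto simp: leaves_def)
  then have "ls = [v]" using 0 by (cases ls) (auto simp: subset_singleton_iff)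
  have "words V d = {[]}" using words_length[OF 0(2), of _ d] 0(4) d v by (auto simp: words_def)
  then show ?case using 0 v \<open>ls = [v]\<close>
    by (auto simp: arborescences_def arborescence_singleton)
next
  case (Suc N)
  have "leaves V d \<noteq> {}" using Suc.prems by (intro leaves_nonempty) auto
  then obtain l ls0 where ls: "ls = l # ls0" using Suc.prems by (cases ls) auto
  have l: "l \<in> V" "d l = 0" using Suc.prems ls by (auto simp: leaves_def)
  have "l \<noteq> r" using arborescence_root_not_leaf[OF Suc.prems(1)] l Suc.prems by auto
  obtain x where x: "(x, l) \<in> E" "x \<in> V" "x \<noteq> l" "0 < d x"
    "(r, E - {(x, l)}) \<in> arborescences (V - {l}) (d(x := d x - 1))"
    using arborescences_remove_leaf[OF Suc.prems(1) l \<open>l \<noteq> r\<close>] by blast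
  have a: "arborescence V r E" using Suc.prems by (simp add: arborescences_def)
  have xu: "y = x" if "(y, l) \<in> E" for y by (rule arborescence_parent_unique[OF a that x(1)])
  define V' where "V' = V - {l}"
  define d' where "d' = d(x := d x - 1)"
  \<comment> \<open>The degree of \<open>x\<close> decides the updated list before any word is
    known.\<close>
  define ls' where "ls' = (if 1 < d x then ls0 else x # ls0)"
  have sumd: "sum d' V' = N"
  proof -
    have "sum d V = d x + sum d (V - {x})" using x Suc.prems by (simp add: sum.remove)
    moreover have "sum d' V = d' x + sum d' (V - {x})" using x Suc.prems by (simp add: sum.remove)
    moreover have "sum d' (V - {x}) = sum d (V - {x})" by (intro sum.cong) (auto simp: d'_def)
    moreover have "sum d' V = d' l + sum d' V'" using l Suc.prems by (simp add: sum.remove V'_def)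
    ultimately show ?thesis using Suc.prems x l by (simp add: d'_def)
  qed
  have ls': "distinct ls'" "set ls' = leaves V' d'"
  proof -
    show "distinct ls'" using Suc.prems ls x by (auto simp: ls'_def leaves_def)
    show "set ls' = leaves V' d'"
    proof (cases "1 < d x")
      case True
      then show ?thesis using Suc.prems ls x l by (auto simp: ls'_def leaves_def V'_def d'_def)
    next
      case False
      then have "d x = 1" using x by auto
      then show ?thesis using Suc.prems ls x l by (auto simp: ls'_def leaves_def V'_def d'_def)
    qed
  qed
  have "\<exists>!xs. xs \<in> words V' d' \<and> tree_of_word xs ls' = (r, E - {(x, l)})"
  proof (rule Suc.IH)
    show "(r, E - {(x, l)}) \<in> arborescences V' d'" using x(5) by (simp add: V'_def d'_def)
    show "finite V'" "card V' = Suc N" using Suc.prems l by (auto simp: V'_def)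
  qed (rule sumd ls')+
  then obtain xs where xs: "xs \<in> words V' d'" "tree_of_word xs ls' = (r, E - {(x, l)})"
    and uniq: "\<And>ys. ys \<in> words V' d' \<Longrightarrow> tree_of_word ys ls' = (r, E - {(x, l)}) \<Longrightarrow> ys = xs" by blast
  have w: "x # ys \<in> words V d \<longleftrightarrow> ys \<in> words V' d'" for ys
    using x l words_remove_leaf[of l V d' ys] by (simp add: words_Cons_iff d'_def V'_def)
  have ls'_eq: "(if x \<in> set ys then ls0 else x # ls0) = ls'" if "ys \<in> words V' d'" for ys
    using words_in_set_iff[OF that, of x] x by (auto simp: V'_def d'_def ls'_def)
  show ?case
  proof (rule ex1I[of _ "x # xs"])
    show "x # xs \<in> words V d \<and> tree_of_word (x # xs) ls = (r, E)"
      using xs w ls'_eq[OF xs(1)] x(1) tree_of_word_Cons[of xs x ls0 r "E - {(x, l)}" l]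
      by (simp add: ls insert_absorb)
  next
    fix zs assume zs: "zs \<in> words V d \<and> tree_of_word zs ls = (r, E)"
    then have "length zs = Suc N" using words_length[OF Suc.prems(2), of zs d] Suc.prems(4) by simp
    then obtain z ys where zy: "zs = z # ys" by (cases zs) auto
    obtain r0 E0 where t0: "tree_of_word ys (if z \<in> set ys then ls0 else z # ls0) = (r0, E0)"
      by fastforce
    have r0: "r = r0" "E = insert (z, l) E0" using zs tree_of_word_Cons[OF t0, of l] by (simp_all add: zy ls)
    then have "(z, l) \<in> E" by simp
    then have z: "z = x" using xu by simp
    have ys: "ys \<in> words V' d'" using zs zy z w by simp
    \<comment> \<open>This shows that \<open>E0\<close> lacks the edge \<open>(x, l)\<close>, so
      that removing it from \<open>E\<close> gives back exactly \<open>E0\<close>.\<close>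
    have ar: "tree_of_word ys ls' \<in> arborescences V' d'"
      using Suc.prems l ys sumd ls' words_length[OF _ ys]
      by (intro tree_of_word_in_arborescences) (auto simp: V'_def)
    have "tree_of_word ys ls' = (r, E - {(x, l)})"
    proof -
      have t: "tree_of_word ys ls' = (r0, E0)" using t0 unfolding z ls'_eq[OF ys] .
      have "E0 \<subseteq> V' \<times> V'" using ar unfolding t by (simp add: arborescences_def arborescence_def)
      then have "(x, l) \<notin> E0" by (auto simp: V'_def)
      then show ?thesis using t r0 z by auto
    qed
    then show "zs = x # xs" using uniq[OF ys] zy z by simp
  qed
qed

lemma bij_betw_tree_of_word:
  assumes "finite V" "card V = Suc (sum d V)" "distinct ls" "set ls = leaves V d"
  shows "bij_betw (\<lambda>xs. tree_of_word xs ls) (words V d) (arborescences V d)"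
proof -
  have mem: "tree_of_word xs ls \<in> arborescences V d" if "xs \<in> words V d" for xs
    using that assms words_length[OF assms(1) that] by (intro tree_of_word_in_arborescences) auto
  have ex1: "\<exists>!xs. xs \<in> words V d \<and> tree_of_word xs ls = t" if "t \<in> arborescences V d" for t
    using arborescence_ex1_word[OF _ assms(1,2) refl assms(3,4), of "fst t" "snd t"] that by simp
  show ?thesis unfolding bij_betw_def
  proof
    show "inj_on (\<lambda>xs. tree_of_word xs ls) (words V d)"
    proof (rule inj_onI)
      fix xs ys assume "xs \<in> words V d" "ys \<in> words V d" "tree_of_word xs ls = tree_of_word ys ls"
      then show "xs = ys" using ex1[OF mem[of xs]] by auto
    qed
    show "(\<lambda>xs. tree_of_word xs ls) ` words V d = arborescences V d"
    proof
      show "arborescences V d \<subseteq> (\<lambda>xs. tree_of_word xs ls) ` words V d"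
        using ex1 by (metis imageI subsetI)
    qed (use mem in auto)
  qed
qed

section \<open>Depths of leaves and gaps\<close>

lemma level_le_leaf:
  assumes "(r, E) \<in> arborescences V d" "finite V" "\<And>u v. (u, v) \<in> E \<Longrightarrow> \<delta> v = Suc (\<delta> u)" "v \<in> V"
  shows "(\<delta> v :: nat) \<le> Max (\<delta> ` leaves V d)"
proof -
  have "finite (\<delta> ` V)" using assms by simp
  then obtain w where w: "w \<in> V" "\<And>u. u \<in> V \<Longrightarrow> \<delta> u \<le> \<delta> w"
    using Max_in[of "\<delta> ` V"] Max_ge[of "\<delta> ` V"] assms(4) by fastforce
  have "E `` {w} = {}"
  proof (rule ccontr)
    assume "E `` {w} \<noteq> {}"
    then obtain u where u: "(w, u) \<in> E" by auto
    then have "u \<in> V" using assms(1) by (auto simp: arborescences_def arborescence_def)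
    then show False using w(2)[of u] assms(3)[OF u] by simp
  qed
  then have "d w = 0" using assms(1) w(1) by (fastforce simp: arborescences_def)
  then have "\<delta> w \<le> Max (\<delta> ` leaves V d)" using w assms by (intro Max_ge) (auto simp: leaves_def)
  then show ?thesis using w(2)[OF assms(4)] by simp
qed

text \<open>The letters of a word are exactly the inner vertices, and there is one vertex more than
  there are positions. In terms of paths: every path but the first starts with a repeat.\<close>

lemma card_leaves_words:
  assumes "xs \<in> words V d" "finite V" "card V = Suc (length xs)"
  shows "card (leaves V d) = Suc (repeats xs)"
proof -
  have "set xs = V - leaves V d" using assms words_in_set_iff[OF assms(1)]
    by (auto simp: leaves_def words_def)
  moreover have "leaves V d \<subseteq> V" by (auto simp: leaves_def)
  moreover have "card (leaves V d) \<le> card V" using assms(2) by (intro card_mono) (auto simp: leaves_def)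
  ultimately have "card (set xs) = card V - card (leaves V d)" "card (leaves V d) \<le> card V"
    using assms(2) by (auto simp: card_Diff_subset finite_subset)
  then show ?thesis using assms card_length[of xs] by (simp add: repeats_def)
qed

text \<open>Leaves are deleted until the path of \<open>l\<close> is consumed down to the vertex
  where it is attached. That vertex belongs to the tree whose leaves are \<open>fs\<close>, and its
  level is at most that of the deepest of them. A level function replaces depth because the same
  function serves all the smaller trees; \<open>insert 0\<close> covers empty
  \<open>fs\<close>.\<close>

lemma level_leaf_le_gap:
  assumes "xs \<in> words V d" "finite V" "card V = Suc (length xs)"
    "distinct (as @ l # fs)" "set (as @ l # fs) = leaves V d"
    "\<And>u v. (u, v) \<in> snd (tree_of_word xs (as @ l # fs)) \<Longrightarrow> \<delta> v = Suc (\<delta> u)"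
    "\<delta> (fst (tree_of_word xs (as @ l # fs))) = 0"
  shows "\<delta> l \<le> gap (length fs) xs + Max (insert 0 (\<delta> ` set fs))"
  using assms
proof (induction xs arbitrary: V d as l fs)
  case Nil
  have "card (leaves V d) = 1" using card_leaves_words[OF Nil(1-3)] by simp
  then have "length (as @ l # fs) = 1" using distinct_card[OF Nil(4)] Nil(5) by simp
  then show ?case using Nil by simp
next
  case (Cons x xs)
  obtain k ls0 where ls: "as @ l # fs = k # ls0" by (cases "as @ l # fs") auto
  have ls0: "length ls0 = repeats (x # xs)"
    using card_leaves_words[OF Cons.prems(1-3)] distinct_card[OF Cons.prems(4)] Cons.prems(5) ls
    by (metis Suc_inject length_Cons)
  define ls' where "ls' = (if x \<in> set xs then ls0 else x # ls0)"
  note step = leaf_list_step[OF Cons.prems(1,2), of k ls0, folded ls, OF Cons.prems(4,5), folded ls'_def]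
  have len: "card (V - {k}) = Suc (length xs)" using Cons.prems step(1) by simp
  have fin: "finite (V - {k})" using Cons.prems by simp
  have tree: "tree_of_word (x # xs) (as @ l # fs) =
      (fst (tree_of_word xs ls'), insert (x, k) (snd (tree_of_word xs ls')))"
    using tree_of_word_Cons[of xs x ls0 "fst (tree_of_word xs ls')" "snd (tree_of_word xs ls')" k]
    by (simp add: ls ls'_def)
  have lev: "\<And>u v. (u, v) \<in> snd (tree_of_word xs ls') \<Longrightarrow> \<delta> v = Suc (\<delta> u)"
    "\<delta> (fst (tree_of_word xs ls')) = 0" "\<delta> k = Suc (\<delta> x)"
    using Cons.prems(6,7) unfolding tree by auto
  note IH = Cons.IH[OF step(5) fin len, of _ _ fs]
  show ?case
  proof (cases as)
    \<comment> \<open>The deleted leaf is attached later than \<open>l\<close>, so neither the gap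
      nor \<open>fs\<close> is affected.\<close>
    case (Cons a as')
    then have ka: "k = a" "ls0 = as' @ l # fs" using ls by auto
    then have "repeats (x # xs) > length fs" using ls0 by simp
    then have g: "gap (length fs) (x # xs) = gap (length fs) xs" by simp
    define bs where "bs = (if x \<in> set xs then as' else x # as')"
    have "ls' = bs @ l # fs" by (simp add: ls'_def ka bs_def)
    then show ?thesis using IH[of bs l] step lev g by metis
  next
    case as: Nil
    then have ka: "k = l" "ls0 = fs" using ls by auto
    then have rep: "repeats (x # xs) = length fs" using ls0 by simp
    show ?thesis
    proof (cases "x \<in> set xs")
      \<comment> \<open>Here \<open>x\<close> still occurs in \<open>xs\<close>, so it is the vertex
        where the path of \<open>l\<close> is attached, and the leaves of the remaining tree are
        exactly \<open>fs\<close>.\<close>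
      case True
      have "leaves (V - {k}) (d(x := d x - 1)) \<noteq> {}"
        using words_length[OF fin step(5)] len by (intro leaves_nonempty[OF fin]) simp
      then have fs_ne: "fs \<noteq> []" using step(7) True by (auto simp: ls'_def ka)
      have "tree_of_word xs ls' \<in> arborescences (V - {k}) (d(x := d x - 1))"
        by (rule tree_of_word_in_arborescences[OF step(5) fin len step(6,7)])
      then have "\<delta> x \<le> Max (\<delta> ` leaves (V - {k}) (d(x := d x - 1)))"
        using lev(1) step(3) level_le_leaf[OF _ fin,
            of "fst (tree_of_word xs ls')" "snd (tree_of_word xs ls')" "d(x := d x - 1)" \<delta> x]
        by (metis prod.collapse)
      also have "\<dots> = Max (\<delta> ` set fs)" using True step by (simp add: ls'_def ka)
      also have "\<dots> \<le> Max (insert 0 (\<delta> ` set fs))"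
        using fs_ne by (intro Max_mono) auto
      finally show ?thesis using True rep lev ka by simp
    next
      \<comment> \<open>Now \<open>x\<close> becomes a leaf and takes the place of \<open>l\<close>;
        the path of \<open>l\<close> is one edge longer than that of \<open>x\<close>.\<close>
      case False
      then have "ls' = [] @ x # fs" by (simp add: ls'_def ka)
      then have "\<delta> x \<le> gap (length fs) xs + Max (insert 0 (\<delta> ` set fs))"
        using IH[of "[]" x] step lev by metis
      then show ?thesis using False rep lev ka by simp
    qed
  qed
qed

lemma depth_leaf_le_gap:
  assumes "xs \<in> words V d" "finite V" "card V = Suc (sum d V)"
    "distinct (as @ l # fs)" "set (as @ l # fs) = leaves V d"
  defines "t \<equiv> tree_of_word xs (as @ l # fs)"
  shows "depth t l \<le> gap (length fs) xs + Max (insert 0 (depth t ` set fs))"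
proof -
  have "t \<in> arborescences V d"
    using assms words_length[OF assms(2,1)] by (auto intro!: tree_of_word_in_arborescences)
  then have a: "arborescence V (fst t) (snd t)" by (auto simp: arborescences_def)
  show ?thesis
    using assms words_length[OF assms(2,1)] depth_root[OF a] depth_edge[OF a]
    by (intro level_leaf_le_gap) auto
qed

section \<open>Prefixes of random permutations\<close>

lemma sum_of_bool_card: "finite A \<Longrightarrow> (\<Sum>x\<in>A. of_bool (P x)) = real (card {x\<in>A. P x})"
  by (simp add: of_bool_def sum.If_cases Int_def)

text \<open>The left-hand side consists of the first two terms of the binomial expansion; the others
  are nonnegative.\<close>

lemma bernoulli_two_terms:
  fixes r e :: real
  assumes "0 \<le> r" "0 \<le> e"
  shows "r ^ Suc b + Suc b * r ^ b * e \<le> (r + e) ^ Suc b"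
proof (induction b)
  case (Suc b)
  have "r ^ Suc (Suc b) + Suc (Suc b) * r ^ Suc b * e
      \<le> (r ^ Suc b + Suc b * r ^ b * e) * (r + e)"
    using assms by (simp add: algebra_simps)
  also have "\<dots> \<le> (r + e) ^ Suc b * (r + e)"
    using Suc assms by (intro mult_right_mono) auto
  finally show ?case by (simp add: mult.commute)
qed simp

text \<open>Sampling without replacement contains a fixed set with at most the probability of
  independent sampling. The induction conditions on the first entry, which lies in \<open>Y\<close>
  with probability \<open>card Y / card C\<close>; the resulting average is of the form treated in
  \<open>bernoulli_two_terms\<close>.\<close>

lemma card_permutations_prefix_superset:
  assumes "finite C" "Y \<subseteq> C" "t \<le> card C"
  shows "real (card {l \<in> permutations_of_set C. Y \<subseteq> set (take t l)})
      \<le> (real t / real (card C)) ^ card Y * fact (card C)"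
  using assms
proof (induction "card C" arbitrary: C Y t)
  case 0
  then show ?case by simp
next
  case (Suc N)
  have finY: "finite Y" using Suc finite_subset by blast
  show ?case
  proof (cases t)
    case 0
    show ?thesis
    proof (cases "Y = {}")
      case True
      then show ?thesis using Suc.prems by (simp add: 0)
    next
      case False
      then show ?thesis using finY by (simp add: 0 power_0_left card_eq_0_iff)
    qed
  next
    case t: (Suc t')
    \<comment> \<open>The ratio left after the first entry, \<open>N\<close> being
      \<open>card C - 1\<close>. If \<open>N = 0\<close>, then \<open>t' = 0\<close>, and division
      by zero gives the right value 0.\<close>
    define r where "r = real t' / real N"
    have r: "0 \<le> r" "r \<le> 1" "r * N = t'"
      using Suc.hyps(2) Suc.prems(3) t by (auto simp: r_def divide_le_eq_1)
    have b: "card Y \<le> Suc N" using Suc card_mono by metis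
    let ?S = "\<lambda>C Y t. {l \<in> permutations_of_set C. Y \<subseteq> set (take t l)}"
    have "C \<noteq> {}" using Suc by auto
    then have eq: "?S C Y t = (\<Union>a\<in>C. (#) a ` ?S (C - {a}) (Y - {a}) t')"
    proof (intro equalityI subsetI)
      fix l assume l: "l \<in> ?S C Y t"
      then obtain a m where a: "a \<in> C" "l = a # m" "m \<in> permutations_of_set (C - {a})"
        using permutations_of_set_nonempty[OF \<open>C \<noteq> {}\<close>] by auto
      then have "m \<in> ?S (C - {a}) (Y - {a}) t'" using l by (auto simp: t)
      then show "l \<in> (\<Union>a\<in>C. (#) a ` ?S (C - {a}) (Y - {a}) t')" using a by blast
    next
      fix l assume "l \<in> (\<Union>a\<in>C. (#) a ` ?S (C - {a}) (Y - {a}) t')"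
      then show "l \<in> ?S C Y t"
        using permutations_of_set_nonempty[OF \<open>C \<noteq> {}\<close>] by (auto simp: t)
    qed
    have "card (?S C Y t) \<le> (\<Sum>a\<in>C. card ((#) a ` ?S (C - {a}) (Y - {a}) t'))"
      unfolding eq using Suc.prems by (intro card_UN_le)
    also have "\<dots> = (\<Sum>a\<in>C. card (?S (C - {a}) (Y - {a}) t'))"
      by (intro sum.cong card_image) auto
    finally have "real (card (?S C Y t)) \<le> real (\<Sum>a\<in>C. card (?S (C - {a}) (Y - {a}) t'))"
      by (rule of_nat_mono)
    also have "\<dots> = (\<Sum>a\<in>C. real (card (?S (C - {a}) (Y - {a}) t')))" by simp
    also have "\<dots> \<le> (\<Sum>a\<in>C. r ^ card (Y - {a}) * fact N)"
    proof (rule sum_mono)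
      fix a assume a: "a \<in> C"
      then have "card (C - {a}) = N" using Suc by simp
      then show "real (card (?S (C - {a}) (Y - {a}) t')) \<le> r ^ card (Y - {a}) * fact N"
        using Suc.hyps(1)[of "C - {a}" "Y - {a}" t'] Suc.prems Suc.hyps(2) t
        by (auto simp: r_def)
    qed
    also have "\<dots> = (\<Sum>a\<in>C. r ^ card (Y - {a})) * fact N" by (simp add: sum_distrib_right)
    also have "\<dots> \<le> Suc N * (Suc t' / Suc N) ^ card Y * fact N"
    proof (rule mult_right_mono)
      have "(\<Sum>a\<in>C. r ^ card (Y - {a})) = (\<Sum>a\<in>Y. r ^ card (Y - {a})) + (\<Sum>a\<in>C - Y. r ^ card (Y - {a}))"
        by (subst sum.subset_diff[OF Suc.prems(2,1)]) (rule add.commute)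
      also have "(\<Sum>a\<in>Y. r ^ card (Y - {a})) = (\<Sum>a\<in>Y. r ^ (card Y - 1))"
        by (intro sum.cong) auto
      also have "(\<Sum>a\<in>C - Y. r ^ card (Y - {a})) = (\<Sum>a\<in>C - Y. r ^ card Y)"
        by (intro sum.cong) auto
      also have "(\<Sum>a\<in>Y. r ^ (card Y - 1)) + (\<Sum>a\<in>C - Y. r ^ card Y)
          = card Y * r ^ (card Y - 1) + (Suc N - card Y) * r ^ card Y"
        using Suc.prems Suc.hyps(2) finY by (simp add: card_Diff_subset)
      also have "\<dots> \<le> Suc N * (Suc t' / Suc N) ^ card Y"
      proof (cases "card Y")
        case (Suc b)
        \<comment> \<open>The ratio for the full set exceeds \<open>r\<close> by exactly the
          increment that the two-term bound needs.\<close>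
        have eq: "real (Suc t') / Suc N = r + (1 - r) / Suc N"
          using r(3) by (simp add: field_simps)
        have "card Y * r ^ (card Y - 1) + (Suc N - card Y) * r ^ card Y
            = Suc N * (r ^ Suc b + Suc b * r ^ b * ((1 - r) / Suc N))"
          using b Suc by (simp add: of_nat_diff field_simps)
        also have "\<dots> \<le> Suc N * (r + (1 - r) / Suc N) ^ Suc b"
          using r by (intro mult_left_mono bernoulli_two_terms) auto
        finally show ?thesis using Suc eq by simp
      qed simp
      finally show "(\<Sum>a\<in>C. r ^ card (Y - {a})) \<le> Suc N * (Suc t' / Suc N) ^ card Y" .
    qed simp
    also have "\<dots> = (real t / real (card C)) ^ card Y * fact (card C)"
      unfolding Suc.hyps(2)[symmetric] t by (simp del: of_nat_Suc)
    finally show ?thesis .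
  qed
qed

text \<open>Avoiding a prefix means lying in the complementary suffix, which reversal turns into a
  prefix of length \<open>card C - t\<close>.\<close>

lemma card_permutations_prefix_disjoint:
  assumes "finite C" "D \<subseteq> C" "t \<le> card C"
  shows "real (card {l \<in> permutations_of_set C. set (take t l) \<inter> D = {}})
      \<le> (1 - real t / real (card C)) ^ card D * fact (card C)"
proof (cases "card C = 0")
  case True
  then show ?thesis using assms by simp
next
  case False
  have "{l \<in> permutations_of_set C. set (take t l) \<inter> D = {}}
      \<subseteq> rev ` {l \<in> permutations_of_set C. D \<subseteq> set (take (card C - t) l)}"
  proof
    fix l assume "l \<in> {l \<in> permutations_of_set C. set (take t l) \<inter> D = {}}"
    then have l: "l \<in> permutations_of_set C" "set (take t l) \<inter> D = {}" by auto
    have "set l = set (take t l) \<union> set (drop t l)" by (metis append_take_drop_id set_append)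
    then have "D \<subseteq> set (drop t l)" using l assms by (auto dest: permutations_of_setD)
    moreover have "take (card C - t) (rev l) = rev (drop t l)"
      using l by (simp add: take_rev length_finite_permutations_of_set assms)
    moreover have "rev l \<in> permutations_of_set C" using l by (auto simp: permutations_of_set_def)
    ultimately show "l \<in> rev ` {l \<in> permutations_of_set C. D \<subseteq> set (take (card C - t) l)}"
      by (intro image_eqI[of _ _ "rev l"]) auto
  qed
  then have "card {l \<in> permutations_of_set C. set (take t l) \<inter> D = {}}
      \<le> card {l \<in> permutations_of_set C. D \<subseteq> set (take (card C - t) l)}"
    by (intro surj_card_le) auto
  also have "real \<dots> \<le> (real (card C - t) / real (card C)) ^ card D * fact (card C)"
    using assms by (intro card_permutations_prefix_superset) auto
  also have "real (card C - t) / real (card C) = 1 - real t / real (card C)"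
    using False assms by (simp add: of_nat_diff diff_divide_distrib)
  finally show ?thesis by simp
qed

text \<open>
  Expanding the exponential into a sum over sets of unseen colours leaves only probabilities that a
  fixed set is avoided by a prefix, so no independence is needed.
\<close>

lemma sum_permutations_exp_seen_le:
  fixes a :: "'i \<Rightarrow> real" and f :: "'c \<Rightarrow> 'i"
  assumes "finite C" "t \<le> card C" "0 \<le> \<mu>" "\<And>i. 0 \<le> a i"
  shows "(\<Sum>l\<in>permutations_of_set C. exp (- \<mu> * sum a (f ` set (take t l))))
    \<le> (\<Prod>i\<in>f ` C. exp (- \<mu> * a i)
          + (1 - exp (- \<mu> * a i)) * (1 - real t / real (card C)) ^ card {c\<in>C. f c = i})
       * fact (card C)"
proof -
  define g where "g i = exp (- \<mu> * a i)" for i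
  define q where "q = 1 - real t / real (card C)"
  define I where "I = f ` C"
  define D where "D Z = {c\<in>C. f c \<in> Z}" for Z
  have finI: "finite I" using assms by (simp add: I_def)
  have g: "0 \<le> g i" "g i \<le> 1" for i using assms by (auto simp: g_def)
  have exp_eq: "exp (- \<mu> * sum a (f ` set (take t l)))
      = (\<Sum>Z\<in>Pow I. (\<Prod>i\<in>Z. 1 - g i) * (\<Prod>i\<in>I - Z. g i) * of_bool (set (take t l) \<inter> D Z = {}))"
    if l: "l \<in> permutations_of_set C" for l
  proof -
    let ?X = "set (take t l)"
    have X: "?X \<subseteq> C" using l by (auto dest: permutations_of_setD in_set_takeD)
    then have fX: "f ` ?X \<subseteq> I" by (auto simp: I_def)
    have "exp (- \<mu> * sum a (f ` ?X)) = (\<Prod>i\<in>f ` ?X. g i)"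
      by (simp add: g_def sum_distrib_left exp_sum)
    also have "\<dots> = (\<Prod>i\<in>I. if i \<in> f ` ?X then g i else 1)"
      using finI fX by (simp add: prod.If_cases Int_absorb1)
    \<comment> \<open>Writing each factor as a sum of two terms lets the product expand over sets
      \<open>Z\<close> of colours that are all unseen.\<close>
    also have "\<dots> = (\<Prod>i\<in>I. (1 - g i) * of_bool (i \<notin> f ` ?X) + g i)"
      by (intro prod.cong) auto
    also have "\<dots> = (\<Sum>Z\<in>Pow I. (\<Prod>i\<in>Z. (1 - g i) * of_bool (i \<notin> f ` ?X)) * (\<Prod>i\<in>I - Z. g i))"
      by (rule prod_add[OF finI])
    also have "\<dots> = (\<Sum>Z\<in>Pow I. (\<Prod>i\<in>Z. 1 - g i) * (\<Prod>i\<in>I - Z. g i) * of_bool (?X \<inter> D Z = {}))"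
    proof (rule sum.cong[OF refl])
      fix Z assume "Z \<in> Pow I"
      then have finZ: "finite Z" using finI finite_subset by auto
      have "(\<Prod>i\<in>Z. of_bool (i \<notin> f ` ?X) :: real) = of_bool (?X \<inter> D Z = {})"
      proof (cases "?X \<inter> D Z = {}")
        case True
        then have "\<forall>i\<in>Z. i \<notin> f ` ?X" using X by (auto simp: D_def)
        then show ?thesis using True by simp
      next
        case False
        then obtain i where "i \<in> Z" "i \<in> f ` ?X" by (auto simp: D_def)
        then have "(\<Prod>i\<in>Z. of_bool (i \<notin> f ` ?X) :: real) = 0"
          using finZ by (intro prod_zero) auto
        then show ?thesis using False by simp
      qed
      then show "(\<Prod>i\<in>Z. (1 - g i) * of_bool (i \<notin> f ` ?X)) * (\<Prod>i\<in>I - Z. g i)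
          = (\<Prod>i\<in>Z. 1 - g i) * (\<Prod>i\<in>I - Z. g i) * of_bool (?X \<inter> D Z = {})"
        by (simp add: prod.distrib mult_ac)
    qed
    finally show ?thesis .
  qed
  have cardD: "card (D Z) = (\<Sum>i\<in>Z. card {c\<in>C. f c = i})" if "Z \<subseteq> I" for Z
  proof -
    have "D Z = (\<Union>i\<in>Z. {c\<in>C. f c = i})" by (auto simp: D_def)
    then show ?thesis using assms that finI
      by (auto intro!: card_UN_disjoint simp: finite_subset)
  qed
  have "(\<Sum>l\<in>permutations_of_set C. exp (- \<mu> * sum a (f ` set (take t l))))
      = (\<Sum>l\<in>permutations_of_set C. \<Sum>Z\<in>Pow I.
          (\<Prod>i\<in>Z. 1 - g i) * (\<Prod>i\<in>I - Z. g i) * of_bool (set (take t l) \<inter> D Z = {}))"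
    by (intro sum.cong refl exp_eq)
  also have "\<dots> = (\<Sum>Z\<in>Pow I. (\<Prod>i\<in>Z. 1 - g i) * (\<Prod>i\<in>I - Z. g i) *
          (\<Sum>l\<in>permutations_of_set C. of_bool (set (take t l) \<inter> D Z = {})))"
    unfolding sum_distrib_left by (rule sum.swap)
  \<comment> \<open>The values of \<open>g\<close> lie between 0 and 1, so all coefficients are
    nonnegative and each avoidance probability may be replaced by its bound.\<close>
  also have "\<dots> \<le> (\<Sum>Z\<in>Pow I. (\<Prod>i\<in>Z. 1 - g i) * (\<Prod>i\<in>I - Z. g i) *
          (q ^ card (D Z) * fact (card C)))"
  proof (rule sum_mono)
    fix Z
    have "(\<Sum>l\<in>permutations_of_set C. of_bool (set (take t l) \<inter> D Z = {}) :: real)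
        = real (card {l \<in> permutations_of_set C. set (take t l) \<inter> D Z = {}})"
      by (simp add: sum_of_bool_card del: sum_of_bool_eq)
    also have "\<dots> \<le> q ^ card (D Z) * fact (card C)"
      unfolding q_def using assms
      by (intro card_permutations_prefix_disjoint) (auto simp: D_def)
    finally show "(\<Prod>i\<in>Z. 1 - g i) * (\<Prod>i\<in>I - Z. g i) *
          (\<Sum>l\<in>permutations_of_set C. of_bool (set (take t l) \<inter> D Z = {}))
        \<le> (\<Prod>i\<in>Z. 1 - g i) * (\<Prod>i\<in>I - Z. g i) * (q ^ card (D Z) * fact (card C))"
      using g by (intro mult_left_mono mult_nonneg_nonneg prod_nonneg) auto
  qed
  \<comment> \<open>The power of \<open>q\<close> splits over the colours in \<open>Z\<close>, so
    the sum folds back into a product.\<close>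
  also have "\<dots> = (\<Sum>Z\<in>Pow I. (\<Prod>i\<in>Z. (1 - g i) * q ^ card {c\<in>C. f c = i}) * (\<Prod>i\<in>I - Z. g i)) * fact (card C)"
    unfolding sum_distrib_right
    by (intro sum.cong) (auto simp: cardD power_sum prod.distrib mult_ac)
  also have "\<dots> = (\<Prod>i\<in>I. (1 - g i) * q ^ card {c\<in>C. f c = i} + g i) * fact (card C)"
    by (simp add: prod_add[OF finI])
  finally show ?thesis by (simp add: I_def g_def q_def add.commute)
qed

section \<open>Exponential moments of the number of repeats\<close>

lemma sum_power_card_Pow:
  fixes s :: "'b :: comm_semiring_1"
  assumes "finite A"
  shows "(\<Sum>Y\<in>Pow A. s ^ card Y) = (1 + s) ^ card A"
  using prod_add[OF assms, of "\<lambda>_. s" "\<lambda>_. 1"] by (simp add: add.commute)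

text \<open>Averaging the sums over all subsets for \<open>s\<close> and for \<open>- s\<close>
  cancels the odd sizes.\<close>

lemma sum_power_card_even:
  fixes s :: real
  assumes "finite A"
  shows "(\<Sum>Y | Y \<subseteq> A \<and> even (card Y). s ^ card Y) = ((1 + s) ^ card A + (1 - s) ^ card A) / 2"
proof -
  have "(\<Sum>Y | Y \<subseteq> A \<and> even (card Y). s ^ card Y)
      = (\<Sum>Y\<in>Pow A. if even (card Y) then s ^ card Y else 0)"
    using assms by (intro sum.mono_neutral_cong_left) auto
  also have "\<dots> = (\<Sum>Y\<in>Pow A. (s ^ card Y + (- s) ^ card Y) / 2)"
    by (intro sum.cong) auto
  also have "\<dots> = ((1 + s) ^ card A + (1 - s) ^ card A) / 2"
    using sum_power_card_Pow[OF assms, of s] sum_power_card_Pow[OF assms, of "- s"]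
    by (simp add: sum_divide_distrib[symmetric] sum.distrib)
  finally show ?thesis .
qed

text \<open>
  The number of even subsets of \<open>X\<close> is two to the number of repeated colours in \<open>X\<close>. This turns the
  exponential moment of the number of repeats into a sum of probabilities that a fixed set is
  contained in a prefix.
\<close>

definition even_subsets :: "('c \<Rightarrow> 'i) \<Rightarrow> 'c set \<Rightarrow> 'c set set" where
  "even_subsets f X = {Y. Y \<subseteq> X \<and> (\<forall>i. even (card {c\<in>Y. f c = i}))}"

text \<open>The choices of an even subset within the colour classes are independent, so the
  generating function factorises.\<close>

lemma sum_power_card_even_subsets:
  fixes s :: real
  assumes "finite I" "finite X" "f ` X \<subseteq> I"
  shows "(\<Sum>Y\<in>even_subsets f X. s ^ card Y)
      = (\<Prod>i\<in>I. ((1 + s) ^ card {c\<in>X. f c = i} + (1 - s) ^ card {c\<in>X. f c = i}) / 2)"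
  using assms
proof (induction I arbitrary: X rule: finite_induct)
  case empty
  then show ?case by (simp add: even_subsets_def cong: conj_cong)
next
  case (insert i I)
  define A where "A = {c\<in>X. f c = i}"
  define B where "B = {c\<in>X. f c \<noteq> i}"
  define U where "U = {Y. Y \<subseteq> A \<and> even (card Y)}"
  have fin: "finite A" "finite B" using insert by (auto simp: A_def B_def)
  have AB: "A \<inter> B = {}" by (auto simp: A_def B_def)
  have restr: "{c \<in> Y \<union> Z. f c = j} = (if j = i then Y else {c \<in> Z. f c = j})"
    if "Y \<subseteq> A" "Z \<subseteq> B" for Y Z j
    using that by (auto simp: A_def B_def)
  have "even_subsets f X = (\<lambda>(Y, Z). Y \<union> Z) ` (U \<times> even_subsets f B)"
  proof (intro equalityI subsetI)
    fix W assume W: "W \<in> even_subsets f X"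
    have "{c\<in>W. f c = i} \<in> U" using W by (auto simp: even_subsets_def U_def A_def)
    moreover have "{c\<in>W. f c \<noteq> i} \<in> even_subsets f B"
    proof -
      have "{c \<in> {c\<in>W. f c \<noteq> i}. f c = j} = (if j = i then {} else {c\<in>W. f c = j})" for j by auto
      then show ?thesis using W by (auto simp: even_subsets_def B_def)
    qed
    moreover have "W = {c\<in>W. f c = i} \<union> {c\<in>W. f c \<noteq> i}" by auto
    ultimately show "W \<in> (\<lambda>(Y, Z). Y \<union> Z) ` (U \<times> even_subsets f B)"
      by (intro image_eqI[of _ _ "({c\<in>W. f c = i}, {c\<in>W. f c \<noteq> i})"]) auto
  next
    fix W assume "W \<in> (\<lambda>(Y, Z). Y \<union> Z) ` (U \<times> even_subsets f B)"
    then obtain Y Z where YZ: "W = Y \<union> Z" "Y \<in> U" "Z \<in> even_subsets f B" by auto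
    then have "Y \<subseteq> A" "Z \<subseteq> B" by (auto simp: U_def even_subsets_def)
    then show "W \<in> even_subsets f X"
      using YZ restr[of Y Z] by (auto simp: U_def even_subsets_def A_def B_def)
  qed
  moreover have "inj_on (\<lambda>(Y, Z). Y \<union> Z) (U \<times> even_subsets f B)"
  proof (rule inj_onI, clarify)
    fix Y Z Y' Z' assume "Y \<in> U" "Z \<in> even_subsets f B" "Y' \<in> U" "Z' \<in> even_subsets f B"
      and eq: "Y \<union> Z = Y' \<union> Z'"
    then have "Y \<subseteq> A" "Z \<subseteq> B" "Y' \<subseteq> A" "Z' \<subseteq> B" by (auto simp: U_def even_subsets_def)
    then show "Y = Y' \<and> Z = Z'" using eq AB by blast
  qed
  ultimately have "(\<Sum>W\<in>even_subsets f X. s ^ card W)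
      = (\<Sum>(Y, Z)\<in>U \<times> even_subsets f B. s ^ card (Y \<union> Z))"
    by (simp add: sum.reindex case_prod_unfold)
  also have "\<dots> = (\<Sum>(Y, Z)\<in>U \<times> even_subsets f B. s ^ card Y * s ^ card Z)"
  proof (intro sum.cong refl, clarify)
    fix Y Z assume "Y \<in> U" "Z \<in> even_subsets f B"
    then have "Y \<subseteq> A" "Z \<subseteq> B" by (auto simp: U_def even_subsets_def)
    then have "card (Y \<union> Z) = card Y + card Z"
      using fin AB by (intro card_Un_disjoint) (auto intro: finite_subset)
    then show "s ^ card (Y \<union> Z) = s ^ card Y * s ^ card Z" by (simp add: power_add)
  qed
  also have "\<dots> = (\<Sum>Y\<in>U. s ^ card Y) * (\<Sum>Z\<in>even_subsets f B. s ^ card Z)"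
    by (simp add: sum_product sum.cartesian_product)
  also have "(\<Sum>Y\<in>U. s ^ card Y) = ((1 + s) ^ card A + (1 - s) ^ card A) / 2"
    unfolding U_def by (rule sum_power_card_even[OF fin(1)])
  also have "(\<Sum>Z\<in>even_subsets f B. s ^ card Z)
      = (\<Prod>j\<in>I. ((1 + s) ^ card {c\<in>B. f c = j} + (1 - s) ^ card {c\<in>B. f c = j}) / 2)"
    using insert fin by (intro insert.IH) (auto simp: B_def)
  also have "\<dots> = (\<Prod>j\<in>I. ((1 + s) ^ card {c\<in>X. f c = j} + (1 - s) ^ card {c\<in>X. f c = j}) / 2)"
  proof (intro prod.cong refl)
    fix j assume "j \<in> I"
    then have "{c\<in>B. f c = j} = {c\<in>X. f c = j}" using insert by (auto simp: B_def)
    then show "((1 + s) ^ card {c\<in>B. f c = j} + (1 - s) ^ card {c\<in>B. f c = j}) / 2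
       = ((1 + s) ^ card {c\<in>X. f c = j} + (1 - s) ^ card {c\<in>X. f c = j}) / 2" by simp
  qed
  finally show ?case using insert by (simp add: A_def)
qed

text \<open>At \<open>s = 1\<close> a colour class of size m > 0 contributes the factor 2^(m -
  1).\<close>

lemma card_even_subsets:
  assumes "finite X"
  shows "real (card (even_subsets f X)) = 2 ^ (card X - card (f ` X))"
proof -
  have "real (card (even_subsets f X)) = (\<Sum>Y\<in>even_subsets f X. 1 ^ card Y)" by simp
  also have "\<dots> = (\<Prod>i\<in>f ` X. (2 ^ card {c\<in>X. f c = i} + 0 ^ card {c\<in>X. f c = i}) / 2)"
    using sum_power_card_even_subsets[of "f ` X" X f 1] assms by simp
  also have "\<dots> = (\<Prod>i\<in>f ` X. 2 ^ (card {c\<in>X. f c = i} - 1))"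
  proof (intro prod.cong refl)
    fix i assume "i \<in> f ` X"
    then have "0 < card {c\<in>X. f c = i}" using assms by (auto simp: card_gt_0_iff)
    then show "(2 ^ card {c\<in>X. f c = i} + 0 ^ card {c\<in>X. f c = i}) / 2 = (2::real) ^ (card {c\<in>X. f c = i} - 1)"
      by (cases "card {c\<in>X. f c = i}") auto
  qed
  also have "\<dots> = 2 ^ (\<Sum>i\<in>f ` X. card {c\<in>X. f c = i} - 1)" by (simp add: power_sum)
  also have "(\<Sum>i\<in>f ` X. card {c\<in>X. f c = i} - 1) = card X - card (f ` X)"
  proof -
    have "(\<Sum>i\<in>f ` X. card {c\<in>X. f c = i} - 1) + (\<Sum>i\<in>f ` X. 1) = (\<Sum>i\<in>f ` X. card {c\<in>X. f c = i})"
      unfolding sum.distrib[symmetric]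
    proof (intro sum.cong refl)
      fix i assume "i \<in> f ` X"
      then have "0 < card {c\<in>X. f c = i}" using assms by (auto simp: card_gt_0_iff)
      then show "card {c\<in>X. f c = i} - 1 + 1 = card {c\<in>X. f c = i}" by simp
    qed
    also have "\<dots> = card (\<Union>i\<in>f ` X. {c\<in>X. f c = i})"
      using assms by (intro card_UN_disjoint[symmetric]) auto
    also have "(\<Union>i\<in>f ` X. {c\<in>X. f c = i}) = X" by auto
    finally show ?thesis by simp
  qed
  finally show ?thesis .
qed

lemma sum_permutations_power_repeats_le:
  fixes f :: "'c \<Rightarrow> 'i"
  assumes "finite C" "t \<le> card C"
  defines "s \<equiv> real t / real (card C)"
  shows "(\<Sum>l\<in>permutations_of_set C. 2 ^ (t - card (f ` set (take t l))) :: real)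
    \<le> (\<Prod>i\<in>f ` C. ((1 + s) ^ card {c\<in>C. f c = i} + (1 - s) ^ card {c\<in>C. f c = i}) / 2) * fact (card C)"
proof -
  have fin: "finite (even_subsets f C)"
    by (rule finite_subset[of _ "Pow C"]) (use assms(1) in \<open>auto simp: even_subsets_def\<close>)
  have "(\<Sum>l\<in>permutations_of_set C. 2 ^ (t - card (f ` set (take t l))) :: real)
      = (\<Sum>l\<in>permutations_of_set C. \<Sum>Y\<in>even_subsets f C. of_bool (Y \<subseteq> set (take t l)))"
  proof (rule sum.cong[OF refl])
    fix l assume l: "l \<in> permutations_of_set C"
    have X: "set (take t l) \<subseteq> C" using l by (auto dest: permutations_of_setD in_set_takeD)
    have "card (set (take t l)) = t"
      using l assms(1,2) length_finite_permutations_of_set[OF l]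
      by (subst distinct_card) (auto dest: permutations_of_setD)
    then have "(2::real) ^ (t - card (f ` set (take t l))) = real (card (even_subsets f (set (take t l))))"
      by (simp add: card_even_subsets)
    also have "even_subsets f (set (take t l)) = {Y\<in>even_subsets f C. Y \<subseteq> set (take t l)}"
      using X by (auto simp: even_subsets_def)
    also have "real (card \<dots>) = (\<Sum>Y\<in>even_subsets f C. of_bool (Y \<subseteq> set (take t l)))"
      using fin by (simp add: sum_of_bool_card del: sum_of_bool_eq)
    finally show "(2::real) ^ (t - card (f ` set (take t l)))
        = (\<Sum>Y\<in>even_subsets f C. of_bool (Y \<subseteq> set (take t l)))" .
  qed
  also have "\<dots> = (\<Sum>Y\<in>even_subsets f C. \<Sum>l\<in>permutations_of_set C. of_bool (Y \<subseteq> set (take t l)))"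
    by (rule sum.swap)
  also have "\<dots> = (\<Sum>Y\<in>even_subsets f C. real (card {l\<in>permutations_of_set C. Y \<subseteq> set (take t l)}))"
    by (simp add: sum_of_bool_card del: sum_of_bool_eq)
  also have "\<dots> \<le> (\<Sum>Y\<in>even_subsets f C. s ^ card Y * fact (card C))"
    unfolding s_def using assms(1,2)
    by (intro sum_mono card_permutations_prefix_superset) (auto simp: even_subsets_def)
  also have "\<dots> = (\<Prod>i\<in>f ` C. ((1 + s) ^ card {c\<in>C. f c = i} + (1 - s) ^ card {c\<in>C. f c = i}) / 2) * fact (card C)"
    using assms(1) by (simp add: sum_distrib_right[symmetric] sum_power_card_even_subsets[of "f ` C"])
  finally show ?thesis .
qed

section \<open>Permutations stopped at a random time\<close>

definition pending :: "('c \<Rightarrow> 'i) \<Rightarrow> 'c set \<Rightarrow> 'c list \<Rightarrow> 'c set" where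
  "pending f C b = {c \<in> C - set b. f c \<in> f ` set b}"

lemma card_permutations_prefix_fixed:
  assumes "finite C" "l0 \<in> permutations_of_set C" "j \<le> card C"
  defines "b \<equiv> take j l0"
  shows "{l \<in> permutations_of_set C. take j l = b} = (@) b ` permutations_of_set (C - set b)"
    and "card (C - set b) = card C - j"
proof -
  have l0: "set l0 = C" "distinct l0" "length l0 = card C"
    using assms length_finite_permutations_of_set by (auto dest: permutations_of_setD)
  have b: "set b \<subseteq> C" "distinct b" "length b = j" using l0 assms by (auto simp: b_def dest: in_set_takeD)
  show "card (C - set b) = card C - j" using b assms by (simp add: card_Diff_subset distinct_card)
  show "{l \<in> permutations_of_set C. take j l = b} = (@) b ` permutations_of_set (C - set b)"
  proof (intro equalityI subsetI)
    fix l assume l: "l \<in> {l \<in> permutations_of_set C. take j l = b}"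
    then have eq: "l = b @ drop j l" by (metis (mono_tags) append_take_drop_id mem_Collect_eq)
    have "set l = C" "distinct l" using l by (auto dest: permutations_of_setD)
    then have "distinct (b @ drop j l)" "set (b @ drop j l) = C" using eq by simp_all
    then have "drop j l \<in> permutations_of_set (C - set b)" by (auto simp: permutations_of_set_def)
    then show "l \<in> (@) b ` permutations_of_set (C - set b)" using eq by blast
  next
    fix l assume "l \<in> (@) b ` permutations_of_set (C - set b)"
    then show "l \<in> {l \<in> permutations_of_set C. take j l = b}"
      using b by (auto simp: permutations_of_set_def)
  qed
qed

text \<open>The event is split by the stopped prefix \<open>b\<close>. Given \<open>b\<close>, the
  rest is a uniform permutation of the remaining elements, for which avoiding the pending set is a
  case of \<open>card_permutations_prefix_disjoint\<close>. The hypothesis \<open>stop\<close> says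
  that \<open>J\<close> is determined by the prefix that it cuts off.\<close>

lemma card_permutations_stopped_le:
  fixes f :: "'c \<Rightarrow> 'i" and J :: "'c list \<Rightarrow> nat"
  assumes "finite C"
    and stop: "\<And>l l'. l \<in> permutations_of_set C \<Longrightarrow> l' \<in> permutations_of_set C \<Longrightarrow>
      take (J l) l' = take (J l) l \<Longrightarrow> J l' = J l"
    and \<rho>: "\<And>l. l \<in> permutations_of_set C \<Longrightarrow> P (take (J l) l) \<Longrightarrow> \<rho> \<le> real (card (pending f C (take (J l) l)))"
    and "0 \<le> \<rho>"
  shows "real (card {l \<in> permutations_of_set C. J l + h \<le> card C \<and> P (take (J l) l) \<and>
      set (take h (drop (J l) l)) \<inter> pending f C (take (J l) l) = {}})
    \<le> exp (- (real h * \<rho> / real (card C))) * fact (card C)"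
proof -
  let ?P = "permutations_of_set C"
  define G where "G = {l \<in> ?P. J l + h \<le> card C \<and> P (take (J l) l) \<and>
      set (take h (drop (J l) l)) \<inter> pending f C (take (J l) l) = {}}"
  define F where "F l = take (J l) l" for l
  define \<epsilon> where "\<epsilon> = exp (- (real h * \<rho> / real (card C)))"
  have fibre: "real (card {l\<in>G. F l = b}) \<le> \<epsilon> * real (card {l\<in>?P. F l = b})" if "b \<in> F ` G" for b
  proof -
    obtain l0 where l0: "l0 \<in> G" "b = F l0" using \<open>b \<in> F ` G\<close> by auto
    define j where "j = J l0"
    have l0P: "l0 \<in> ?P" and jh: "j + h \<le> card C" and Pb: "P b"
      using l0 by (auto simp: G_def F_def j_def)
    have b: "b = take j l0" using l0(2) by (simp only: F_def j_def)
    have len: "length l = card C" if "l \<in> ?P" for l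
      using length_finite_permutations_of_set[OF that] .
    have lenb: "length b = j" using len[OF l0P] jh by (simp add: b)
    \<comment> \<open>Stopping with prefix \<open>b\<close> is the same as starting with
      \<open>b\<close>, so a fibre consists of all extensions of \<open>b\<close>.\<close>
    have FJ: "F l = b \<longleftrightarrow> take j l = b" "F l = b \<Longrightarrow> J l = j" if "l \<in> ?P" for l
    proof -
      show *: "J l = j" if "F l = b"
      proof -
        have "length (take (J l) l) = j" using \<open>F l = b\<close> lenb by (simp add: F_def)
        then have "take j l = b" using \<open>F l = b\<close> by (auto simp: F_def min_def split: if_splits)
        then show ?thesis using stop[OF l0P \<open>l \<in> ?P\<close>] by (simp only: b j_def)
      qed
      show "F l = b \<longleftrightarrow> take j l = b"
      proof
        assume "F l = b"
        then show "take j l = b" using *[OF \<open>F l = b\<close>] by (simp only: F_def)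
      next
        assume "take j l = b"
        then have "J l = j" using stop[OF l0P \<open>l \<in> ?P\<close>] by (simp only: b j_def)
        then show "F l = b" using \<open>take j l = b\<close> by (simp only: F_def)
      qed
    qed
    let ?D = "pending f C b"
    let ?Q = "permutations_of_set (C - set b)"
    have jC: "j \<le> card C" using jh by simp
    note pf = card_permutations_prefix_fixed[OF assms(1) l0P jC, folded b]
    have "{l\<in>?P. F l = b} = {l\<in>?P. take j l = b}" using FJ by auto
    then have Pb_eq: "{l\<in>?P. F l = b} = (@) b ` ?Q" using pf(1) by simp
    then have card_all: "card {l\<in>?P. F l = b} = fact (card C - j)"
      unfolding Pb_eq using pf(2) assms(1)
      by (subst card_image) (simp_all add: inj_on_def)
    have "{l\<in>G. F l = b} \<subseteq> (@) b ` {m\<in>?Q. set (take h m) \<inter> ?D = {}}"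
    proof
      fix l assume l: "l \<in> {l\<in>G. F l = b}"
      then have lP: "l \<in> ?P" "F l = b" by (auto simp: G_def)
      then obtain m where m: "l = b @ m" "m \<in> ?Q" using Pb_eq by auto
      have "drop (J l) l = m" using FJ(2)[OF lP] m lenb by simp
      moreover have "set (take h (drop (J l) l)) \<inter> pending f C (F l) = {}"
        using l by (auto simp: G_def F_def)
      ultimately have "set (take h m) \<inter> ?D = {}" using lP by simp
      then show "l \<in> (@) b ` {m\<in>?Q. set (take h m) \<inter> ?D = {}}" using m by blast
    qed
    then have "card {l\<in>G. F l = b} \<le> card {m\<in>?Q. set (take h m) \<inter> ?D = {}}"
      by (intro surj_card_le) auto
    also have "real \<dots> \<le> (1 - real h / real (card (C - set b))) ^ card ?D * fact (card (C - set b))"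
      using assms(1) jh pf(2) by (intro card_permutations_prefix_disjoint) (auto simp: pending_def)
    also have "\<dots> \<le> \<epsilon> * fact (card C - j)"
    proof -
      let ?M = "card C - j"
      have hM: "real h / real ?M \<le> 1" using jh by (auto simp: divide_le_eq_1)
      have "(1 - real h / real ?M) ^ card ?D \<le> exp (- (real h / real ?M)) ^ card ?D"
        using hM exp_ge_add_one_self[of "- (real h / real ?M)"] by (intro power_mono) auto
      also have "\<dots> = exp (- (real h / real ?M * real (card ?D)))"
        by (simp add: exp_of_nat_mult[symmetric] algebra_simps)
      also have "\<dots> \<le> \<epsilon>"
      \<comment> \<open>For \<open>h = 0\<close> nothing may remain after \<open>b\<close>, so
        \<open>?M\<close> could vanish.\<close>
      proof (cases "h = 0")
        case False
        then have M: "0 < ?M" using jh by linarith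
        have "\<rho> \<le> real (card ?D)" using \<rho>[OF l0P] Pb by (simp only: b j_def)
        then have "real h / real (card C) * \<rho> \<le> real h / real ?M * real (card ?D)"
          using M \<open>0 \<le> \<rho>\<close> by (intro mult_mono divide_left_mono) auto
        then show ?thesis by (simp add: \<epsilon>_def)
      qed (simp add: \<epsilon>_def)
      finally show ?thesis unfolding pf(2) by (intro mult_right_mono) auto
    qed
    finally show ?thesis by (simp add: card_all)
  qed
  have finP: "finite ?P" by simp
  then have finG: "finite G" by (auto simp: G_def)
  have part: "card A = (\<Sum>b\<in>B. card {l\<in>A. F l = b})" if "finite A" "F ` A \<subseteq> B" "finite B" for A B
  proof -
    have "(\<Sum>b\<in>B. \<Sum>l | l \<in> A \<and> F l = b. 1) = (\<Sum>l\<in>A. 1::nat)"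
      using that by (intro sum.group) auto
    then show ?thesis by simp
  qed
  have "real (card G) = (\<Sum>b\<in>F ` G. real (card {l\<in>G. F l = b}))"
    using part[OF finG subset_refl] finG by simp
  also have "\<dots> \<le> (\<Sum>b\<in>F ` G. \<epsilon> * real (card {l\<in>?P. F l = b}))"
    using fibre by (intro sum_mono) auto
  also have "\<dots> \<le> (\<Sum>b\<in>F ` ?P. \<epsilon> * real (card {l\<in>?P. F l = b}))"
    using finP by (intro sum_mono2) (auto simp: G_def \<epsilon>_def)
  also have "\<dots> = \<epsilon> * real (card ?P)"
    using part[OF finP subset_refl] finP by (simp add: sum_distrib_left)
  finally show ?thesis using assms(1) by (simp add: G_def \<epsilon>_def)
qed

section \<open>Gaps of random words\<close>

lemma repeats_append_le: "repeats xs \<le> repeats (xs @ ys)"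
proof -
  have "card (set xs \<union> set ys) \<le> card (set xs) + length ys"
    using card_Un_le[of "set xs" "set ys"] card_length[of ys] by linarith
  then show ?thesis by (simp add: repeats_def)
qed

lemma repeats_append_eqD:
  assumes "repeats (xs @ ys) = repeats xs"
  shows "set xs \<inter> set ys = {}"
proof (rule ccontr)
  assume "set xs \<inter> set ys \<noteq> {}"
  then have "card (set ys - set xs) < card (set ys)" by (intro psubset_card_mono) auto
  moreover have "card (set xs \<union> set ys) = card (set xs) + card (set ys - set xs)"
    using card_Un_disjoint[of "set xs" "set ys - set xs"] by simp
  moreover note card_length[of xs] card_length[of ys]
  ultimately show False using assms by (simp add: repeats_def)
qed

lemma repeats_take_mono: "i \<le> j \<Longrightarrow> repeats (take i xs) \<le> repeats (take j xs)"
  using repeats_append_le[of "take i xs" "take (j - i) (drop i xs)"] by (simp flip: take_add)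

lemma repeats_rev [simp]: "repeats (rev xs) = repeats xs"
  by (simp add: repeats_def)

lemma repeats_snoc: "repeats (xs @ [x]) = (if x \<in> set xs then Suc (repeats xs) else repeats xs)"
  using card_length[of xs] by (auto simp: repeats_def insert_absorb)

text \<open>For \<open>K > 0\<close> the prefix of this length ends with the \<open>K\<close>-th
  repeat itself; for \<open>K = 0\<close> the time is 0.\<close>

definition repeat_time :: "nat \<Rightarrow> 'a list \<Rightarrow> nat" where
  "repeat_time K xs = (LEAST j. K \<le> repeats (take j xs))"

lemma repeats_repeat_time:
  assumes "K \<le> repeats xs"
  shows "repeats (take (repeat_time K xs) xs) = K" "repeat_time K xs \<le> length xs"
proof -
  have ex: "K \<le> repeats (take (length xs) xs)" using assms by simp
  show le: "repeat_time K xs \<le> length xs" unfolding repeat_time_def using ex by (rule Least_le)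
  have ge: "K \<le> repeats (take (repeat_time K xs) xs)" unfolding repeat_time_def using ex by (rule LeastI)
  show "repeats (take (repeat_time K xs) xs) = K"
  proof (cases "repeat_time K xs")
    case 0
    then show ?thesis using ge by simp
  next
    case (Suc j)
    then have "repeats (take j xs) < K"
      using not_less_Least[of j "\<lambda>j. K \<le> repeats (take j xs)"] by (simp add: repeat_time_def)
    moreover have "take (Suc j) xs = take j xs @ [xs ! j]" using le Suc by (simp add: take_Suc_conv_app_nth)
    ultimately show ?thesis using ge Suc by (simp add: repeats_snoc split: if_splits)
  qed
qed

lemma repeat_time_take_eqI:
  assumes "K \<le> repeats (take j xs)" "\<And>i. i < j \<Longrightarrow> repeats (take i xs) < K"
  shows "repeat_time K xs = j"
  unfolding repeat_time_def using assms by (intro Least_equality) (auto simp flip: not_less)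

text \<open>This makes \<open>repeat_time K\<close> a stopping time in the sense of
  \<open>card_permutations_stopped_le\<close>.\<close>

lemma repeat_time_prefix:
  assumes "K \<le> repeats xs" "take (repeat_time K xs) ys = take (repeat_time K xs) xs"
  shows "repeat_time K ys = repeat_time K xs"
proof (rule repeat_time_take_eqI)
  show "K \<le> repeats (take (repeat_time K xs) ys)" using repeats_repeat_time[OF assms(1)] assms(2) by simp
  fix i assume i: "i < repeat_time K xs"
  then have "take i ys = take i xs" using assms(2) by (metis min.strict_order_iff take_take min.commute)
  then show "repeats (take i ys) < K"
    using not_less_Least[of i "\<lambda>j. K \<le> repeats (take j xs)"] i by (simp add: repeat_time_def)
qed

text \<open>For \<open>K > 0\<close> the gap counts the \<open>K\<close>-th repeat as its first
  letter, so a gap of \<open>Suc h\<close> leaves \<open>h\<close> letters without a new repeat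
  after \<open>repeat_time\<close>. For \<open>K = 0\<close> there is no such letter and the
  conclusion gives one letter away.\<close>

lemma gap_rev_le:
  assumes "Suc h \<le> gap K (rev v)" "K \<le> repeats v"
  shows "repeat_time K v + h \<le> length v \<and> repeats (take (repeat_time K v + h) v) = K"
  using assms
proof (induction v arbitrary: h rule: rev_induct)
  case Nil
  then show ?case by simp
next
  case (snoc x v)
  consider "K < repeats (v @ [x])" | "repeats (v @ [x]) = K" using snoc.prems by linarith
  then show ?case
  proof cases
    case 1
    then have Kv: "K \<le> repeats v" by (auto simp: repeats_snoc split: if_splits)
    have "repeats (x # rev v) = repeats (v @ [x])" using repeats_rev[of "v @ [x]"] by simp
    then have "Suc h \<le> gap K (rev v)" using snoc.prems 1 by simp
    then have IH: "repeat_time K v + h \<le> length v" "repeats (take (repeat_time K v + h) v) = K"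
      using snoc.IH Kv by auto
    have "repeat_time K (v @ [x]) = repeat_time K v"
      using repeats_repeat_time[OF Kv] Kv by (intro repeat_time_prefix) auto
    then show ?thesis using IH by simp
  next
    case 2
    then have r: "repeats (x # rev v) = K" using repeats_rev[of "v @ [x]"] by simp
    show ?thesis
    proof (cases h)
      case 0
      then show ?thesis using repeats_repeat_time[OF snoc.prems(2)] by simp
    next
      case (Suc h')
      have xv: "x \<notin> set v"
      proof
        assume "x \<in> set v"
        then have "gap K (x # rev v) = 1" using r by simp
        then show False using snoc.prems Suc by simp
      qed
      then have Kv: "repeats v = K" using 2 by (simp add: repeats_snoc)
      have "Suc h' \<le> gap K (rev v)" using snoc.prems(1) Suc r xv by simp
      then have IH: "repeat_time K v + h' \<le> length v" using snoc.IH[of h'] Kv by simp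
      have "repeat_time K (v @ [x]) = repeat_time K v"
        using repeats_repeat_time[of K v] Kv by (intro repeat_time_prefix) auto
      moreover have "repeats (take (repeat_time K v + h) (v @ [x])) = K"
      proof (rule antisym)
        show "repeats (take (repeat_time K v + h) (v @ [x])) \<le> K"
          using repeats_append_le[of "take (repeat_time K v + h) (v @ [x])" "drop (repeat_time K v + h) (v @ [x])"] 2
          unfolding append_take_drop_id by simp
        have "K = repeats (take (repeat_time K v) (v @ [x]))"
          using repeats_repeat_time[of K v] Kv by simp
        also have "\<dots> \<le> repeats (take (repeat_time K v + h) (v @ [x]))"
          by (intro repeats_take_mono) simp
        finally show "K \<le> repeats (take (repeat_time K v + h) (v @ [x]))" .
      qed
      ultimately show ?thesis using IH Suc by simp
    qed
  qed
qed

lemma gap_le_length: "gap K xs \<le> length xs"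
  by (induction xs) auto

section \<open>Elementary estimates for the factor of one colour\<close>

text \<open>A common scale for \<open>x - 1 + exp (- x)\<close>, which it bounds from below up to a
  constant, and for the logarithm of the factor counting even subsets, which it bounds from
  above.\<close>

definition lin_quad :: "real \<Rightarrow> real" where
  "lin_quad x = min x (x\<^sup>2)"

text \<open>The inequality \<open>1 - x \<le> exp (- x)\<close> is integrated twice from 0.\<close>

lemma exp_minus_ge_cubic:
  fixes x :: real
  assumes "0 \<le> x"
  shows "1 - x + x\<^sup>2 / 2 - x ^ 3 / 6 \<le> exp (- x)"
proof -
  define f where "f x = exp (- x) - (1 - x + x\<^sup>2 / 2 - x ^ 3 / 6)" for x :: real
  define g where "g x = - exp (- x) + 1 - x + x\<^sup>2 / 2" for x :: real
  define h where "h x = exp (- x) - 1 + x" for x :: real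
  have h: "0 \<le> h x" for x using exp_ge_add_one_self[of "- x"] by (simp add: h_def)
  have "g 0 \<le> g y" if "0 \<le> y" for y
    using that by (rule DERIV_nonneg_imp_nondecreasing)
      (auto intro!: exI[of _ "h _"] h derivative_eq_intros simp: g_def h_def)
  then have g: "0 \<le> g y" if "0 \<le> y" for y using that by (force simp: g_def)
  have "f 0 \<le> f x"
    using assms
  proof (rule DERIV_nonneg_imp_nondecreasing)
    fix y :: real assume "0 \<le> y"
    have "(f has_real_derivative g y) (at y)"
      unfolding f_def g_def by (auto intro!: derivative_eq_intros simp: power2_eq_square)
    then show "\<exists>D. (f has_real_derivative D) (at y) \<and> 0 \<le> D" using g \<open>0 \<le> y\<close> by blast
  qed
  then show ?thesis by (simp add: f_def)
qed

lemma lin_quad_le_exp: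
  assumes "0 \<le> x"
  shows "lin_quad x / 3 \<le> x - 1 + exp (- x)"
proof (cases "x \<le> 1")
  case True
  have "x ^ 3 \<le> x\<^sup>2" using assms True by (intro power_decreasing) auto
  then have "x\<^sup>2 / 3 \<le> x - 1 + exp (- x)" using exp_minus_ge_cubic[OF assms] by linarith
  then show ?thesis by (auto simp: lin_quad_def)
next
  case False
  have "1 / 3 \<le> exp (- 1 :: real)" using exp_le by (simp add: exp_minus divide_simps)
  \<comment> \<open>The tangent of \<open>exp (- x)\<close> at 1.\<close>
  moreover have "exp (- 1) * (1 + (1 - x)) \<le> exp (- 1) * exp (1 - x)"
    by (intro mult_left_mono exp_ge_add_one_self) auto
  then have "exp (- 1) * (2 - x) \<le> exp (- x)" by (simp flip: exp_add)
  moreover have "exp (- 1 :: real) \<le> 1" by simp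
  ultimately have "x / 3 \<le> x - 1 + exp (- x)"
  proof -
    define e where "e = exp (- 1 :: real)"
    have e: "1 / 3 \<le> e" "e \<le> 1 / 2"
      using \<open>1 / 3 \<le> exp (- 1 :: real)\<close> exp_ge_add_one_self[of "1 :: real"]
      by (auto simp: e_def exp_minus divide_simps)
    have "0 \<le> (x - 1) * (2 / 3 - e)" using False e by (intro mult_nonneg_nonneg) auto
    moreover have "(x - 1) * (2 / 3 - e) = 2 * x / 3 - e * x - 2 / 3 + e" by (simp add: field_simps)
    moreover have "e * (2 - x) = 2 * e - e * x" by (simp add: algebra_simps)
    ultimately have "x / 3 \<le> x - 1 + e * (2 - x)" using e by linarith
    then show ?thesis using \<open>exp (- 1) * (2 - x) \<le> exp (- x)\<close> by (simp add: e_def)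
  qed
  then show ?thesis by (simp add: lin_quad_def)
qed

text \<open>With \<open>x = s (k - 1)\<close> and p = \<open>exp (- x)\<close>, the power
  \<open>(1 - s) ^ k\<close> is at most p, which leaves p (1 + (1 - p)), and
  \<open>1 + u \<le> exp u\<close> finishes.\<close>

lemma seen_factor_le:
  fixes s :: real
  assumes "0 \<le> s" "s \<le> 1" "1 \<le> k"
  shows "exp (- s * real (k - 1)) + (1 - exp (- s * real (k - 1))) * (1 - s) ^ k
    \<le> exp (- lin_quad (s * real (k - 1)) / 3)"
proof -
  define x where "x = s * real (k - 1)"
  have x: "0 \<le> x" using assms by (simp add: x_def)
  have "(1 - s) ^ k \<le> exp (- s) ^ k"
    using assms exp_ge_add_one_self[of "- s"] by (intro power_mono) auto
  also have "\<dots> = exp (- s * real k)" by (simp add: exp_of_nat_mult[symmetric] mult.commute)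
  also have "\<dots> \<le> exp (- x)" using assms by (simp add: x_def mult_left_mono)
  finally have "exp (- x) + (1 - exp (- x)) * (1 - s) ^ k \<le> exp (- x) + (1 - exp (- x)) * exp (- x)"
    using x by (intro add_left_mono mult_left_mono) auto
  also have "\<dots> = exp (- x) * (1 + (1 - exp (- x)))" by (simp add: algebra_simps)
  also have "\<dots> \<le> exp (- x) * exp (1 - exp (- x))"
    by (intro mult_left_mono exp_ge_add_one_self) auto
  also have "\<dots> = exp (- (x - 1 + exp (- x)))" by (simp flip: exp_add)
  also have "\<dots> \<le> exp (- lin_quad x / 3)" using lin_quad_le_exp[OF x] by simp
  finally show ?thesis by (simp add: x_def)
qed

text \<open>The derivative of \<open>x\<^sup>2 / 2 - ln (cosh x)\<close> is
  \<open>x - sinh x / cosh x\<close>, and \<open>sinh x \<le> x * cosh x\<close> for nonnegative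
  \<open>x\<close>.\<close>

lemma cosh_le_exp_square:
  fixes x :: real
  assumes "0 \<le> x"
  shows "cosh x \<le> exp (x\<^sup>2 / 2)"
proof -
  have sc: "sinh y \<le> y * cosh y" if "0 \<le> y" for y :: real
  proof -
    have "0 * cosh 0 - sinh 0 \<le> y * cosh y - sinh y"
      using that
    proof (rule DERIV_nonneg_imp_nondecreasing)
      fix u :: real assume "0 \<le> u"
      have "((\<lambda>u. u * cosh u - sinh u) has_real_derivative u * sinh u) (at u)"
        by (auto intro!: derivative_eq_intros)
      then show "\<exists>D. ((\<lambda>u. u * cosh u - sinh u) has_real_derivative D) (at u) \<and> 0 \<le> D"
        using \<open>0 \<le> u\<close> by (intro exI[of _ "u * sinh u"]) auto
    qed
    then show ?thesis by simp
  qed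
  have "0\<^sup>2 / 2 - ln (cosh 0) \<le> x\<^sup>2 / 2 - ln (cosh x)"
    using assms
  proof (rule DERIV_nonneg_imp_nondecreasing)
    fix y :: real assume y: "0 \<le> y"
    have "((\<lambda>y. y\<^sup>2 / 2 - ln (cosh y)) has_real_derivative y - sinh y / cosh y) (at y)"
      using cosh_real_pos[of y] by (auto intro!: derivative_eq_intros simp: field_simps)
    moreover have "sinh y / cosh y \<le> y" using sc[OF y] cosh_real_pos[of y] by (simp add: divide_le_eq)
    ultimately show "\<exists>D. ((\<lambda>y. y\<^sup>2 / 2 - ln (cosh y)) has_real_derivative D) (at y) \<and> 0 \<le> D" by force
  qed
  then have "ln (cosh x) \<le> x\<^sup>2 / 2" by simp
  then show ?thesis using cosh_real_pos[of x] by (metis exp_le_cancel_iff exp_ln)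
qed

text \<open>The left-hand side is at most \<open>cosh (s * k)\<close>, and \<open>k\<close> may be
  replaced by \<open>2 (k - 1)\<close> unless \<open>k = 1\<close>, when the left-hand side is
  1.\<close>

lemma even_factor_le:
  fixes s :: real
  assumes "0 \<le> s" "s \<le> 1" "1 \<le> k"
  shows "((1 + s) ^ k + (1 - s) ^ k) / 2 \<le> exp (2 * lin_quad (s * real (k - 1)))"
proof (cases "k = 1")
  case True
  then show ?thesis by (simp add: lin_quad_def)
next
  case False
  then have k: "real k \<le> 2 * real (k - 1)" using assms by linarith
  define x where "x = s * real k"
  define y where "y = s * real (k - 1)"
  have xy: "0 \<le> x" "x \<le> 2 * y" using assms(1) mult_left_mono[OF k assms(1)] by (simp_all add: x_def y_def del: of_nat_diff)
  have "(1 + s) ^ k \<le> exp s ^ k" using assms exp_ge_add_one_self[of s] by (intro power_mono) auto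
  moreover have "(1 - s) ^ k \<le> exp (- s) ^ k"
    using assms exp_ge_add_one_self[of "- s"] by (intro power_mono) auto
  ultimately have "((1 + s) ^ k + (1 - s) ^ k) / 2 \<le> (exp s ^ k + exp (- s) ^ k) / 2" by simp
  also have "\<dots> = cosh x" by (simp add: x_def cosh_field_def exp_of_nat_mult[symmetric] mult.commute)
  also have "\<dots> \<le> exp (2 * lin_quad y)"
  proof -
    have "cosh x \<le> exp (2 * y)"
    proof -
      have "exp (- x) \<le> exp x" using xy by simp
      then have "cosh x \<le> exp x" by (simp add: cosh_field_def)
      then show ?thesis using xy by (meson exp_le_cancel_iff order_trans)
    qed
    moreover have "x\<^sup>2 \<le> (2 * y)\<^sup>2" using xy by (intro power_mono) auto
    then have "cosh x \<le> exp (2 * y\<^sup>2)"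
      using cosh_le_exp_square[OF xy(1)] by (auto simp: power_mult_distrib intro: order_trans)
    ultimately show ?thesis by (simp add: lin_quad_def min_def)
  qed
  finally show ?thesis by (simp add: y_def)
qed

section \<open>Random permutations of a coloured set\<close>

locale coloured_set =
  fixes C :: "'c set" and f :: "'c \<Rightarrow> 'i"
  assumes finite_C: "finite C"
begin

definition excess :: "'i \<Rightarrow> nat" where
  "excess i = card {c\<in>C. f c = i} - 1"

text \<open>The exponent at the sampled fraction \<open>s\<close> in both tail estimates: large
  energy forces much excess to be seen, small energy makes many repeats unlikely.\<close>

definition energy :: "real \<Rightarrow> real" where
  "energy s = (\<Sum>i\<in>f ` C. lin_quad (s * real (excess i)))"

abbreviation P :: "'c list set" where
  "P \<equiv> permutations_of_set C"

lemma card_fibre: "i \<in> f ` C \<Longrightarrow> card {c\<in>C. f c = i} = Suc (excess i)"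
proof -
  assume "i \<in> f ` C"
  then have "0 < card {c\<in>C. f c = i}" using finite_C by (auto simp: card_gt_0_iff)
  then show ?thesis by (simp add: excess_def)
qed

lemma length_P: "l \<in> P \<Longrightarrow> length l = card C"
  by (rule length_finite_permutations_of_set)

lemma take_P:
  assumes "l \<in> P"
  shows "distinct (take t l)" "set (take t l) \<subseteq> C"
  using assms by (auto dest: permutations_of_setD in_set_takeD)

lemma sum_card_fibres: "I \<subseteq> f ` C \<Longrightarrow> (\<Sum>i\<in>I. card {c\<in>C. f c = i}) = card {c\<in>C. f c \<in> I}"
proof -
  assume I: "I \<subseteq> f ` C"
  then have "finite I" using finite_C finite_subset by blast
  then have "(\<Sum>i\<in>I. card {c\<in>C. f c = i}) = card (\<Union>i\<in>I. {c\<in>C. f c = i})"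
    using finite_C by (intro card_UN_disjoint[symmetric]) auto
  also have "(\<Union>i\<in>I. {c\<in>C. f c = i}) = {c\<in>C. f c \<in> I}" by auto
  finally show ?thesis .
qed

text \<open>Each colour seen owns one element more than its excess. Apart from the first one of its
  colour, every such element is either a repeat in \<open>b\<close> or pending.\<close>

lemma card_pending:
  assumes "distinct b" "set b \<subseteq> C"
  shows "card (pending f C b) + repeats (map f b) = sum excess (f ` set b)"
proof -
  let ?I = "f ` set b"
  have I: "?I \<subseteq> f ` C" using assms by auto
  have "sum excess ?I + card ?I = (\<Sum>i\<in>?I. card {c\<in>C. f c = i})"
  proof -
    have "(\<Sum>i\<in>?I. card {c\<in>C. f c = i}) = (\<Sum>i\<in>?I. excess i + 1)"
      using I card_fibre by (intro sum.cong) auto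
    then show ?thesis by (simp add: sum_Suc)
  qed
  also have "\<dots> = card {c\<in>C. f c \<in> ?I}" by (rule sum_card_fibres[OF I])
  also have "{c\<in>C. f c \<in> ?I} = set b \<union> pending f C b" using assms by (auto simp: pending_def)
  also have "card \<dots> = length b + card (pending f C b)"
    using assms finite_C by (subst card_Un_disjoint) (auto simp: pending_def distinct_card)
  finally have "sum excess ?I + card ?I = length b + card (pending f C b)" .
  moreover have "card ?I \<le> length b" using card_length[of "map f b"] by simp
  ultimately show ?thesis by (simp add: repeats_def)
qed

lemma repeats_P: "l \<in> P \<Longrightarrow> repeats (map f l) = sum excess (f ` C)"
proof -
  assume l: "l \<in> P"
  then have *: "distinct l" "set l = C" by (auto dest: permutations_of_setD)
  then have "pending f C l = {}" by (simp add: pending_def)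
  then show ?thesis using card_pending[of l] * by simp
qed

text \<open>A Chernoff bound for the lower tail whose parameter is the sampled fraction
  \<open>s\<close> itself, so that \<open>seen_factor_le\<close> applies to every colour.\<close>

lemma card_seen_le:
  assumes "t \<le> card C" "0 < card C"
  defines "s \<equiv> real t / real (card C)"
  shows "real (card {l\<in>P. real (sum excess (f ` set (take t l))) \<le> w})
    \<le> exp (s * w - energy s / 3) * fact (card C)"
proof -
  have s: "0 \<le> s" "s \<le> 1" using assms by (auto simp: s_def divide_le_eq_1)
  define A where "A l = real (sum excess (f ` set (take t l)))" for l
  have "real (card {l\<in>P. A l \<le> w}) = (\<Sum>l\<in>{l\<in>P. A l \<le> w}. 1)" by simp
  also have "\<dots> \<le> (\<Sum>l\<in>{l\<in>P. A l \<le> w}. exp (s * w) * exp (- s * A l))"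
  proof (rule sum_mono)
    fix l assume "l \<in> {l\<in>P. A l \<le> w}"
    then have "0 \<le> s * w + - s * A l" using s by (simp add: mult_left_mono)
    then show "1 \<le> exp (s * w) * exp (- s * A l)" by (simp flip: exp_add)
  qed
  also have "\<dots> \<le> (\<Sum>l\<in>P. exp (s * w) * exp (- s * A l))"
    by (intro sum_mono2) auto
  also have "\<dots> = exp (s * w) * (\<Sum>l\<in>P. exp (- s * sum (\<lambda>i. real (excess i)) (f ` set (take t l))))"
    by (simp add: sum_distrib_left A_def)
  also have "\<dots> \<le> exp (s * w) * ((\<Prod>i\<in>f ` C. exp (- s * real (excess i))
          + (1 - exp (- s * real (excess i))) * (1 - real t / real (card C)) ^ card {c\<in>C. f c = i})
       * fact (card C))"
    using finite_C assms(1) s by (intro mult_left_mono sum_permutations_exp_seen_le) auto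
  also have "\<dots> \<le> exp (s * w) * ((\<Prod>i\<in>f ` C. exp (- lin_quad (s * real (excess i)) / 3)) * fact (card C))"
  proof (intro mult_left_mono mult_right_mono prod_mono conjI)
    fix i assume i: "i \<in> f ` C"
    have st: "real t / real (card C) = s" by (simp add: s_def)
    show "0 \<le> exp (- s * real (excess i))
          + (1 - exp (- s * real (excess i))) * (1 - real t / real (card C)) ^ card {c\<in>C. f c = i}"
      unfolding st using s by (intro add_nonneg_nonneg mult_nonneg_nonneg) auto
    show "exp (- s * real (excess i))
          + (1 - exp (- s * real (excess i))) * (1 - real t / real (card C)) ^ card {c\<in>C. f c = i}
        \<le> exp (- lin_quad (s * real (excess i)) / 3)"
      unfolding st using seen_factor_le[OF s, of "Suc (excess i)"] card_fibre[OF i] by simp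
  qed auto
  also have "(\<Prod>i\<in>f ` C. exp (- lin_quad (s * real (excess i)) / 3)) = exp (- energy s / 3)"
    using finite_C by (simp add: energy_def exp_sum[symmetric] sum_negf sum_divide_distrib)
  also have "exp (s * w) * (exp (- energy s / 3) * fact (card C))
      = exp (s * w - energy s / 3) * fact (card C)"
    by (simp flip: exp_add mult.assoc)
  finally show ?thesis by (simp add: A_def)
qed

text \<open>Markov's inequality for 2 to the number of repeats.\<close>

lemma card_many_repeats_le:
  assumes "t \<le> card C" "0 < card C"
  defines "s \<equiv> real t / real (card C)"
  shows "real (card {l\<in>P. K \<le> repeats (map f (take t l))})
    \<le> exp (2 * energy s) / 2 ^ K * fact (card C)"
proof -
  have s: "0 \<le> s" "s \<le> 1" using assms by (auto simp: s_def divide_le_eq_1)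
  have rep: "repeats (map f (take t l)) = t - card (f ` set (take t l))" if "l \<in> P" for l
    using assms(1) length_P[OF that] by (simp add: repeats_def)
  have "2 ^ K * real (card {l\<in>P. K \<le> repeats (map f (take t l))})
      = (\<Sum>l\<in>{l\<in>P. K \<le> repeats (map f (take t l))}. 2 ^ K)" by simp
  also have "\<dots> \<le> (\<Sum>l\<in>{l\<in>P. K \<le> repeats (map f (take t l))}. 2 ^ (t - card (f ` set (take t l))))"
    using rep by (intro sum_mono power_increasing) auto
  also have "\<dots> \<le> (\<Sum>l\<in>P. 2 ^ (t - card (f ` set (take t l))))"
    by (intro sum_mono2) auto
  also have "\<dots> \<le> (\<Prod>i\<in>f ` C. ((1 + s) ^ card {c\<in>C. f c = i} + (1 - s) ^ card {c\<in>C. f c = i}) / 2) * fact (card C)"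
    unfolding s_def using finite_C assms(1) by (rule sum_permutations_power_repeats_le)
  also have "\<dots> \<le> (\<Prod>i\<in>f ` C. exp (2 * lin_quad (s * real (excess i)))) * fact (card C)"
  proof (intro mult_right_mono prod_mono conjI)
    fix i assume i: "i \<in> f ` C"
    show "0 \<le> ((1 + s) ^ card {c\<in>C. f c = i} + (1 - s) ^ card {c\<in>C. f c = i}) / 2"
      using s by auto
    show "((1 + s) ^ card {c\<in>C. f c = i} + (1 - s) ^ card {c\<in>C. f c = i}) / 2
        \<le> exp (2 * lin_quad (s * real (excess i)))"
      using even_factor_le[OF s, of "Suc (excess i)"] card_fibre[OF i] by simp
  qed auto
  also have "(\<Prod>i\<in>f ` C. exp (2 * lin_quad (s * real (excess i)))) = exp (2 * energy s)"
    using finite_C by (simp add: energy_def exp_sum[symmetric] sum_distrib_left)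
  finally show ?thesis by (simp add: field_simps)
qed

text \<open>
  \<open>J\<close> is a stopping time. If there is no repeat among the \<open>h\<close> elements after it, then these avoid
  all elements that are pending at that time.
\<close>

lemma card_no_repeat_after_le:
  fixes J :: "'c list \<Rightarrow> nat"
  assumes stop: "\<And>l l'. l \<in> P \<Longrightarrow> l' \<in> P \<Longrightarrow> take (J l) l' = take (J l) l \<Longrightarrow> J l' = J l"
    and "0 \<le> w"
  shows "real (card {l\<in>P. J l + h \<le> card C \<and>
      repeats (map f (take (J l) l)) = K \<and> repeats (map f (take (J l + h) l)) = K \<and>
      w + real K < real (sum excess (f ` set (take (J l) l)))})
    \<le> exp (- (real h * w / real (card C))) * fact (card C)"
proof -
  define Q where "Q b \<longleftrightarrow> repeats (map f b) = K \<and> w + real K < real (sum excess (f ` set b))" for b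
  have "{l\<in>P. J l + h \<le> card C \<and>
      repeats (map f (take (J l) l)) = K \<and> repeats (map f (take (J l + h) l)) = K \<and>
      w + real K < real (sum excess (f ` set (take (J l) l)))}
    \<subseteq> {l\<in>P. J l + h \<le> card C \<and> Q (take (J l) l) \<and>
        set (take h (drop (J l) l)) \<inter> pending f C (take (J l) l) = {}}"
  proof clarify
    fix l assume l: "l \<in> P" "J l + h \<le> card C" "K = repeats (map f (take (J l) l))"
      "repeats (map f (take (J l + h) l)) = repeats (map f (take (J l) l))"
      "w + real (repeats (map f (take (J l) l))) < real (sum excess (f ` set (take (J l) l)))"
    have "repeats (map f (take (J l) l) @ map f (take h (drop (J l) l))) = repeats (map f (take (J l) l))"
      using l(4) by (simp only: take_add map_append)
    then have "set (map f (take (J l) l)) \<inter> set (map f (take h (drop (J l) l))) = {}"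
      by (rule repeats_append_eqD)
    then have "set (take h (drop (J l) l)) \<inter> pending f C (take (J l) l) = {}"
      by (auto simp: pending_def)
    then show "Q (take (J l) l) \<and> set (take h (drop (J l) l)) \<inter> pending f C (take (J l) l) = {}"
      using l by (simp add: Q_def)
  qed
  then have "card {l\<in>P. J l + h \<le> card C \<and>
      repeats (map f (take (J l) l)) = K \<and> repeats (map f (take (J l + h) l)) = K \<and>
      w + real K < real (sum excess (f ` set (take (J l) l)))}
    \<le> card {l\<in>P. J l + h \<le> card C \<and> Q (take (J l) l) \<and>
        set (take h (drop (J l) l)) \<inter> pending f C (take (J l) l) = {}}"
    by (intro card_mono) auto
  also have "real \<dots> \<le> exp (- (real h * w / real (card C))) * fact (card C)"
  proof (rule card_permutations_stopped_le[OF finite_C stop _ assms(2)])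
    fix l assume l: "l \<in> P" "Q (take (J l) l)"
    show "w \<le> real (card (pending f C (take (J l) l)))"
    proof -
      \<comment> \<open>The \<open>K\<close> repeats have used up part of the excess seen, hence the
        shift by \<open>K\<close> in the event.\<close>
      have "real (card (pending f C (take (J l) l))) + real K = real (sum excess (f ` set (take (J l) l)))"
        using card_pending[OF take_P[OF l(1)], of "J l"] l(2) by (metis Q_def of_nat_add)
      then show ?thesis using l(2) by (simp add: Q_def del: of_nat_sum)
    qed
  qed
  finally show ?thesis by simp
qed

lemma lin_quad_scale_le:
  assumes "0 \<le> x"
  shows "lin_quad (2 * x) \<le> 4 * lin_quad x"
  using assms by (auto simp: lin_quad_def power_mult_distrib)

lemma lin_quad_mono: "0 \<le> x \<Longrightarrow> x \<le> y \<Longrightarrow> lin_quad x \<le> lin_quad y"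
  unfolding lin_quad_def by (intro min.mono power_mono) auto

lemma energy_mono: "0 \<le> s \<Longrightarrow> s \<le> s' \<Longrightarrow> energy s \<le> energy s'"
  unfolding energy_def by (intro sum_mono lin_quad_mono mult_right_mono) auto

lemma energy_double: "0 \<le> s \<Longrightarrow> energy (2 * s) \<le> 4 * energy s"
  unfolding energy_def sum_distrib_left
  by (intro sum_mono order.trans[OF _ lin_quad_scale_le]) (auto simp: mult.assoc)

text \<open>For \<open>s\<close> at most 1 and an integer \<open>k\<close>, both
  \<open>s * k\<close> and \<open>(s * k)\<^sup>2\<close> are at least
  \<open>s\<^sup>2 * k\<close>.\<close>

lemma energy_ge:
  assumes "0 \<le> s" "s \<le> 1"
  shows "s\<^sup>2 * real (sum excess (f ` C)) \<le> energy s"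
proof -
  have "s\<^sup>2 * real k \<le> lin_quad (s * real k)" for k :: nat
  proof (cases "k = 0")
    case False
    have "s\<^sup>2 \<le> s" using assms by (simp add: power2_eq_square mult_left_le)
    then have "s\<^sup>2 * real k \<le> s * real k" by (intro mult_right_mono) auto
    moreover have "s\<^sup>2 * real k \<le> s\<^sup>2 * (real k)\<^sup>2"
      using False by (intro mult_left_mono) (auto simp: power2_eq_square)
    ultimately show ?thesis by (simp add: lin_quad_def power_mult_distrib)
  qed (simp add: lin_quad_def)
  then show ?thesis by (auto simp: energy_def sum_distrib_left intro!: sum_mono)
qed

text \<open>For a colour class of size m the summand is m (m - 1), so this becomes the sum of d (d -
  1) for words.\<close>

definition second_moment :: real where
  "second_moment = (\<Sum>i\<in>f ` C. (real (excess i) + 1) * real (excess i))"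

lemma excess_le_sqrt:
  assumes "i \<in> f ` C"
  shows "real (excess i) \<le> sqrt second_moment"
proof -
  have "(real (excess i))\<^sup>2 \<le> (real (excess i) + 1) * real (excess i)"
    by (simp add: power2_eq_square mult_right_mono)
  also have "\<dots> \<le> second_moment"
    unfolding second_moment_def using finite_C assms
    by (intro member_le_sum[of i "f ` C" "\<lambda>i. (real (excess i) + 1) * real (excess i)"]) auto
  finally show ?thesis by (rule real_le_rsqrt)
qed

text \<open>Two phases of length \<open>t\<close>: by the end of the first, excess of order
  sqrt(\<open>second_moment\<close>) has been seen; during the second, no pending element may be
  hit. The phase boundary is fixed, so the stopping time is constant.\<close>

lemma card_large_first_gap_le:
  assumes S: "0 < second_moment" and z: "1 \<le> z"
    and t: "z * real (card C) / sqrt second_moment \<le> real t"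
  shows "real (card {l\<in>P. 2 * t + 1 \<le> gap 0 (rev (map f l))}) \<le> 2 * exp (- z / 12) * fact (card C)"
proof (cases "2 * t \<le> card C")
  case False
  then have "{l\<in>P. 2 * t + 1 \<le> gap 0 (rev (map f l))} = {}"
  proof (intro equals0I)
    fix l assume "l \<in> {l\<in>P. 2 * t + 1 \<le> gap 0 (rev (map f l))}"
    then show False using gap_le_length[of 0 "rev (map f l)"] length_P[of l] False by simp
  qed
  then show ?thesis by (simp only: card.empty) simp
next
  case True
  define R where "R = sqrt second_moment"
  define s where "s = real t / real (card C)"
  \<comment> \<open>The energy is at least \<open>s * R / 2\<close>, so \<open>card_seen_le\<close>
    has exponent at most \<open>s * R / 12 - s * R / 6\<close>; the second phase has exponent
    \<open>- s * R / 12\<close> as well.\<close>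
  define w where "w = R / 12"
  have R: "0 < R" "R\<^sup>2 = second_moment" using S by (auto simp: R_def)
  have N: "0 < card C"
  proof (rule ccontr)
    assume "\<not> 0 < card C"
    then have "f ` C = {}" using finite_C by simp
    then show False using S unfolding second_moment_def by simp
  qed
  have s: "0 \<le> s" by (simp add: s_def)
  have zs: "z \<le> s * R" using t R(1) N by (simp add: s_def R_def[symmetric] field_simps)
  have Z1: "1 \<le> s * R" using zs z by simp
  have en: "s * R / 2 \<le> energy s"
  proof -
    \<comment> \<open>As \<open>e\<close> is at most \<open>R\<close> and \<open>s * R\<close> is at
      least 1, \<open>(s * e)\<^sup>2 / (s * R)\<close> lies below both terms of the minimum in
      \<open>lin_quad\<close>. This turns the energy into the second moment.\<close>
    have "(s\<^sup>2 * ((real (excess i) + 1) * real (excess i))) / (2 * (s * R)) \<le> lin_quad (s * real (excess i))"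
      if i: "i \<in> f ` C" for i
    proof -
      define e where "e = real (excess i)"
      have e: "0 \<le> e" "e \<le> R" using excess_le_sqrt[OF i] by (auto simp: e_def R_def)
      have "(e + 1) * e \<le> 2 * e\<^sup>2"
      proof (cases "excess i = 0")
        case False
        then have "1 \<le> e" by (simp add: e_def)
        then have "e * 1 \<le> e * e" by (intro mult_left_mono) auto
        then show ?thesis by (simp add: power2_eq_square algebra_simps)
      qed (simp add: e_def)
      then have "(s\<^sup>2 * ((e + 1) * e)) / (2 * (s * R)) \<le> (s\<^sup>2 * (2 * e\<^sup>2)) / (2 * (s * R))"
        using Z1 by (intro divide_right_mono mult_left_mono) auto
      also have "\<dots> = (s * e)\<^sup>2 / (s * R)" by (simp add: power_mult_distrib)
      also have "\<dots> \<le> lin_quad (s * e)"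
      proof -
        have se: "0 \<le> s * e" "s * e \<le> s * R" using e s by (auto intro: mult_left_mono)
        have "(s * e)\<^sup>2 / (s * R) \<le> s * e"
        proof -
          have "(s * e)\<^sup>2 \<le> (s * e) * (s * R)"
            unfolding power2_eq_square using se e s by (intro mult_left_mono) auto
          then show ?thesis using Z1 by (subst pos_divide_le_eq) auto
        qed
        moreover have "(s * e)\<^sup>2 / (s * R) \<le> (s * e)\<^sup>2 / 1"
          using Z1 by (intro divide_left_mono) auto
        ultimately show ?thesis by (simp add: lin_quad_def)
      qed
      finally show ?thesis by (simp add: e_def)
    qed
    then have "(\<Sum>i\<in>f ` C. (s\<^sup>2 * ((real (excess i) + 1) * real (excess i))) / (2 * (s * R))) \<le> energy s"
      unfolding energy_def by (intro sum_mono)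
    also have "(\<Sum>i\<in>f ` C. (s\<^sup>2 * ((real (excess i) + 1) * real (excess i))) / (2 * (s * R)))
        = s\<^sup>2 * R\<^sup>2 / (2 * (s * R))"
      by (simp add: R(2) second_moment_def sum_divide_distrib sum_distrib_left)
    also have "\<dots> = s * R / 2" using Z1 by (simp add: power2_eq_square)
    finally show ?thesis .
  qed
  let ?A = "\<lambda>l. real (sum excess (f ` set (take t l)))"
  let ?G1 = "{l\<in>P. ?A l \<le> w}"
  let ?G2 = "{l\<in>P. t + t \<le> card C \<and> repeats (map f (take t l)) = 0 \<and> repeats (map f (take (t + t) l)) = 0 \<and>
      w + real 0 < ?A l}"
  have "{l\<in>P. 2 * t + 1 \<le> gap 0 (rev (map f l))} \<subseteq> ?G1 \<union> ?G2"
  proof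
    fix l assume l: "l \<in> {l\<in>P. 2 * t + 1 \<le> gap 0 (rev (map f l))}"
    then have "repeats (take (repeat_time 0 (map f l) + 2 * t) (map f l)) = 0"
      by (intro gap_rev_le[THEN conjunct2]) auto
    moreover have "repeat_time 0 (map f l) = 0" by (simp add: repeat_time_def)
    ultimately have r: "repeats (take (t + t) (map f l)) = 0" by (simp add: mult_2)
    then have "repeats (take t (map f l)) = 0"
      using repeats_take_mono[of t "t + t" "map f l"] by simp
    then show "l \<in> ?G1 \<union> ?G2" using l r True by (auto simp: take_map)
  qed
  then have "card {l\<in>P. 2 * t + 1 \<le> gap 0 (rev (map f l))} \<le> card ?G1 + card ?G2"
    by (intro order.trans[OF card_mono card_Un_le]) auto
  then have "real (card {l\<in>P. 2 * t + 1 \<le> gap 0 (rev (map f l))}) \<le> real (card ?G1) + real (card ?G2)"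
    by linarith
  also have "real (card ?G1) \<le> exp (s * w - energy s / 3) * fact (card C)"
    unfolding s_def using True N by (intro card_seen_le) auto
  also have "real (card ?G2) \<le> exp (- (real t * w / real (card C))) * fact (card C)"
    using R by (intro card_no_repeat_after_le[of "\<lambda>_. t"]) (auto simp: w_def)
  also have "exp (s * w - energy s / 3) * fact (card C) \<le> exp (- z / 12) * fact (card C)"
    using en zs by (intro mult_right_mono) (auto simp: w_def)
  also have "exp (- (real t * w / real (card C))) * fact (card C) \<le> exp (- z / 12) * fact (card C)"
    using zs by (intro mult_right_mono) (auto simp: w_def s_def)
  finally show ?thesis by (simp add: mult_ac)
qed

text \<open>A time \<open>t\<close> with energy between \<open>K / 32\<close> and
  \<open>K / 8\<close> separates two scales. The upper bound makes \<open>K\<close> repeats within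
  \<open>t\<close> steps unlikely; the lower bound ensures that much excess has been seen by then,
  hence also at the later \<open>K\<close>-th repeat.\<close>

lemma card_large_gap_le:
  defines "\<alpha> \<equiv> real (sum excess (f ` C))"
  assumes K: "8 \<le> K" "18432 * real K \<le> \<alpha>"
  shows "real (card {l\<in>P. h + 1 \<le> gap K (rev (map f l))})
    \<le> (2 * exp (- real K / 192) + exp (- (real h * sqrt (\<alpha> * K) / (136 * real (card C))))) * fact (card C)"
proof -
  define N where "N = card C"
  have \<alpha>: "0 < \<alpha>" using K by simp
  have N: "0 < N"
  proof (rule ccontr)
    assume "\<not> 0 < N"
    then have "C = {}" using finite_C by (simp add: N_def)
    then show False using \<alpha> by (simp add: \<alpha>_def)
  qed
  define Th where "Th t = energy (real t / real N)" for t :: nat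
  have Th_mono: "Th t \<le> Th t'" if "t \<le> t'" for t t'
    unfolding Th_def using that by (intro energy_mono divide_right_mono) auto
  \<comment> \<open>One step has energy at most 1, which is at most \<open>K / 8\<close> as
    \<open>K\<close> is at least 8; so the set defining \<open>t\<close> is nonempty.\<close>
  have Th1: "Th 1 \<le> 1"
  proof -
    have ex: "excess i \<le> N" for i
      using card_mono[of C "{c\<in>C. f c = i}"] finite_C by (auto simp: excess_def N_def)
    have "Th 1 \<le> (\<Sum>i\<in>f ` C. real (excess i) / real N)"
      unfolding Th_def energy_def
    proof (rule sum_mono)
      fix i assume "i \<in> f ` C"
      show "lin_quad (real 1 / real N * real (excess i)) \<le> real (excess i) / real N"
        by (simp add: lin_quad_def)
    qed
    also have "\<dots> = \<alpha> / N" by (simp add: \<alpha>_def sum_divide_distrib)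
    also have "\<alpha> \<le> N"
    proof -
      have "sum excess (f ` C) \<le> (\<Sum>i\<in>f ` C. card {c\<in>C. f c = i})"
        by (intro sum_mono) (simp add: excess_def)
      also have "\<dots> = card {c\<in>C. f c \<in> f ` C}" by (rule sum_card_fibres) simp
      also have "\<dots> = N" by (auto simp: N_def intro!: arg_cong[of _ _ card])
      finally show ?thesis by (simp add: \<alpha>_def del: of_nat_sum)
    qed
    finally show ?thesis using N by (simp add: divide_le_eq)
  qed
  have ThN: "real K / 8 < Th N"
  proof -
    have "\<alpha> \<le> Th N" using energy_ge[of 1] N by (simp add: Th_def \<alpha>_def)
    moreover have "real K / 8 < \<alpha>" using K by linarith
    ultimately show ?thesis by linarith
  qed
  define t where "t = Max {t. t \<le> N \<and> Th t \<le> real K / 8}"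
  have ne: "1 \<in> {t. t \<le> N \<and> Th t \<le> real K / 8}" using Th1 K N by auto
  have "t \<in> {t. t \<le> N \<and> Th t \<le> real K / 8}" unfolding t_def by (rule Max_in) (use ne in auto)
  then have tin: "t \<le> N" "Th t \<le> real K / 8" by auto
  have t1: "1 \<le> t" unfolding t_def using ne by (intro Max_ge) auto
  have tN: "t < N" using tin ThN by (cases "t = N") auto
  have "real K / 8 < Th (Suc t)"
  proof (rule ccontr)
    assume "\<not> real K / 8 < Th (Suc t)"
    then have "Suc t \<le> t" unfolding t_def using tN by (intro Max_ge) (auto simp: t_def)
    then show False by simp
  qed
  \<comment> \<open>One more step is at most a doubling of the time and multiplies the energy by at
    most four, whence the lower bound \<open>K / 32\<close>.\<close>
  also have "Th (Suc t) \<le> Th (2 * t)" using t1 by (intro Th_mono) auto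
  also have "\<dots> \<le> 4 * Th t" using energy_double[of "real t / real N"] by (simp add: Th_def)
  finally have Th_lower: "real K / 32 < Th t" by simp
  define s where "s = real t / real N"
  have s: "0 < s" "s \<le> 1" using t1 tN by (auto simp: s_def)
  have s2: "s\<^sup>2 * \<alpha> \<le> real K / 8"
    using energy_ge[of s] s tin by (simp add: \<alpha>_def Th_def s_def)
  \<comment> \<open>This is where 18432 = 384^2 / 8 comes from; 384 = 2 * 192 then gives
    \<open>2 * K \<le> w\<close>.\<close>
  have s_small: "s \<le> 1 / 384"
  proof (rule ccontr)
    assume "\<not> s \<le> 1 / 384"
    then have "(1 / 384)\<^sup>2 < s\<^sup>2" by (intro power_strict_mono) auto
    then have "(1 / 384)\<^sup>2 * \<alpha> < s\<^sup>2 * \<alpha>" using \<alpha> by (intro mult_strict_right_mono)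
    moreover have "(1 / 384 :: real)\<^sup>2 = 1 / 147456" by (simp add: power2_eq_square)
    ultimately have "1 / 147456 * \<alpha> < s\<^sup>2 * \<alpha>" by (simp only:)
    then show False using s2 K(2) by linarith
  qed
  \<comment> \<open>The lower tail bound then has exponent at most K/192 - K/96 = -K/192.\<close>
  define w where "w = real K / (192 * s)"
  have wK: "2 * real K \<le> w"
  proof -
    have "real K * (s * 384) \<le> real K * 1" using s_small by (intro mult_left_mono) auto
    then show ?thesis using s by (simp add: w_def field_simps)
  qed
  \<comment> \<open>From \<open>s\<^sup>2 * \<alpha> \<le> K / 8\<close>; 68 is 192 / sqrt 8 rounded
    up.\<close>
  have w_lower: "sqrt (\<alpha> * K) / 68 \<le> w"
  proof -
    have "\<alpha> * K / 68\<^sup>2 \<le> w\<^sup>2"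
    proof -
      have "\<alpha> * s\<^sup>2 * 36864 \<le> real K * 4624" using s2 by (simp add: mult.commute)
      then have "(\<alpha> * s\<^sup>2 * 36864) * real K \<le> (real K * 4624) * real K" by (intro mult_right_mono) auto
      then show ?thesis using s by (simp add: w_def power2_eq_square field_simps)
    qed
    then have "sqrt (\<alpha> * K / 68\<^sup>2) \<le> w" using wK by (intro real_le_lsqrt) auto
    then show ?thesis by (simp add: real_sqrt_divide)
  qed
  \<comment> \<open>The three ways to a long gap: the \<open>K\<close>-th repeat comes too early,
    too little excess is seen by time \<open>t\<close>, or the pending elements are avoided for
    \<open>h\<close> steps in spite of a large excess.\<close>
  let ?J = "\<lambda>l. repeat_time K (map f l)"
  let ?G1 = "{l\<in>P. K \<le> repeats (map f (take t l))}"
  let ?G2 = "{l\<in>P. real (sum excess (f ` set (take t l))) \<le> w}"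
  let ?G3 = "{l\<in>P. ?J l + h \<le> card C \<and>
      repeats (map f (take (?J l) l)) = K \<and> repeats (map f (take (?J l + h) l)) = K \<and>
      (w - K) + real K < real (sum excess (f ` set (take (?J l) l)))}"
  have Krep: "K \<le> repeats (map f l)" if "l \<in> P" for l
  proof -
    have "real K \<le> real (sum excess (f ` C))" using K unfolding \<alpha>_def by linarith
    then show ?thesis using repeats_P[OF that] by (simp only: of_nat_le_iff)
  qed
  have "{l\<in>P. h + 1 \<le> gap K (rev (map f l))} \<subseteq> ?G1 \<union> ?G2 \<union> ?G3"
  proof
    fix l assume l: "l \<in> {l\<in>P. h + 1 \<le> gap K (rev (map f l))}"
    then have lP: "l \<in> P" by simp
    have g: "?J l + h \<le> card C" "repeats (map f (take (?J l + h) l)) = K"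
      using gap_rev_le[of h K "map f l"] l Krep[OF lP] length_P[OF lP] by (simp_all add: take_map)
    have J: "repeats (map f (take (?J l) l)) = K"
      using repeats_repeat_time(1)[OF Krep[OF lP]] by (simp add: take_map)
    show "l \<in> ?G1 \<union> ?G2 \<union> ?G3"
    proof (cases "t \<le> ?J l")
      case True
      have "set (take t l) \<subseteq> set (take (?J l) l)" using True by (rule set_take_subset_set_take)
      then have "sum excess (f ` set (take t l)) \<le> sum excess (f ` set (take (?J l) l))"
        by (intro sum_mono2) auto
      then have "real (sum excess (f ` set (take t l))) \<le> real (sum excess (f ` set (take (?J l) l)))"
        by (rule of_nat_mono)
      then show ?thesis using lP g J by (auto simp del: of_nat_sum)
    next
      case False
      then have "K \<le> repeats (map f (take t l))"
        using repeats_take_mono[of "?J l" t "map f l"] J by (simp add: take_map)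
      then show ?thesis using lP by simp
    qed
  qed
  then have "card {l\<in>P. h + 1 \<le> gap K (rev (map f l))} \<le> card (?G1 \<union> ?G2 \<union> ?G3)"
    by (intro card_mono) auto
  also have "\<dots> \<le> card ?G1 + card ?G2 + card ?G3"
    using card_Un_le[of "?G1 \<union> ?G2" ?G3] card_Un_le[of ?G1 ?G2] by linarith
  finally have "real (card {l\<in>P. h + 1 \<le> gap K (rev (map f l))})
      \<le> real (card ?G1) + real (card ?G2) + real (card ?G3)" by linarith
  also have "real (card ?G1) \<le> exp (- real K / 192) * fact (card C)"
  proof -
    have "real (card ?G1) \<le> exp (2 * Th t) / 2 ^ K * fact (card C)"
      unfolding Th_def N_def using tN N by (intro card_many_repeats_le) (auto simp: N_def)
    also have "\<dots> \<le> exp (- real K / 192) * fact (card C)"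
    proof (rule mult_right_mono)
      have "exp (1 / 2 :: real) \<le> 2"
      proof -
        have "exp (1 / 2 :: real) ^ 2 \<le> 2 ^ 2" using exp_le by (simp add: exp_of_nat_mult[symmetric])
        then show ?thesis by (rule power2_le_imp_le) simp
      qed
      then have "exp (1 / 2 :: real) ^ K \<le> 2 ^ K" by (intro power_mono) auto
      then have "exp (real K / 2) \<le> 2 ^ K" by (simp add: exp_of_nat_mult[symmetric])
      then have "exp (2 * Th t) / 2 ^ K \<le> exp (real K / 4) / exp (real K / 2)"
        using tin by (intro frac_le) auto
      also have "\<dots> \<le> exp (- real K / 192)" by (simp flip: exp_diff)
      finally show "exp (2 * Th t) / 2 ^ K \<le> exp (- real K / 192)" .
    qed simp
    finally show ?thesis .
  qed
  also have "real (card ?G2) \<le> exp (- real K / 192) * fact (card C)"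
  proof -
    have "real (card ?G2) \<le> exp (s * w - energy s / 3) * fact (card C)"
      unfolding s_def N_def using tN N by (intro card_seen_le) (auto simp: N_def)
    also have "\<dots> \<le> exp (- real K / 192) * fact (card C)"
      using Th_lower s by (intro mult_right_mono) (auto simp: w_def Th_def s_def[symmetric])
    finally show ?thesis .
  qed
  also have "real (card ?G3) \<le> exp (- (real h * sqrt (\<alpha> * K) / (136 * real (card C)))) * fact (card C)"
  proof -
    have "real (card ?G3) \<le> exp (- (real h * (w - K) / real (card C))) * fact (card C)"
    proof (rule card_no_repeat_after_le)
      fix l l' assume "l \<in> P" "l' \<in> P" "take (?J l) l' = take (?J l) l"
      then show "?J l' = ?J l"
        using Krep by (intro repeat_time_prefix) (auto simp: take_map)
    qed (use wK in simp)
    also have "\<dots> \<le> exp (- (real h * (sqrt (\<alpha> * K) / 136) / real (card C))) * fact (card C)"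
    proof (rule mult_right_mono)
      have "sqrt (\<alpha> * K) / 136 \<le> w - K" using wK w_lower by simp
      then have "real h * (sqrt (\<alpha> * K) / 136) / real (card C) \<le> real h * (w - K) / real (card C)"
        by (intro divide_right_mono mult_left_mono) auto
      then show "exp (- (real h * (w - K) / real (card C))) \<le> exp (- (real h * (sqrt (\<alpha> * K) / 136) / real (card C)))"
        by simp
    qed simp
    finally show ?thesis by simp
  qed
  finally show ?thesis by (simp add: algebra_simps)
qed

end

section \<open>Heights of random arborescences\<close>

lemma mset_eq_words:
  assumes "v \<in> words V d" "v' \<in> words V d"
  shows "mset v = mset v'"
proof (rule multiset_eqI)
  fix x
  show "count (mset v) x = count (mset v') x"
  proof (cases "x \<in> V")
    case True
    then show ?thesis using assms by (simp add: words_def count_mset)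
  next
    case False
    then have "x \<notin> set v" "x \<notin> set v'" using assms by (auto simp: words_def)
    then show ?thesis by (simp add: count_mset count_list_0_iff)
  qed
qed

lemma finite_words:
  assumes "finite V"
  shows "finite (words V d)"
proof (rule finite_subset)
  show "words V d \<subseteq> {xs. set xs \<subseteq> V \<and> length xs = sum d V}"
    using words_length[OF assms] by (auto simp: words_def)
  show "finite {xs. set xs \<subseteq> V \<and> length xs = sum d V}"
    using finite_lists_length_eq[OF assms] by simp
qed

lemma rev_words [simp]: "rev xs \<in> words V d \<longleftrightarrow> xs \<in> words V d"
  by (simp add: words_def)

text \<open>A permutation of positions taking \<open>v\<close> to \<open>v'\<close> maps one fibre
  of \<open>map f\<close> injectively into the other; by symmetry all fibres over rearrangements
  have equal size.\<close>

lemma card_map_eq_le: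
  fixes f :: "'c \<Rightarrow> 'i"
  assumes "mset v = mset v'"
  shows "card {l \<in> permutations_of_set C. map f l = v} \<le> card {l \<in> permutations_of_set C. map f l = v'}"
proof -
  obtain p where p: "p permutes {..<length v}" "permute_list p v = v'"
    using mset_eq_permutation[OF assms[symmetric]] by blast
  show ?thesis
  proof (rule card_inj_on_le[of "permute_list p"])
    show "permute_list p ` {l \<in> permutations_of_set C. map f l = v} \<subseteq> {l \<in> permutations_of_set C. map f l = v'}"
    proof clarify
      fix l assume l: "l \<in> permutations_of_set C" "v = map f l"
      then have "p permutes {..<length l}" using p by simp
      then show "permute_list p l \<in> permutations_of_set C \<and> map f (permute_list p l) = v'"
        using l p by (auto simp: permutations_of_set_def permute_list_map)
    qed
    show "inj_on (permute_list p) {l \<in> permutations_of_set C. map f l = v}"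
    proof (rule inj_onI)
      fix l m assume lm: "l \<in> {l \<in> permutations_of_set C. map f l = v}"
        "m \<in> {l \<in> permutations_of_set C. map f l = v}" "permute_list p l = permute_list p m"
      then have "length (map f l) = length v" "length (map f m) = length v" by simp_all
      then have len: "length l = length v" "length m = length v" by simp_all
      show "l = m"
      proof (rule nth_equalityI)
        fix i assume i: "i < length l"
        obtain j where j: "i = p j" using permutes_surj[OF p(1)] by (rule surjE)
        then have "j < length v" using permutes_in_image[OF p(1), of j] i len by simp
        then show "l ! i = m ! i"
          using permute_list_nth[of p l j] permute_list_nth[of p m j] p(1) len lm(3) j by simp
      qed (use len in simp)
    qed
  qed simp
qed

text \<open>The \<open>d i\<close> occurrences of \<open>i\<close> are made distinguishable, so that
  forgetting the second components turns a uniform permutation into a uniform word.\<close>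

definition word_slots :: "'a set \<Rightarrow> ('a \<Rightarrow> nat) \<Rightarrow> ('a \<times> nat) set" where
  "word_slots V d = (SIGMA i:V. {..<d i})"

lemma finite_word_slots: "finite V \<Longrightarrow> finite (word_slots V d)"
  by (simp add: word_slots_def)

lemma card_word_slots: "finite V \<Longrightarrow> card (word_slots V d) = sum d V"
  by (simp add: word_slots_def)

lemma word_slots_fibre: "i \<in> V \<Longrightarrow> {c \<in> word_slots V d. fst c = i} = {i} \<times> {..<d i}"
  by (auto simp: word_slots_def)

lemma fst_word_slots: "fst ` word_slots V d = {i\<in>V. 0 < d i}"
  by (force simp: word_slots_def)

lemma map_fst_permutation_in_words:
  assumes "finite V" "l \<in> permutations_of_set (word_slots V d)"
  shows "map fst l \<in> words V d"
proof -
  have l: "set l = word_slots V d" "distinct l" using assms by (auto dest: permutations_of_setD)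
  have "count_list (map fst l) i = d i" if "i \<in> V" for i
  proof -
    have "count_list (map fst l) i = length (filter (\<lambda>c. fst c = i) l)"
      by (induction l) auto
    also have "\<dots> = card {c \<in> set l. fst c = i}"
      using l(2) by (simp flip: distinct_card add: distinct_filter)
    finally show ?thesis using l word_slots_fibre[OF that, of d] by simp
  qed
  moreover have "set (map fst l) \<subseteq> V" using l fst_word_slots[of V d] by auto
  ultimately show ?thesis by (simp add: words_def)
qed

text \<open>Every word is the image of the same number \<open>F\<close> of permutations, so
  proportions carry over.\<close>

lemma card_words_le:
  assumes "finite V"
    and le: "real (card {l \<in> permutations_of_set (word_slots V d). Q (map fst l)}) \<le> e * fact (sum d V)"
  shows "real (card {v \<in> words V d. Q v}) \<le> e * real (card (words V d))"
proof -
  let ?P = "permutations_of_set (word_slots V d)"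
  let ?F = "\<lambda>v. {l \<in> ?P. map fst l = v}"
  obtain l0 where "l0 \<in> ?P"
    using finite_distinct_list[OF finite_word_slots[OF assms(1)]] by (auto simp: permutations_of_set_def)
  then have v0: "map fst l0 \<in> words V d" by (rule map_fst_permutation_in_words[OF assms(1)])
  define F where "F = card (?F (map fst l0))"
  have F: "card (?F v) = F" if "v \<in> words V d" for v
    unfolding F_def using mset_eq_words[OF that v0] by (intro antisym card_map_eq_le) auto
  have count: "card {l \<in> ?P. R (map fst l)} = F * card {v \<in> words V d. R v}" for R
  proof -
    have "{l \<in> ?P. R (map fst l)} = (\<Union>v\<in>{v \<in> words V d. R v}. ?F v)"
      using map_fst_permutation_in_words[OF assms(1)] by auto
    also have "card \<dots> = (\<Sum>v\<in>{v \<in> words V d. R v}. card (?F v))"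
      using finite_words[OF assms(1)] by (intro card_UN_disjoint) auto
    also have "\<dots> = (\<Sum>v\<in>{v \<in> words V d. R v}. F)" using F by (intro sum.cong) auto
    finally show ?thesis by simp
  qed
  have fact_eq: "fact (sum d V) = F * card (words V d)"
    using count[of "\<lambda>_. True"] card_word_slots[OF assms(1), of d] finite_word_slots[OF assms(1), of d] by simp
  have "0 < F"
  proof (rule ccontr)
    assume "\<not> 0 < F"
    then have "(fact (sum d V) :: nat) = 0" using fact_eq by simp
    then show False by simp
  qed
  have "real F * real (card {v \<in> words V d. Q v}) \<le> e * fact (sum d V)"
    using le unfolding count by simp
  also have "fact (sum d V) = real F * real (card (words V d))"
    using arg_cong[OF fact_eq, of real] by simp
  finally show ?thesis using \<open>0 < F\<close> by (simp add: mult.left_commute)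
qed

text \<open>Words are stored with the last letter first, while stopping times read them from the
  root.\<close>

lemma card_words_rev: "card {xs \<in> words V d. Q xs} = card {v \<in> words V d. Q (rev v)}"
proof -
  have "{xs \<in> words V d. Q xs} = rev ` {v \<in> words V d. Q (rev v)}"
  proof (intro equalityI subsetI)
    fix xs assume "xs \<in> {xs \<in> words V d. Q xs}"
    then show "xs \<in> rev ` {v \<in> words V d. Q (rev v)}" by (intro image_eqI[of _ _ "rev xs"]) auto
  qed auto
  then show ?thesis by (simp add: card_image)
qed

section \<open>Union bounds over leaves\<close>

locale degrees =
  fixes V :: "'a set" and d :: "'a \<Rightarrow> nat"
  assumes finite_V: "finite V" and card_V: "card V = Suc (sum d V)"
begin

abbreviation N :: nat where "N \<equiv> sum d V"

text \<open>The number of repeats in every word, one less than the number of leaves.\<close>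

definition \<alpha> :: nat where "\<alpha> = (\<Sum>i\<in>V. d i - 1)"

definition S :: real where "S = (\<Sum>i\<in>V. real (d i) * (real (d i) - 1))"

sublocale slots: coloured_set "word_slots V d" fst
  by unfold_locales (rule finite_word_slots[OF finite_V])

lemma excess_slots: "i \<in> V \<Longrightarrow> slots.excess i = d i - 1"
  unfolding slots.excess_def by (simp add: word_slots_fibre card_cartesian_product)

lemma sum_excess_slots: "sum slots.excess (fst ` word_slots V d) = \<alpha>"
proof -
  have "sum slots.excess (fst ` word_slots V d) = (\<Sum>i\<in>{i\<in>V. 0 < d i}. d i - 1)"
    unfolding fst_word_slots by (intro sum.cong) (auto simp: excess_slots)
  also have "\<dots> = \<alpha>" unfolding \<alpha>_def using finite_V by (intro sum.mono_neutral_left) auto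
  finally show ?thesis .
qed

lemma second_moment_slots: "slots.second_moment = S"
proof -
  have "slots.second_moment = (\<Sum>i\<in>{i\<in>V. 0 < d i}. real (d i) * (real (d i) - 1))"
    unfolding slots.second_moment_def fst_word_slots
    by (intro sum.cong) (auto simp: excess_slots of_nat_diff)
  also have "\<dots> = S" unfolding S_def using finite_V by (intro sum.mono_neutral_left) auto
  finally show ?thesis .
qed

lemma words_large_first_gap_le:
  assumes "0 < S" "1 \<le> z" "z * real N / sqrt S \<le> real t"
  shows "real (card {xs \<in> words V d. 2 * t + 1 \<le> gap 0 xs}) \<le> 2 * exp (- z / 12) * card (words V d)"
  unfolding card_words_rev[of V d "\<lambda>xs. 2 * t + 1 \<le> gap 0 xs"]
  using slots.card_large_first_gap_le[of z t] assms
  by (intro card_words_le[OF finite_V]) (simp add: second_moment_slots card_word_slots[OF finite_V])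

lemma words_large_gap_le:
  assumes "8 \<le> K" "18432 * real K \<le> real \<alpha>"
  shows "real (card {xs \<in> words V d. h + 1 \<le> gap K xs})
    \<le> (2 * exp (- real K / 192) + exp (- (real h * sqrt (real \<alpha> * K) / (136 * real N)))) * card (words V d)"
  unfolding card_words_rev[of V d "\<lambda>xs. h + 1 \<le> gap K xs"]
  using slots.card_large_gap_le[of K h] assms
  by (intro card_words_le[OF finite_V])
    (simp add: sum_excess_slots card_word_slots[OF finite_V] del: of_nat_sum)

lemma card_leaves: "card (leaves V d) = Suc \<alpha>"
proof -
  have "N + card (leaves V d) = (\<Sum>i\<in>V. d i + of_bool (d i = 0))"
    using finite_V by (simp add: sum.distrib leaves_def Int_def)
  also have "\<dots> = (\<Sum>i\<in>V. (d i - 1) + 1)" by (intro sum.cong) auto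
  also have "\<dots> = \<alpha> + card V" by (simp only: sum.distrib \<alpha>_def) simp
  finally show ?thesis using card_V by simp
qed

lemma bij_betw_words:
  "distinct ls \<Longrightarrow> set ls = leaves V d \<Longrightarrow>
    bij_betw (\<lambda>xs. tree_of_word xs ls) (words V d) (arborescences V d)"
  using bij_betw_tree_of_word[OF finite_V card_V] by blast

lemma ex_leaf_list:
  obtains ls where "distinct ls" "set ls = leaves V d"
  using finite_distinct_list[of "leaves V d"] finite_V by (auto simp: leaves_def)

lemma finite_arborescences: "finite (arborescences V d)"
proof -
  obtain ls where "distinct ls" "set ls = leaves V d" by (rule ex_leaf_list)
  then show ?thesis using bij_betw_finite[OF bij_betw_words] finite_words[OF finite_V, of d] by blast
qed

lemma card_arborescences: "card (arborescences V d) = card (words V d)"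
proof -
  obtain ls where "distinct ls" "set ls = leaves V d" by (rule ex_leaf_list)
  then show ?thesis using bij_betw_same_card[OF bij_betw_words] by metis
qed

text \<open>The freedom of the leaf order enters here: listing \<open>fs\<close> as the first leaves
  and \<open>l\<close> as the next turns the distance of \<open>l\<close> into a gap whose law
  depends only on the length of \<open>fs\<close>.\<close>

lemma card_far_leaf_le:
  assumes "distinct (l # fs)" "set (l # fs) \<subseteq> leaves V d"
  shows "card {t \<in> arborescences V d. H + Max (insert 0 (depth t ` set fs)) \<le> depth t l}
    \<le> card {xs \<in> words V d. H \<le> gap (length fs) xs}"
proof -
  have "finite (leaves V d - set (l # fs))" using finite_V by (simp add: leaves_def)
  then obtain as where as: "distinct as" "set as = leaves V d - set (l # fs)"
    using finite_distinct_list by blast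
  define ls where "ls = as @ l # fs"
  have ls: "distinct ls" "set ls = leaves V d" using assms as by (auto simp: ls_def)
  have "{t \<in> arborescences V d. H + Max (insert 0 (depth t ` set fs)) \<le> depth t l}
      \<subseteq> (\<lambda>xs. tree_of_word xs ls) ` {xs \<in> words V d. H \<le> gap (length fs) xs}"
  proof clarify
    fix r E assume t: "(r, E) \<in> arborescences V d"
      and H: "H + Max (insert 0 (depth (r, E) ` set fs)) \<le> depth (r, E) l"
    then have "(r, E) \<in> (\<lambda>xs. tree_of_word xs ls) ` words V d"
      using bij_betw_imp_surj_on[OF bij_betw_words[OF ls]] by simp
    then obtain xs where xs: "xs \<in> words V d" "tree_of_word xs ls = (r, E)" by fastforce
    have "depth (r, E) l \<le> gap (length fs) xs + Max (insert 0 (depth (r, E) ` set fs))"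
      using depth_leaf_le_gap[OF xs(1) finite_V card_V, of as l fs] ls xs(2) by (simp add: ls_def)
    then have "H \<le> gap (length fs) xs" using H by linarith
    then show "(r, E) \<in> (\<lambda>xs. tree_of_word xs ls) ` {xs \<in> words V d. H \<le> gap (length fs) xs}"
      using xs by (intro image_eqI[of _ _ xs]) simp_all
  qed
  then show ?thesis using finite_words[OF finite_V] by (intro surj_card_le) auto
qed

text \<open>All leaves of a block are compared with the same \<open>k m\<close> leaves of the
  earlier blocks, not with one another, so a block costs one gap bound times its size, here bounded
  by \<open>k (Suc m)\<close>.\<close>

lemma card_chain_le:
  assumes ls: "distinct ls" "set ls = leaves V d"
    and k: "k 0 = 0" "\<And>i. k i \<le> k (Suc i)" "k m \<le> length ls"
  shows "card {t \<in> arborescences V d. (\<Sum>i<m. H i) < Max (insert 0 (depth t ` set (take (k m) ls)))}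
    \<le> (\<Sum>i<m. k (Suc i) * card {xs \<in> words V d. H i \<le> gap (k i) xs})"
  using k(3)
proof (induction m)
  case 0
  then show ?case by (simp add: k)
next
  case (Suc m)
  let ?T = "arborescences V d"
  define M where "M m t = Max (insert 0 (depth t ` set (take (k m) ls)))" for m t
  let ?B = "\<lambda>j. {t \<in> ?T. H m + M m t \<le> depth t (ls ! j)}"
  let ?J = "{k m..<k (Suc m)}"
  have kl: "k m \<le> length ls" using k(2)[of m] Suc.prems by simp
  \<comment> \<open>If no leaf of the new block rises by \<open>H m\<close> above the earlier
    maximum \<open>M m t\<close>, the maximum grows by at most \<open>H m\<close>.\<close>
  have sub: "{t \<in> ?T. (\<Sum>i<Suc m. H i) < M (Suc m) t} \<subseteq> {t \<in> ?T. (\<Sum>i<m. H i) < M m t} \<union> (\<Union>j\<in>?J. ?B j)"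
  proof (rule subsetI, rule ccontr)
    fix t assume t: "t \<in> {t \<in> ?T. (\<Sum>i<Suc m. H i) < M (Suc m) t}"
      and nt: "t \<notin> {t \<in> ?T. (\<Sum>i<m. H i) < M m t} \<union> (\<Union>j\<in>?J. ?B j)"
    have m: "M m t \<le> (\<Sum>i<m. H i)" using t nt by (simp add: not_less)
    have j: "depth t (ls ! j) < H m + M m t" if "j \<in> ?J" for j
    proof (rule ccontr)
      assume "\<not> depth t (ls ! j) < H m + M m t"
      then have "t \<in> ?B j" using t by (simp add: not_less)
      then show False using nt that by blast
    qed
    have sumS: "(\<Sum>i<Suc m. H i) = (\<Sum>i<m. H i) + H m" by simp
    have "x \<le> (\<Sum>i<Suc m. H i)" if x: "x \<in> insert 0 (depth t ` set (take (k (Suc m)) ls))" for x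
    proof (cases "x = 0")
      case False
      then obtain j where j': "j < k (Suc m)" "x = depth t (ls ! j)"
        using x Suc.prems by (auto simp: in_set_conv_nth)
      show ?thesis
      proof (cases "j < k m")
        case True
        then have "ls ! j \<in> set (take (k m) ls)"
          using kl by (auto simp: in_set_conv_nth intro!: exI[of _ j])
        then have "x \<le> M m t" unfolding M_def using j' by (intro Max_ge) auto
        then show ?thesis using m sumS by linarith
      next
        case False
        then have "j \<in> ?J" using j' by simp
        from j[OF this] show ?thesis using j'(2) m sumS by linarith
      qed
    qed simp
    then have "M (Suc m) t \<le> (\<Sum>i<Suc m. H i)" unfolding M_def by (intro Max.boundedI) simp_all
    then show False using t by simp
  qed
  have B: "card (?B j) \<le> card {xs \<in> words V d. H m \<le> gap (k m) xs}" if "j \<in> ?J" for j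
  proof -
    have j: "k m \<le> j" "j < length ls" using that Suc.prems by auto
    have "ls ! j \<notin> set (take (k m) ls)"
    proof
      assume "ls ! j \<in> set (take (k m) ls)"
      then obtain i where "i < k m" "i < length ls" "ls ! j = ls ! i" by (auto simp: in_set_conv_nth)
      then show False using nth_eq_iff_index_eq[OF ls(1) j(2), of i] j(1) by simp
    qed
    moreover have "set (ls ! j # take (k m) ls) \<subseteq> leaves V d"
      using set_take_subset[of "k m" ls] nth_mem[OF j(2)] ls(2) by simp
    ultimately show ?thesis
      using card_far_leaf_le[of "ls ! j" "take (k m) ls" "H m"] ls(1) kl by (simp add: M_def)
  qed
  have "card {t \<in> ?T. (\<Sum>i<Suc m. H i) < M (Suc m) t}
      \<le> card ({t \<in> ?T. (\<Sum>i<m. H i) < M m t} \<union> (\<Union>j\<in>?J. ?B j))"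
    using finite_arborescences by (intro card_mono[OF _ sub]) auto
  also have "\<dots> \<le> card {t \<in> ?T. (\<Sum>i<m. H i) < M m t} + card (\<Union>j\<in>?J. ?B j)"
    by (rule card_Un_le)
  also have "card (\<Union>j\<in>?J. ?B j) \<le> (\<Sum>j\<in>?J. card (?B j))" by (intro card_UN_le) simp
  also have "\<dots> \<le> (\<Sum>j\<in>?J. card {xs \<in> words V d. H m \<le> gap (k m) xs})"
    using B by (rule sum_mono)
  also have "\<dots> \<le> k (Suc m) * card {xs \<in> words V d. H m \<le> gap (k m) xs}" by simp
  also have "card {t \<in> ?T. (\<Sum>i<m. H i) < M m t}
      \<le> (\<Sum>i<m. k (Suc i) * card {xs \<in> words V d. H i \<le> gap (k i) xs})"
    unfolding M_def using Suc.IH kl by simp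
  finally show ?case by (simp add: M_def)
qed

lemma depth_le_leaves:
  assumes "t \<in> arborescences V d" "v \<in> V"
  shows "depth t v \<le> Max (insert 0 (depth t ` leaves V d))"
proof -
  have a: "arborescence V (fst t) (snd t)" using assms by (auto simp: arborescences_def)
  have "depth t v \<le> Max (depth t ` leaves V d)"
    using assms depth_edge[OF a] finite_V by (intro level_le_leaf[of "fst t" "snd t"]) auto
  also have "\<dots> \<le> Max (insert 0 (depth t ` leaves V d))"
  proof (rule Max_mono)
    show "depth t ` leaves V d \<noteq> {}" using card_leaves by auto
  qed (use finite_V in \<open>auto simp: leaves_def\<close>)
  finally show ?thesis .
qed

lemma card_high_le:
  fixes e :: "nat \<Rightarrow> real"
  assumes k: "k 0 = 0" "\<And>i. k i \<le> k (Suc i)" "k m = Suc \<alpha>"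
    and e: "\<And>i. i < m \<Longrightarrow> real (k (Suc i)) * real (card {xs \<in> words V d. H i \<le> gap (k i) xs}) \<le> e i * card (words V d)"
  shows "real (card {t \<in> arborescences V d. \<exists>v\<in>V. (\<Sum>i<m. H i) < depth t v}) \<le> (\<Sum>i<m. e i) * card (arborescences V d)"
proof -
  obtain ls where ls: "distinct ls" "set ls = leaves V d" by (rule ex_leaf_list)
  have len: "length ls = Suc \<alpha>" using distinct_card[OF ls(1)] card_leaves ls(2) by simp
  have "{t \<in> arborescences V d. \<exists>v\<in>V. (\<Sum>i<m. H i) < depth t v}
      \<subseteq> {t \<in> arborescences V d. (\<Sum>i<m. H i) < Max (insert 0 (depth t ` set (take (k m) ls)))}"
  proof
    fix t assume t: "t \<in> {t \<in> arborescences V d. \<exists>v\<in>V. (\<Sum>i<m. H i) < depth t v}"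
    then obtain v where v: "v \<in> V" "(\<Sum>i<m. H i) < depth t v" by auto
    have tk: "take (k m) ls = ls" using len k(3) by simp
    show "t \<in> {t \<in> arborescences V d. (\<Sum>i<m. H i) < Max (insert 0 (depth t ` set (take (k m) ls)))}"
      unfolding tk ls(2) using t order.strict_trans2[OF v(2) depth_le_leaves[OF _ v(1)]] by blast
  qed
  then have "card {t \<in> arborescences V d. \<exists>v\<in>V. (\<Sum>i<m. H i) < depth t v}
      \<le> card {t \<in> arborescences V d. (\<Sum>i<m. H i) < Max (insert 0 (depth t ` set (take (k m) ls)))}"
    using finite_arborescences by (intro card_mono) auto
  also have "\<dots> \<le> (\<Sum>i<m. k (Suc i) * card {xs \<in> words V d. H i \<le> gap (k i) xs})"
    by (rule card_chain_le[OF ls k(1,2)]) (use k(3) len in simp)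
  finally have "real (card {t \<in> arborescences V d. \<exists>v\<in>V. (\<Sum>i<m. H i) < depth t v})
      \<le> real (\<Sum>i<m. k (Suc i) * card {xs \<in> words V d. H i \<le> gap (k i) xs})" by (rule of_nat_mono)
  also have "\<dots> = (\<Sum>i<m. real (k (Suc i)) * real (card {xs \<in> words V d. H i \<le> gap (k i) xs}))" by simp
  also have "\<dots> \<le> (\<Sum>i<m. e i * card (words V d))" using e by (intro sum_mono) auto
  finally show ?thesis by (simp add: card_arborescences sum_distrib_right)
qed

end

section \<open>Rooted trees as graphs\<close>

context pair_graph
begin

lemma connected_iff_awalks:
  "Digraph_Component.connected (with_proj G) \<longleftrightarrow>
    pverts G \<noteq> {} \<and> (\<forall>u\<in>pverts G. \<forall>v\<in>pverts G. \<exists>p. awalk u p v)"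
proof -
  have "u \<rightarrow>\<^sup>*\<^bsub>mk_symmetric G\<^esub> v \<longleftrightarrow> (\<exists>p. awalk u p v)" for u v
    by (rule trans[OF reachable_mk_symmetric_eq[OF pair_sym_arcs] reachable_awalk])
  then show ?thesis by (simp add: Digraph_Component.connected_def strongly_connected_def)
qed

text \<open>The walk is shortened to a path and closed by the arc \<open>(b, a)\<close>. Since the
  arc \<open>(a, b)\<close> is avoided, the path has at least two arcs, so the cycle is not merely a
  pair of opposite arcs.\<close>

lemma ex_long_cycle:
  assumes p: "awalk a p b" and "a \<noteq> b" "(b, a) \<in> parcs G" "(a, b) \<notin> set p"
  shows "\<exists>q. cycle q \<and> 3 \<le> length q"
proof -
  define q where "q = awalk_to_apath p"
  have q: "apath a q b" "set q \<subseteq> set p"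
    using apath_awalk_to_apath[OF p] awalk_to_apath_subset[OF p] by (simp_all add: q_def)
  have walk: "awalk a q b" and dist: "distinct (awalk_verts a q)" using q by (auto simp: apath_def)
  have "2 \<le> length q"
  proof (rule ccontr)
    assume "\<not> 2 \<le> length q"
    then have "length q = 0 \<or> length q = 1" by linarith
    then consider "q = []" | e where "q = [e]" by (auto simp: length_Suc_conv)
    then show False
    proof cases
      case 1
      then show ?thesis using walk \<open>a \<noteq> b\<close> by (simp add: awalk_Nil_iff)
    next
      case (2 e)
      then have "e = (a, b)" using walk by (cases e) (auto simp: awalk_simps)
      then show ?thesis using 2 q assms(4) by auto
    qed
  qed
  moreover have "awalk b ((b, a) # q) b"
    using walk assms(3) by (auto simp: awalk_Cons_iff dest: in_arcsD1)
  then have "cycle ((b, a) # q)" using dist by (auto simp: cycle_def intro!: exI[of _ b])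
  ultimately show ?thesis by (intro exI[of _ "(b, a) # q"]) simp
qed

end

lemma graph_dist_le: "pre_digraph.awalk (with_proj G) u p v \<Longrightarrow> graph_dist G u v \<le> length p"
  unfolding graph_dist_def by (intro Least_le) auto

definition ascending_arcs :: "'a rooted_tree \<Rightarrow> ('a \<times> 'a) set" where
  "ascending_arcs t = {(u, v). u \<in> pverts (fst t) \<and> v \<in> children t u}"

context
  fixes t :: "'a rooted_tree"
  assumes tree: "is_rooted_tree t"
begin

interpretation pair_graph "fst t"
  using tree by (simp add: is_rooted_tree_def undirected_tree_def)

lemma root_in_pverts: "snd t \<in> pverts (fst t)"
  using tree by (simp add: is_rooted_tree_def)

lemma no_long_cycle: "\<not> (\<exists>p. cycle p \<and> 3 \<le> length p)"
  using tree by (auto simp: is_rooted_tree_def undirected_tree_def)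

lemma ex_geodesic:
  assumes "v \<in> pverts (fst t)"
  shows "\<exists>p. awalk (snd t) p v \<and> length p = graph_dist (fst t) (snd t) v"
proof -
  have "\<exists>p. awalk (snd t) p v"
    using tree connected_iff_awalks root_in_pverts assms
    by (auto simp: is_rooted_tree_def undirected_tree_def)
  then have "\<exists>k p. awalk (snd t) p v \<and> length p = k" by auto
  then show ?thesis unfolding graph_dist_def by (rule LeastI_ex)
qed

lemma graph_dist_root: "graph_dist (fst t) (snd t) (snd t) = 0"
  using graph_dist_le[of "fst t" "snd t" "[]" "snd t"] root_in_pverts by (simp add: awalk_Nil_iff)

lemma graph_dist_arc_le:
  assumes "(u, v) \<in> parcs (fst t)"
  shows "graph_dist (fst t) (snd t) v \<le> Suc (graph_dist (fst t) (snd t) u)"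
proof -
  obtain p where p: "awalk (snd t) p u" "length p = graph_dist (fst t) (snd t) u"
    using ex_geodesic in_arcsD1[OF assms] by blast
  have "awalk (snd t) (p @ [(u, v)]) v"
    using p(1) assms by (auto simp: awalk_simps dest: in_arcsD1 in_arcsD2)
  from graph_dist_le[OF this] show ?thesis using p(2) by simp
qed

lemma ascending_parent:
  assumes "v \<in> pverts (fst t)" "v \<noteq> snd t"
  obtains u where "(u, v) \<in> parcs (fst t)" "graph_dist (fst t) (snd t) v = Suc (graph_dist (fst t) (snd t) u)"
proof -
  obtain p where p: "awalk (snd t) p v" "length p = graph_dist (fst t) (snd t) v"
    using ex_geodesic assms(1) by blast
  have "p \<noteq> []" using p(1) assms(2) by (auto simp: awalk_Nil_iff)
  then obtain q e where q: "p = q @ [e]" by (cases p rule: rev_cases) auto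
  obtain u w where e: "e = (u, w)" by fastforce
  have "awalk (snd t) q u" "w = v" "(u, v) \<in> parcs (fst t)"
    using p(1) unfolding q e by (auto simp: awalk_simps)
  moreover from this have "graph_dist (fst t) (snd t) u \<le> length q" by (intro graph_dist_le)
  ultimately show ?thesis using that[of u] graph_dist_arc_le[of u v] p(2) q by simp
qed

lemma ex_ascending_walk:
  assumes "v \<in> pverts (fst t)"
  shows "\<exists>p. awalk (snd t) p v \<and> (\<forall>(x, y)\<in>set p.
    graph_dist (fst t) (snd t) y = Suc (graph_dist (fst t) (snd t) x) \<and>
    graph_dist (fst t) (snd t) y \<le> graph_dist (fst t) (snd t) v)"
  using assms
proof (induction "graph_dist (fst t) (snd t) v" arbitrary: v rule: less_induct)
  case less
  show ?case
  proof (cases "v = snd t")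
    case True
    then show ?thesis using less.prems by (intro exI[of _ "[]"]) (simp add: awalk_Nil_iff)
  next
    case False
    then obtain u where u: "(u, v) \<in> parcs (fst t)" "graph_dist (fst t) (snd t) v = Suc (graph_dist (fst t) (snd t) u)"
      using ascending_parent less.prems by blast
    then obtain p where p: "awalk (snd t) p u" "\<forall>(x, y)\<in>set p.
        graph_dist (fst t) (snd t) y = Suc (graph_dist (fst t) (snd t) x) \<and>
        graph_dist (fst t) (snd t) y \<le> graph_dist (fst t) (snd t) u"
      using less.hyps[of u] in_arcsD1[OF u(1)] by auto
    have "awalk (snd t) (p @ [(u, v)]) v"
      using p(1) u(1) by (auto simp: awalk_simps dest: in_arcsD1 in_arcsD2)
    moreover have "\<forall>(x, y)\<in>set (p @ [(u, v)]).
        graph_dist (fst t) (snd t) y = Suc (graph_dist (fst t) (snd t) x) \<and>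
        graph_dist (fst t) (snd t) y \<le> graph_dist (fst t) (snd t) v"
      using p(2) u(2) by fastforce
    ultimately show ?thesis by blast
  qed
qed

lemma set_rev_path: "set (rev_path p) = (\<lambda>(x, y). (y, x)) ` set p"
  by (induction p) auto

text \<open>Two ascending walks are joined at the root. The two properties of the arcs serve to keep
  a given arc off the walk: one that joins equal distances, or one that leads beyond both
  endpoints.\<close>

lemma ex_walk_through_root:
  assumes "u \<in> pverts (fst t)" "v \<in> pverts (fst t)"
  shows "\<exists>p. awalk u p v \<and> (\<forall>(x, y)\<in>set p.
    graph_dist (fst t) (snd t) x \<noteq> graph_dist (fst t) (snd t) y \<and>
    graph_dist (fst t) (snd t) y \<le> max (graph_dist (fst t) (snd t) u) (graph_dist (fst t) (snd t) v))"
proof -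
  obtain p where p: "awalk (snd t) p u" "\<forall>(x, y)\<in>set p.
      graph_dist (fst t) (snd t) y = Suc (graph_dist (fst t) (snd t) x) \<and>
      graph_dist (fst t) (snd t) y \<le> graph_dist (fst t) (snd t) u"
    using ex_ascending_walk[OF assms(1)] by blast
  obtain q where q: "awalk (snd t) q v" "\<forall>(x, y)\<in>set q.
      graph_dist (fst t) (snd t) y = Suc (graph_dist (fst t) (snd t) x) \<and>
      graph_dist (fst t) (snd t) y \<le> graph_dist (fst t) (snd t) v"
    using ex_ascending_walk[OF assms(2)] by blast
  have "awalk u (rev_path p @ q) v" using p q by auto
  moreover have "\<forall>(x, y)\<in>set (rev_path p @ q).
      graph_dist (fst t) (snd t) x \<noteq> graph_dist (fst t) (snd t) y \<and>
      graph_dist (fst t) (snd t) y \<le> max (graph_dist (fst t) (snd t) u) (graph_dist (fst t) (snd t) v)"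
    using p(2) q(2) by (fastforce simp: set_rev_path)
  ultimately show ?thesis by blast
qed

text \<open>An arc between vertices at equal distance would close the walk through the root to a
  long cycle.\<close>

lemma graph_dist_arc_neq:
  assumes "(u, v) \<in> parcs (fst t)"
  shows "graph_dist (fst t) (snd t) u \<noteq> graph_dist (fst t) (snd t) v"
proof
  assume eq: "graph_dist (fst t) (snd t) u = graph_dist (fst t) (snd t) v"
  have uv: "u \<in> pverts (fst t)" "v \<in> pverts (fst t)" "u \<noteq> v"
    using assms pair_no_loops[OF assms] by (auto dest: in_arcsD1 in_arcsD2)
  obtain p where p: "awalk u p v" "\<forall>(x, y)\<in>set p. graph_dist (fst t) (snd t) x \<noteq> graph_dist (fst t) (snd t) y"
    using ex_walk_through_root[OF uv(1,2)] by fastforce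
  then have "(u, v) \<notin> set p" using eq by auto
  then show False using ex_long_cycle[OF p(1) uv(3)] arcs_symmetric[OF assms] no_long_cycle by blast
qed

text \<open>With two parents, the walk from \<open>u\<close> to \<open>u'\<close> continued to
  \<open>v\<close> would avoid the arc \<open>(u, v)\<close>, because \<open>v\<close> is farther
  from the root than all heads of arcs on the walk; closing it gives a long cycle.\<close>

lemma ascending_parent_unique:
  assumes "(u, v) \<in> parcs (fst t)" "(u', v) \<in> parcs (fst t)"
    and eq: "graph_dist (fst t) (snd t) v = Suc (graph_dist (fst t) (snd t) u)"
      "graph_dist (fst t) (snd t) v = Suc (graph_dist (fst t) (snd t) u')"
  shows "u = u'"
proof (rule ccontr)
  assume neq: "u \<noteq> u'"
  have uv: "u \<in> pverts (fst t)" "u' \<in> pverts (fst t)" "u \<noteq> v" "v \<in> pverts (fst t)"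
    using assms pair_no_loops[OF assms(1)] by (auto dest: in_arcsD1 in_arcsD2)
  obtain p where p: "awalk u p u'" "\<forall>(x, y)\<in>set p.
      graph_dist (fst t) (snd t) y \<le> max (graph_dist (fst t) (snd t) u) (graph_dist (fst t) (snd t) u')"
    using ex_walk_through_root[OF uv(1,2)] by fastforce
  have "awalk u (p @ [(u', v)]) v" using p assms(2) uv by (auto simp: awalk_simps)
  moreover have "(u, v) \<notin> set (p @ [(u', v)])" using p(2) eq neq by auto
  ultimately show False
    using ex_long_cycle[of u _ v] uv(3) arcs_symmetric[OF assms(1)] no_long_cycle by blast
qed

lemma ascending_arcs_iff:
  "(u, v) \<in> ascending_arcs t \<longleftrightarrow>
    (u, v) \<in> parcs (fst t) \<and> graph_dist (fst t) (snd t) v = Suc (graph_dist (fst t) (snd t) u)"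
  by (auto simp: ascending_arcs_def children_def dest: in_arcsD1)

lemma arborescence_ascending_arcs: "arborescence (pverts (fst t)) (snd t) (ascending_arcs t)"
  unfolding arborescence_def
proof (intro conjI ballI allI)
  show "finite (pverts (fst t))" by (rule pair_finite_verts)
  show "snd t \<in> pverts (fst t)" by (rule root_in_pverts)
  show "ascending_arcs t \<subseteq> pverts (fst t) \<times> pverts (fst t)"
    by (auto simp: ascending_arcs_iff dest: in_arcsD1 in_arcsD2)
  show "(u, snd t) \<notin> ascending_arcs t" for u by (simp add: ascending_arcs_iff graph_dist_root)
  show "\<exists>\<delta>::'a \<Rightarrow> nat. \<forall>(u, v)\<in>ascending_arcs t. \<delta> v = Suc (\<delta> u)"
    by (intro exI[of _ "graph_dist (fst t) (snd t)"]) (auto simp: ascending_arcs_iff)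
  fix v assume v: "v \<in> pverts (fst t) - {snd t}"
  then obtain u where u: "(u, v) \<in> ascending_arcs t"
    using ascending_parent[of v] by (auto simp: ascending_arcs_iff)
  then show "\<exists>!u. (u, v) \<in> ascending_arcs t"
    using ascending_parent_unique by (intro ex1I[of _ u]) (auto simp: ascending_arcs_iff)
qed

lemma parcs_eq_ascending_arcs: "parcs (fst t) = ascending_arcs t \<union> (ascending_arcs t)\<inverse>"
proof -
  have "(u, v) \<in> ascending_arcs t \<or> (v, u) \<in> ascending_arcs t" if "(u, v) \<in> parcs (fst t)" for u v
  proof -
    have "graph_dist (fst t) (snd t) v = Suc (graph_dist (fst t) (snd t) u)
        \<or> graph_dist (fst t) (snd t) u = Suc (graph_dist (fst t) (snd t) v)"
      using graph_dist_arc_le[OF that] graph_dist_arc_le[OF arcs_symmetric[OF that]]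
        graph_dist_arc_neq[OF that] by linarith
    then show ?thesis using that arcs_symmetric[OF that] by (simp add: ascending_arcs_iff)
  qed
  moreover have "(u, v) \<in> parcs (fst t)" "(v, u) \<in> parcs (fst t)" if "(u, v) \<in> ascending_arcs t" for u v
    using that arcs_symmetric by (auto simp: ascending_arcs_iff)
  ultimately show ?thesis by auto
qed

end

section \<open>From arborescences to rooted trees\<close>

definition tree_of_arborescence :: "'a set \<Rightarrow> 'a \<times> ('a \<times> 'a) set \<Rightarrow> 'a rooted_tree" where
  "tree_of_arborescence V t = (\<lparr>pverts = V, parcs = snd t \<union> (snd t)\<inverse>\<rparr>, fst t)"

lemma rooted_tree_eq_tree_of_arborescence:
  assumes "is_rooted_tree t"
  shows "t = tree_of_arborescence (pverts (fst t)) (snd t, ascending_arcs t)"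
  unfolding tree_of_arborescence_def using parcs_eq_ascending_arcs[OF assms] by (cases t) simp

context
  fixes V :: "'a set" and r E
  assumes arb: "arborescence V r E"
begin

abbreviation (input) "gr \<equiv> fst (tree_of_arborescence V (r, E))"

lemma gr_simps: "pverts gr = V" "parcs gr = E \<union> E\<inverse>" "snd (tree_of_arborescence V (r, E)) = r"
  by (simp_all add: tree_of_arborescence_def)

lemma pair_graph_gr: "pair_graph gr"
proof -
  have E: "E \<subseteq> V \<times> V" "finite V" "finite E"
    using arborescenceD[OF arb] arborescence_finite[OF arb] by auto
  have ne: "u \<noteq> v" if "(u, v) \<in> E" for u v using depth_edge[OF arb that] by auto
  then have "fst e \<noteq> snd e" if "e \<in> E \<union> E\<inverse>" for e using that by (cases e) (auto dest: ne)
  then show ?thesis using E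
    by unfold_locales (auto simp: gr_simps Digraph.symmetric_def sym_Un_converse)
qed

interpretation pair_graph gr
  by (rule pair_graph_gr)

text \<open>Depth changes by exactly one along each arc.\<close>

lemma awalk_length_ge:
  assumes "awalk u p v"
  shows "depth (r, E) v \<le> depth (r, E) u + length p"
  using assms
proof (induction p arbitrary: u)
  case (Cons e p)
  obtain x y where e: "e = (x, y)" by fastforce
  have "awalk y p v" "u = x" "(x, y) \<in> E \<or> (y, x) \<in> E"
    using Cons.prems by (auto simp: awalk_Cons_iff e gr_simps)
  then show ?case using Cons.IH[of y] depth_edge[OF arb, of x y] depth_edge[OF arb, of y x] by auto
qed (simp add: awalk_Nil_iff)

lemma ex_awalk_depth:
  assumes "v \<in> V"
  shows "\<exists>p. awalk r p v \<and> length p = depth (r, E) v"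
  using assms
proof (induction "depth (r, E) v" arbitrary: v rule: less_induct)
  case less
  show ?case
  proof (cases "v = r")
    case True
    then show ?thesis using less.prems depth_root[OF arb]
      by (intro exI[of _ "[]"]) (simp add: awalk_Nil_iff gr_simps)
  next
    case False
    then obtain u where u: "(u, v) \<in> E" "u \<in> V" using arborescence_parent[OF arb less.prems] by blast
    have d: "depth (r, E) v = Suc (depth (r, E) u)" by (rule depth_edge[OF arb u(1)])
    obtain p where p: "awalk r p u" "length p = depth (r, E) u" using less.hyps[of u] u d by auto
    have "awalk r (p @ [(u, v)]) v"
      using p(1) u less.prems by (auto simp: awalk_simps gr_simps)
    then show ?thesis using p(2) d by (intro exI[of _ "p @ [(u, v)]"]) simp
  qed
qed

lemma graph_dist_gr:
  assumes "v \<in> V"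
  shows "graph_dist gr r v = depth (r, E) v"
  unfolding graph_dist_def
proof (rule Least_equality)
  show "\<exists>p. awalk r p v \<and> length p = depth (r, E) v" by (rule ex_awalk_depth[OF assms])
  fix k assume "\<exists>p. awalk r p v \<and> length p = k"
  then show "depth (r, E) v \<le> k" using awalk_length_ge depth_root[OF arb] by fastforce
qed

lemma awalk_nth:
  assumes "awalk u p v" "j < length p"
  shows "p ! j = ((u # map snd p) ! j, (u # map snd p) ! Suc j)"
  using assms
proof (induction p arbitrary: u j)
  case (Cons e p)
  then show ?case by (cases j) (auto simp: awalk_Cons_iff prod_eq_iff)
qed simp

text \<open>Both neighbours of a deepest vertex on the cycle must be its parent, hence equal, which
  is impossible on a cycle of length at least three.\<close>

lemma no_long_cycle_gr: "\<not> (\<exists>p. cycle p \<and> 3 \<le> length p)"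
proof
  assume "\<exists>p. cycle p \<and> 3 \<le> length p"
  then obtain p u where p: "awalk u p u" "distinct (tl (awalk_verts u p))" "3 \<le> length p"
    by (auto simp: cycle_def)
  define n where "n = length p"
  define w where "w j = (u # map snd p) ! j" for j
  have av: "awalk_verts u p = u # map snd p"
  proof -
    have "pcas u p u" using p(1) by auto
    then show ?thesis using awalk_verts_conv'[of u p u] p(3) by (cases p) auto
  qed
  \<comment> \<open>Only the tail of the vertex list is distinct, so positions run from 1 to
    \<open>n\<close>, and position 0 repeats position \<open>n\<close>.\<close>
  have inj: "i = j" if "w i = w j" "1 \<le> i" "i \<le> n" "1 \<le> j" "j \<le> n" for i j
  proof -
    have "distinct (map snd p)" using p(2) av by simp
    then show ?thesis using that nth_eq_iff_index_eq[of "map snd p" "i - 1" "j - 1"]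
      by (cases i; cases j) (auto simp: w_def n_def)
  qed
  have w0: "w 0 = w n"
  proof -
    have "awlast u p = u" using p(1) by auto
    then have "last (u # map snd p) = u" using av by simp
    then show ?thesis using last_conv_nth[of "u # map snd p"] by (simp add: w_def n_def)
  qed
  have arc: "(w j, w (Suc j)) \<in> E \<or> (w (Suc j), w j) \<in> E" if "j < n" for j
  proof -
    have "p ! j \<in> parcs gr" using p(1) that by (auto simp: awalk_def n_def)
    then show ?thesis using awalk_nth[OF p(1), of j] that by (auto simp: gr_simps w_def n_def)
  qed
  have n3: "3 \<le> n" using p(3) by (simp add: n_def)
  let ?D = "\<lambda>j. depth (r, E) (w j)"
  obtain i where i: "i \<in> {1..n}" "\<And>j. j \<in> {1..n} \<Longrightarrow> ?D j \<le> ?D i"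
  proof -
    have "Max (?D ` {1..n}) \<in> ?D ` {1..n}" using n3 by (intro Max_in) auto
    then obtain i where i: "i \<in> {1..n}" "Max (?D ` {1..n}) = ?D i" by auto
    have "?D j \<le> ?D i" if "j \<in> {1..n}" for j unfolding i(2)[symmetric] using that by (intro Max_ge) auto
    then show ?thesis using that i(1) by blast
  qed
  have le: "?D j \<le> ?D i" if "j \<le> n" for j
    using i(2)[of j] i(2)[of n] that w0 n3 by (cases "j = 0") auto
  \<comment> \<open>The cyclic neighbours of \<open>i\<close>: \<open>a\<close> may be 0, which
    stands for \<open>n\<close>, and \<open>b\<close> wraps around to 1.\<close>
  define a where "a = i - 1"
  define b where "b = (if i = n then 1 else Suc i)"
  have pa: "(w a, w i) \<in> E"
  proof -
    have a: "a < n" "Suc a = i" using i(1) by (auto simp: a_def)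
    then show ?thesis using arc[of a] le[of a] depth_edge[OF arb, of "w i" "w a"] by auto
  qed
  have pb: "(w b, w i) \<in> E"
  proof (cases "i = n")
    case True
    then show ?thesis
      using arc[of 0] w0 n3 le[of 1] depth_edge[OF arb, of "w n" "w 1"] by (auto simp: b_def)
  next
    case False
    then show ?thesis
      using arc[of i] i(1) le[of "Suc i"] depth_edge[OF arb, of "w i" "w (Suc i)"] by (auto simp: b_def)
  qed
  have eq: "w a = w b" by (rule arborescence_parent_unique[OF arb pa pb])
  show False
  proof (cases "a = 0")
    case True
    then have "i = 1" using i(1) by (auto simp: a_def)
    then have "b = 2" using n3 by (auto simp: b_def)
    then show False using inj[of n 2] eq True w0 n3 by auto
  next
    case False
    then have "a = b" using inj[of a b] eq i(1) n3 by (auto simp: a_def b_def)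
    then show False using i(1) n3 by (auto simp: a_def b_def split: if_splits)
  qed
qed

lemma is_rooted_tree_gr: "is_rooted_tree (tree_of_arborescence V (r, E))"
proof -
  have r: "r \<in> V" by (rule arborescenceD[OF arb])
  have "\<exists>p. awalk u p v" if "u \<in> V" "v \<in> V" for u v
  proof -
    obtain p where "awalk r p u" using ex_awalk_depth \<open>u \<in> V\<close> by blast
    moreover obtain q where "awalk r q v" using ex_awalk_depth \<open>v \<in> V\<close> by blast
    ultimately have "awalk u (rev_path p @ q) v" by auto
    then show ?thesis by blast
  qed
  then have "Digraph_Component.connected (with_proj gr)"
    using r by (auto simp: connected_iff_awalks gr_simps)
  then show ?thesis
    using pair_graph_gr no_long_cycle_gr r
    by (simp add: is_rooted_tree_def undirected_tree_def gr_simps)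
qed

lemma children_gr: "u \<in> V \<Longrightarrow> children (tree_of_arborescence V (r, E)) u = E `` {u}"
proof -
  assume u: "u \<in> V"
  have E: "E \<subseteq> V \<times> V" using arborescenceD[OF arb] by simp
  show ?thesis
  proof (intro equalityI subsetI)
    fix v assume "v \<in> children (tree_of_arborescence V (r, E)) u"
    then have v: "(u, v) \<in> E \<or> (v, u) \<in> E" "graph_dist gr r v = graph_dist gr r u + 1"
      by (auto simp: children_def gr_simps)
    then have "v \<in> V" using E by auto
    then have "depth (r, E) v = Suc (depth (r, E) u)" using v(2) u by (simp add: graph_dist_gr)
    then show "v \<in> E `` {u}" using v(1) depth_edge[OF arb, of v u] by auto
  next
    fix v assume "v \<in> E `` {u}"
    then have v: "(u, v) \<in> E" by simp
    then have "v \<in> V" using E by auto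
    then show "v \<in> children (tree_of_arborescence V (r, E)) u"
      using v u depth_edge[OF arb v] by (simp add: children_def gr_simps graph_dist_gr)
  qed
qed

lemma tree_height_gr: "tree_height (tree_of_arborescence V (r, E)) = Max (depth (r, E) ` V)"
  unfolding tree_height_def gr_simps using graph_dist_gr by (intro arg_cong[of _ _ Max] image_cong) auto

lemma ascending_arcs_gr: "ascending_arcs (tree_of_arborescence V (r, E)) = E"
  using children_gr arborescenceD(3)[OF arb] by (auto simp: ascending_arcs_def gr_simps)

end

lemma trees_with_degrees_eq:
  "trees_with_degrees n d = tree_of_arborescence {1..n} ` arborescences {1..n} d"
proof (intro equalityI subsetI)
  fix t assume "t \<in> trees_with_degrees n d"
  then have t: "is_rooted_tree t" "pverts (fst t) = {1..n}" "\<forall>i\<in>{1..n}. card (children t i) = d i"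
    by (auto simp: trees_with_degrees_def)
  have arb: "arborescence {1..n} (snd t) (ascending_arcs t)"
    using arborescence_ascending_arcs[OF t(1)] t(2) by simp
  have eq: "t = tree_of_arborescence {1..n} (snd t, ascending_arcs t)"
    using rooted_tree_eq_tree_of_arborescence[OF t(1)] t(2) by simp
  have "(snd t, ascending_arcs t) \<in> arborescences {1..n} d"
    using t(3) children_gr[OF arb] arb eq by (auto simp: arborescences_def)
  then have "tree_of_arborescence {1..n} (snd t, ascending_arcs t)
      \<in> tree_of_arborescence {1..n} ` arborescences {1..n} d" by (rule imageI)
  then show "t \<in> tree_of_arborescence {1..n} ` arborescences {1..n} d"
    by (simp only: eq[symmetric])
next
  fix t assume "t \<in> tree_of_arborescence {1..n} ` arborescences {1..n} d"
  then obtain r E where t: "t = tree_of_arborescence {1..n} (r, E)" "(r, E) \<in> arborescences {1..n} d"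
    by auto
  then have arb: "arborescence {1..n} r E" by (simp add: arborescences_def)
  show "t \<in> trees_with_degrees n d"
    using t is_rooted_tree_gr[OF arb] children_gr[OF arb]
    by (simp add: trees_with_degrees_def arborescences_def gr_simps)
qed

lemma inj_on_tree_of_arborescence: "inj_on (tree_of_arborescence V) (arborescences V d)"
proof (rule inj_onI, clarify)
  fix r E r' E' assume "(r, E) \<in> arborescences V d" "(r', E') \<in> arborescences V d"
    and eq: "tree_of_arborescence V (r, E) = tree_of_arborescence V (r', E')"
  then have arb: "arborescence V r E" "arborescence V r' E'" by (simp_all add: arborescences_def)
  have "r = r'" using eq by (simp add: tree_of_arborescence_def)
  moreover have "E = E'" using ascending_arcs_gr[OF arb(1)] ascending_arcs_gr[OF arb(2)] unfolding eq by (rule trans[OF sym])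
  ultimately show "r = r' \<and> E = E'" by (rule conjI)
qed

section \<open>The tail bound\<close>

lemma words_nonempty:
  assumes "finite V"
  shows "words V d \<noteq> {}"
proof -
  obtain l where "set l = word_slots V d" "distinct l"
    using finite_distinct_list[OF finite_word_slots[OF assms]] by blast
  then show ?thesis using map_fst_permutation_in_words[OF assms, of l d] by blast
qed

lemma two_power_le_exp: "1 \<le> y \<Longrightarrow> 2 ^ k \<le> exp (real k * y)"
proof -
  assume "1 \<le> y"
  then have "2 \<le> exp y" using exp_ge_add_one_self[of y] by linarith
  then have "2 ^ k \<le> exp y ^ k" by (intro power_mono) auto
  then show ?thesis by (simp add: exp_of_nat_mult)
qed

text \<open>The exponential is split into two factors \<open>exp (K / 400)\<close>: one absorbs the
  constant, as 65536 / 400 exceeds 163, the other the square. The constant 294912 is 4 * 73728, from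
  the union bound of a stage.\<close>

lemma square_le_exp_div_200:
  fixes K :: real
  assumes "65536 \<le> K"
  shows "294912 * K\<^sup>2 \<le> exp (K / 200)"
proof -
  have "294912 * (800 :: real)\<^sup>2 \<le> 2 ^ 163" by simp
  also have "\<dots> \<le> exp (163 * 1)" using two_power_le_exp[of 1 163] by simp
  also have "\<dots> \<le> exp (K / 400)" using assms by simp
  finally have *: "294912 * 800\<^sup>2 \<le> exp (K / 400)" .
  have "K / 800 \<le> exp (K / 800)" using exp_ge_add_one_self[of "K / 800"] by linarith
  then have "(K / 800)\<^sup>2 \<le> exp (K / 800) ^ 2" using assms by (intro power_mono) auto
  also have "\<dots> = exp (K / 400)" by (simp flip: exp_of_nat_mult)
  finally have "(K / 800)\<^sup>2 \<le> exp (K / 400)" .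
  with * have "(294912 * 800\<^sup>2) * (K / 800)\<^sup>2 \<le> exp (K / 400) * exp (K / 400)"
    by (intro mult_mono) auto
  then show ?thesis by (simp add: power_divide flip: exp_add)
qed

text \<open>Absorbs the logarithmic factor of a stage into a slightly slower geometric
  decay.\<close>

lemma linear_div_two_power_le: "(57 + 4 * real j) / 2 ^ j \<le> 57 * (3 / 4) ^ j"
proof (induction j)
  case (Suc j)
  have "(57 + 4 * real (Suc j)) / 2 ^ Suc j \<le> (3 / 4) * ((57 + 4 * real j) / 2 ^ j)"
    by (simp add: field_simps)
  also have "\<dots> \<le> (3 / 4) * (57 * (3 / 4) ^ j)" using Suc by (intro mult_left_mono) auto
  finally show ?case by simp
qed simp

section \<open>The height bound in stages\<close>

context degrees
begin

text \<open>With this, \<open>S / branching\<close> is the square of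
  \<open>deg_sigma'\<close>.\<close>

definition branching :: real where "branching = real (card {i\<in>V. d i \<noteq> 1})"

lemma S_ge: "2 * real \<alpha> \<le> S"
proof -
  have "2 * real (k - 1) \<le> real k * (real k - 1)" for k :: nat
  proof (cases "k \<le> 1")
    case False
    then have "2 * (real k - 1) \<le> real k * (real k - 1)" by (intro mult_right_mono) auto
    then show ?thesis using False by (simp add: of_nat_diff)
  qed (cases k, auto)
  then have "(\<Sum>i\<in>V. 2 * real (d i - 1)) \<le> S" unfolding S_def by (intro sum_mono)
  then show ?thesis by (simp add: \<alpha>_def sum_distrib_left)
qed

text \<open>Makes the length scale \<open>N / sqrt S\<close> at least 1, so that rounding errors can
  be absorbed.\<close>

lemma S_le: "S \<le> (real N)\<^sup>2"
proof -
  have "S \<le> (\<Sum>i\<in>V. real (d i) * real N)"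
    unfolding S_def
  proof (intro sum_mono mult_left_mono)
    fix i assume "i \<in> V"
    then have "d i \<le> N" using finite_V by (intro member_le_sum) auto
    then have "real (d i) \<le> real N" by (rule of_nat_mono)
    then show "real (d i) - 1 \<le> real N" by linarith
  qed auto
  also have "\<dots> = (real N)\<^sup>2" by (simp add: power2_eq_square sum_distrib_right)
  finally show ?thesis .
qed

lemma alpha_pos:
  assumes "0 < S"
  shows "1 \<le> \<alpha>"
proof (rule ccontr)
  assume "\<not> 1 \<le> \<alpha>"
  then have "\<alpha> = 0" by simp
  then have "\<forall>i\<in>V. d i - 1 = 0" unfolding \<alpha>_def using finite_V by (simp only: sum_eq_0_iff)
  then have "real (d i) * (real (d i) - 1) = 0" if "i \<in> V" for i
    using that by (cases "d i") auto
  then have "S = 0" unfolding S_def by (rule sum.neutral[OF ballI])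
  then show False using assms by simp
qed

lemma alpha_le_N: "\<alpha> \<le> N"
  unfolding \<alpha>_def by (intro sum_mono) auto

text \<open>There are \<open>\<alpha> + 1\<close> leaves and at most \<open>\<alpha>\<close>
  vertices of degree two or more.\<close>

lemma branching_le:
  assumes "0 < S"
  shows "branching \<le> 3 * real \<alpha>"
proof -
  have "{i\<in>V. d i \<noteq> 1} = leaves V d \<union> {i\<in>V. 2 \<le> d i}" by (auto simp: leaves_def)
  then have "card {i\<in>V. d i \<noteq> 1} \<le> card (leaves V d) + card {i\<in>V. 2 \<le> d i}"
    using card_Un_le[of "leaves V d" "{i\<in>V. 2 \<le> d i}"] by simp
  also have "card {i\<in>V. 2 \<le> d i} \<le> \<alpha>"
  proof -
    have "card {i\<in>V. 2 \<le> d i} = (\<Sum>i\<in>{i\<in>V. 2 \<le> d i}. 1)" by simp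
    also have "\<dots> \<le> (\<Sum>i\<in>{i\<in>V. 2 \<le> d i}. d i - 1)" by (intro sum_mono) auto
    also have "\<dots> \<le> \<alpha>" unfolding \<alpha>_def using finite_V by (intro sum_mono2) auto
    finally show ?thesis .
  qed
  finally have "card {i\<in>V. d i \<noteq> 1} \<le> 3 * \<alpha>" using card_leaves alpha_pos[OF assms] by linarith
  then show ?thesis unfolding branching_def by linarith
qed

lemma branching_pos:
  assumes "0 < S"
  shows "0 < branching"
proof -
  have "card (leaves V d) \<le> card {i\<in>V. d i \<noteq> 1}"
    using finite_V by (intro card_mono) (auto simp: leaves_def)
  then show ?thesis using card_leaves by (simp add: branching_def)
qed

text \<open>Keeps sigma' away from 0, and thus the exponent y at least 1 in the final
  theorem.\<close>

lemma ratio_ge: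
  assumes "0 < S"
  shows "2 / 3 \<le> S / branching"
  using S_ge branching_le[OF assms] branching_pos[OF assms] by (simp add: le_divide_eq)

text \<open>
  The height is bounded in stages. The first \<open>k 1\<close> leaves are reached from the root one by one; then the number of leaves is
  multiplied by four in each stage, as long as the bound on \<open>gap\<close> applies, and all the remaining
  leaves are reached in a last stage.
\<close>

lemma card_high_arborescences_le:
  assumes S: "0 < S" and y: "1 \<le> y" and ratio: "1 + S / branching \<le> exp y"
  shows "real (card {t \<in> arborescences V d. \<exists>v\<in>V. 2000 * y * real N / sqrt S < real (depth t v)})
    \<le> 2 * exp (- y) * real (card (arborescences V d))"
proof -
  define u where "u = S / branching"
  define Q where "Q = real N / sqrt S"
  \<comment> \<open>The part \<open>65536 * y\<close> makes \<open>exp (- K / 192)\<close>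
    negligible against \<open>exp (- y)\<close>; the part \<open>65536 * u\<close> makes
    \<open>\<alpha> * K\<close> at least (128 * 2^j)^2 S in stage j.\<close>
  define b where "b = 65536 * y * (1 + u)"
  define k0 where "k0 = nat \<lceil>b\<rceil>"
  have u: "2 / 3 \<le> u" using ratio_ge[OF S] by (simp add: u_def)
  have y_exp: "y \<le> exp y" using exp_ge_add_one_self[of y] by linarith
  have b_ge: "65536 * y \<le> b" using y u by (simp add: b_def)
  have k0: "b \<le> real k0" "real k0 \<le> b + 1"
    unfolding k0_def using b_ge y by (simp_all add: of_nat_ceiling)
  have k0_big: "65536 \<le> real k0" using k0 b_ge y by linarith
  have k0_le: "real k0 \<le> 131072 * exp (2 * y)"
  proof -
    have "b \<le> 65536 * exp y * exp y"
      unfolding b_def using ratio[folded u_def] y y_exp u by (intro mult_mono) auto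
    also have "\<dots> = 65536 * exp (2 * y)" by (simp add: exp_double power2_eq_square)
    finally have "b \<le> 65536 * exp (2 * y)" .
    moreover have "1 \<le> exp (2 * y)" using y by simp
    ultimately show ?thesis using k0(2) by linarith
  qed
  have N: "0 < real N"
  proof -
    have "0 < (real N)\<^sup>2" using S S_le by linarith
    then have "real N \<noteq> 0" by (simp only: zero_less_power2) simp
    then show ?thesis using of_nat_0_le_iff[of N] by linarith
  qed
  have Q1: "1 \<le> Q"
  proof -
    have "sqrt S \<le> real N" using S_le N by (intro real_le_lsqrt) auto
    then show ?thesis using S by (simp add: Q_def)
  qed
  have ex: "\<exists>j. \<alpha> < 18432 * (4 ^ j * k0)"
  proof (intro exI)
    have "\<alpha> < 2 ^ \<alpha>" by (rule less_exp)
    also have "(2::nat) ^ \<alpha> \<le> 4 ^ \<alpha>" by (intro power_mono) auto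
    also have "\<dots> \<le> 18432 * (4 ^ \<alpha> * k0)" using k0_big by simp
    finally show "\<alpha> < 18432 * (4 ^ \<alpha> * k0)" .
  qed
  \<comment> \<open>The number of stages for which the hypothesis
    \<open>18432 * K \<le> \<alpha>\<close> of the gap bound holds. It may be 0; then the initial
    block already consists of all leaves, fewer than a constant multiple of \<open>k0\<close> plus
    one.\<close>
  define g where "g = (LEAST j. \<alpha> < 18432 * (4 ^ j * k0))"
  have g: "\<alpha> < 18432 * (4 ^ g * k0)" unfolding g_def using ex by (rule LeastI_ex)
  have g_least: "18432 * (4 ^ j * k0) \<le> \<alpha>" if "j < g" for j
    using not_less_Least[of j "\<lambda>j. \<alpha> < 18432 * (4 ^ j * k0)"] that by (simp add: g_def)
  define k where "k i = (case i of 0 \<Rightarrow> 0 | Suc j \<Rightarrow> if j < g then 4 ^ j * k0 else Suc \<alpha>)" for i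
  have k_0: "k 0 = 0" and k_Suc: "k (Suc j) = (if j < g then 4 ^ j * k0 else Suc \<alpha>)" for j
    by (simp_all add: k_def)
  have k_mono: "k i \<le> k (Suc i)" for i
  proof (cases i)
    case (Suc j)
    have "4 ^ j * k0 \<le> Suc \<alpha>" if "j < g" using g_least[OF that] by linarith
    then show ?thesis by (simp add: Suc k_Suc)
  qed (simp add: k_0)
  have k_last: "k (Suc g) = Suc \<alpha>" by (simp add: k_Suc)
  have k_next: "k (Suc j) \<le> 18432 * (4 ^ j * k0)" if "j \<le> g" for j
    using that g by (cases "j < g") (auto simp: k_Suc)
  \<comment> \<open>With \<open>z = 600 * y\<close> the first gap fails with probability at most
    \<open>2 * exp (- (50 * y))\<close>: 2 y pays for the size of \<open>k0\<close>, 47 y for the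
    constants, and y is left.\<close>
  define t where "t = nat \<lceil>600 * y * Q\<rceil>"
  \<comment> \<open>Divided by the decay rate of the gap bound: 18 pays for the constants,
    \<open>2 * ln K\<close> for a factor \<open>K\<close> of leaves and another for the weight
    2^(-j) of the stage, and \<open>y\<close> is the target exponent.\<close>
  define hr where "hr j = 136 * real N / sqrt (real \<alpha> * real (4 ^ j * k0)) *
    (18 + 2 * ln (real (4 ^ j * k0)) + y)" for j :: nat
  define H where "H i = (case i of 0 \<Rightarrow> 2 * t + 1 | Suc j \<Rightarrow> nat \<lceil>hr j\<rceil> + 1)" for i
  define e where "e i = exp (- y) * (1 / 2) ^ i" for i :: nat
  have H0: "real (H 0) \<le> 1203 * (y * Q)"
  proof -
    have yQ: "1 \<le> y * Q" using mult_mono[of 1 y 1 Q] y Q1 by simp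
    have "0 \<le> 600 * y * Q" using y Q1 by simp
    then have "real t \<le> 600 * y * Q + 1" unfolding t_def by (simp add: of_nat_ceiling)
    then show ?thesis using yQ by (simp add: H_def)
  qed
  have e0: "real (k (Suc 0)) * real (card {xs \<in> words V d. H 0 \<le> gap (k 0) xs}) \<le> e 0 * real (card (words V d))"
  proof -
    have z1: "1 \<le> 600 * y" using y by simp
    have zt: "600 * y * real N / sqrt S \<le> real t"
      using real_nat_ceiling_ge[of "600 * y * Q"] by (simp add: t_def Q_def)
    have "real (card {xs \<in> words V d. 2 * t + 1 \<le> gap 0 xs}) \<le> 2 * exp (- (600 * y) / 12) * card (words V d)"
      by (rule words_large_first_gap_le[OF S z1 zt])
    then have gap: "real (card {xs \<in> words V d. H 0 \<le> gap (k 0) xs}) \<le> 2 * exp (- (50 * y)) * card (words V d)"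
      by (simp add: H_def k_0)
    have "real (k (Suc 0)) \<le> real (18432 * (4 ^ 0 * k0))" using k_next[of 0] by (intro of_nat_mono) auto
    then have k1: "real (k (Suc 0)) \<le> 18432 * (131072 * exp (2 * y))" using k0_le by simp
    have "real (k (Suc 0)) * (2 * exp (- (50 * y))) \<le> 18432 * (131072 * exp (2 * y)) * (2 * exp (- (50 * y)))"
      using k1 by (intro mult_right_mono) auto
    also have "\<dots> = 4831838208 * exp (- (48 * y))" by (simp flip: exp_add)
    also have "\<dots> \<le> 2 ^ 47 * exp (- (48 * y))" by (intro mult_right_mono) auto
    also have "\<dots> \<le> exp (47 * y) * exp (- (48 * y))"
      using two_power_le_exp[OF y, of 47] by (intro mult_right_mono) auto
    also have "\<dots> = e 0" by (simp add: e_def flip: exp_add)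
    finally have k2: "real (k (Suc 0)) * (2 * exp (- (50 * y))) \<le> e 0" .
    have "real (k (Suc 0)) * real (card {xs \<in> words V d. H 0 \<le> gap (k 0) xs})
        \<le> real (k (Suc 0)) * (2 * exp (- (50 * y)) * card (words V d))"
      using gap by (intro mult_left_mono) auto
    also have "\<dots> = (real (k (Suc 0)) * (2 * exp (- (50 * y)))) * card (words V d)" by simp
    also have "\<dots> \<le> e 0 * card (words V d)" using k2 by (intro mult_right_mono) auto
    finally show ?thesis .
  qed
  have stage: "real (k (Suc (Suc j))) * real (card {xs \<in> words V d. H (Suc j) \<le> gap (k (Suc j)) xs})
        \<le> e (Suc j) * real (card (words V d)) \<and> real (H (Suc j)) \<le> 130 * (y * Q) * (3 / 4) ^ j"
    if j: "j < g" for j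
  proof -
    define K where "K = 4 ^ j * k0"
    define s where "s = sqrt (real \<alpha> * real K) / (136 * real N)"
    define L where "L = 18 + 2 * ln (real K) + y"
    define h where "h = nat \<lceil>hr j\<rceil>"
    have K\<alpha>: "18432 * real K \<le> real \<alpha>"
    proof -
      have "real (18432 * K) \<le> real \<alpha>" using g_least[OF j] by (intro of_nat_mono) (simp add: K_def)
      then show ?thesis by simp
    qed
    have k0K: "real k0 \<le> real K" using mult_right_mono[of 1 "4 ^ j" "real k0"] by (simp add: K_def)
    have K_big: "65536 \<le> real K" using k0K k0_big by linarith
    have K8: "8 \<le> K" using K_big by linarith
    have \<alpha>: "0 < real \<alpha>" using K\<alpha> K_big by linarith
    have s: "0 < s" using \<alpha> N K_big by (simp add: s_def)
    have L: "18 \<le> L" using K_big y by (simp add: L_def)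
    have hr_eq: "hr j = L / s" by (simp add: hr_def L_def s_def K_def)
    have h_ge: "L \<le> real h * s"
    proof -
      have "L / s \<le> real h" unfolding h_def hr_eq by (rule real_nat_ceiling_ge)
      then show ?thesis using s by (simp add: divide_le_eq)
    qed
    \<comment> \<open>The weight \<open>(1 / 2) ^ Suc j\<close> is bought with one more factor
      \<open>K\<close>, hence the squares in \<open>first\<close> and \<open>second\<close>.\<close>
    have two: "2 * 2 ^ j \<le> real K"
    proof -
      have "(2::real) ^ j \<le> 4 ^ j" by (intro power_mono) auto
      moreover have "2 \<le> real k0" using k0_big by linarith
      ultimately have "2 ^ j * 2 \<le> 4 ^ j * real k0" by (intro mult_mono) auto
      then show ?thesis by (simp add: K_def mult.commute)
    qed
    have kS: "k (Suc j) = K" using j by (simp add: k_Suc K_def)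
    have "k (Suc (Suc j)) \<le> 18432 * (4 ^ Suc j * k0)" using j by (intro k_next) simp
    also have "\<dots> = 73728 * K" by (simp add: K_def)
    finally have kSS: "real (k (Suc (Suc j))) \<le> 73728 * real K" by linarith
    have "real (card {xs \<in> words V d. h + 1 \<le> gap K xs})
        \<le> (2 * exp (- real K / 192) + exp (- (real h * sqrt (real \<alpha> * K) / (136 * real N)))) * card (words V d)"
      by (rule words_large_gap_le[OF K8 K\<alpha>])
    then have gap: "real (card {xs \<in> words V d. h + 1 \<le> gap K xs})
        \<le> (2 * exp (- real K / 192) + exp (- (real h * s))) * card (words V d)"
      by (simp add: s_def)
    have first: "294912 * (real K)\<^sup>2 * exp (- real K / 192) \<le> exp (- y)"
    proof -
      have yK: "y \<le> real K / 65536" using b_ge k0 k0K by linarith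
      have "294912 * (real K)\<^sup>2 * exp (- real K / 192) \<le> exp (real K / 200) * exp (- real K / 192)"
        using square_le_exp_div_200[OF K_big] by (intro mult_right_mono) auto
      also have "\<dots> = exp (real K / 200 - real K / 192)" by (simp flip: exp_add)
      also have "\<dots> \<le> exp (- y)" using yK by simp
      finally show ?thesis .
    qed
    have second: "147456 * (real K)\<^sup>2 * exp (- (real h * s)) \<le> exp (- y)"
    proof -
      have "147456 * (real K)\<^sup>2 * exp (- (real h * s)) \<le> 147456 * (real K)\<^sup>2 * exp (- L)"
        using h_ge by (intro mult_left_mono) auto
      also have "exp (- L) = exp (- 18) * (exp (- ln (real K)))\<^sup>2 * exp (- y)"
        by (simp add: L_def power2_eq_square flip: exp_add)
      also have "exp (- ln (real K)) = 1 / real K" using K_big by (simp add: exp_minus inverse_eq_divide)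
      also have "147456 * (real K)\<^sup>2 * (exp (- 18) * (1 / real K)\<^sup>2 * exp (- y)) = 147456 * exp (- 18) * exp (- y)"
        using K_big by (simp add: power_divide)
      also have "\<dots> \<le> 2 ^ 18 * exp (- 18) * exp (- y)" by (intro mult_right_mono) auto
      also have "\<dots> \<le> exp 18 * exp (- 18) * exp (- y)"
        using two_power_le_exp[of 1 18] by (intro mult_right_mono) auto
      also have "\<dots> = exp (- y)" by (simp flip: exp_add)
      finally show ?thesis .
    qed
    have "73728 * real K * (2 * exp (- real K / 192) + exp (- (real h * s))) * (2 * 2 ^ j)
        \<le> 73728 * real K * (2 * exp (- real K / 192) + exp (- (real h * s))) * real K"
      using two by (intro mult_left_mono) auto
    also have "\<dots> \<le> exp (- y)"
      using first second by (simp add: power2_eq_square algebra_simps)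
    finally have total: "73728 * real K * (2 * exp (- real K / 192) + exp (- (real h * s))) \<le> e (Suc j)"
      by (simp add: e_def power_one_over divide_simps mult_ac)
    have "real (k (Suc (Suc j))) * real (card {xs \<in> words V d. h + 1 \<le> gap K xs})
        \<le> 73728 * real K * ((2 * exp (- real K / 192) + exp (- (real h * s))) * card (words V d))"
      using gap kSS by (intro mult_mono) auto
    also have "\<dots> = (73728 * real K * (2 * exp (- real K / 192) + exp (- (real h * s)))) * card (words V d)" by simp
    also have "\<dots> \<le> e (Suc j) * card (words V d)" using total by (intro mult_right_mono) auto
    finally have prob: "real (k (Suc (Suc j))) * real (card {xs \<in> words V d. h + 1 \<le> gap K xs})
        \<le> e (Suc j) * card (words V d)" .
    \<comment> \<open>Lets the ceiling and the extra 1 be absorbed by doubling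
      \<open>hr j\<close>.\<close>
    have hr_big: "2 \<le> hr j"
    proof -
      have "sqrt (real \<alpha> * real K) \<le> real \<alpha>"
      proof (rule real_le_lsqrt)
        have "real \<alpha> * real K \<le> real \<alpha> * real \<alpha>" using K\<alpha> by (intro mult_left_mono) auto
        then show "real \<alpha> * real K \<le> (real \<alpha>)\<^sup>2" by (simp add: power2_eq_square)
      qed simp
      also have "\<dots> \<le> real N" using alpha_le_N by (rule of_nat_mono)
      finally have "s \<le> real N / (136 * real N)" unfolding s_def using N by (intro divide_right_mono) auto
      also have "\<dots> \<le> 1" using N by simp
      finally have "2 * s \<le> L" using L by linarith
      then show ?thesis unfolding hr_eq using s by (simp add: le_divide_eq)
    qed
    \<comment> \<open>Here \<open>branching / 4 \<le> \<alpha>\<close> and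
      \<open>65536 * 4 ^ j * u \<le> K\<close> combine, the branching number cancels and only
      \<open>S\<close> remains; 17/16 is 136/128.\<close>
    have s_ge: "2 ^ j / Q \<le> 17 / 16 * s"
    proof -
      have "4 ^ j * 65536 * S / 4 \<le> real \<alpha> * real K"
      proof -
        have "branching / 4 \<le> real \<alpha>" using branching_le[OF S] by linarith
        moreover have "4 ^ j * (65536 * u) \<le> real K"
        proof -
          have "65536 * u \<le> 65536 * y * (1 + u)"
            using y u mult_mono[of 1 y u "1 + u"] by simp
          then have "65536 * u \<le> real k0" using k0(1) unfolding b_def by linarith
          then show ?thesis by (simp add: K_def)
        qed
        ultimately have "branching / 4 * (4 ^ j * (65536 * u)) \<le> real \<alpha> * real K"
          using u branching_pos[OF S] by (intro mult_mono) auto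
        then show ?thesis using branching_pos[OF S] by (simp add: u_def mult_ac)
      qed
      then have "sqrt (4 ^ j * 65536 * S / 4) \<le> sqrt (real \<alpha> * real K)" by (rule real_sqrt_le_mono)
      moreover have "4 ^ j * 65536 * S / 4 = (2 ^ j * 128)\<^sup>2 * S"
        by (simp add: power_mult_distrib power_mult[symmetric] mult.commute[of _ 2] power_mult)
      then have "sqrt (4 ^ j * 65536 * S / 4) = sqrt ((2 ^ j * 128)\<^sup>2) * sqrt S"
        by (simp only: real_sqrt_mult)
      moreover have "sqrt ((2 ^ j * 128)\<^sup>2) = (2 ^ j * 128 :: real)" by (subst real_sqrt_abs) simp
      ultimately have "2 ^ j * 128 * sqrt S \<le> sqrt (real \<alpha> * real K)" by (simp only:)
      then have "2 ^ j * 128 * sqrt S / (136 * real N) \<le> s" unfolding s_def using N by (intro divide_right_mono) auto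
      then show ?thesis using N S by (simp add: Q_def field_simps)
    qed
    \<comment> \<open>From \<open>ln K \<le> 2 j + 17 + 2 y\<close>, where 131072 = 2^17 bounds
      \<open>k0\<close>; the constant 52 is merged using \<open>y \<ge> 1\<close>.\<close>
    have L_le: "L \<le> (57 + 4 * real j) * y"
    proof -
      have "ln (real K) = real j * ln 4 + ln (real k0)"
        using k0_big by (simp add: K_def ln_mult ln_realpow)
      also have "ln (real k0) \<le> ln (131072 * exp (2 * y))" using k0_le k0_big by (intro ln_mono) auto
      also have "\<dots> = ln (2 ^ 17) + 2 * y" by (subst ln_mult) auto
      also have "ln ((2::real) ^ 17) = 17 * ln 2" by (subst ln_realpow) simp_all
      also have "ln (2::real) \<le> 1" using ln_add_one_self_le_self[of 1] by simp
      finally have "ln (real K) \<le> real j * ln 4 + (17 * 1 + 2 * y)" by simp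
      moreover have "ln (4::real) \<le> 2"
      proof -
        have "ln (4::real) = 2 * ln 2" using ln_realpow[of 2 2] by simp
        then show ?thesis using \<open>ln (2::real) \<le> 1\<close> by simp
      qed
      then have "real j * ln 4 \<le> real j * 2" by (intro mult_left_mono) auto
      ultimately have "L \<le> 52 + 4 * real j + 5 * y" unfolding L_def by linarith
      also have "\<dots> \<le> (57 + 4 * real j) * y"
      proof -
        have "0 \<le> (52 + 4 * real j) * (y - 1)" using y by (intro mult_nonneg_nonneg) auto
        then show ?thesis by (simp add: algebra_simps)
      qed
      finally show ?thesis .
    qed
    have "real h \<le> hr j + 1" unfolding h_def using hr_big by (simp add: of_nat_ceiling)
    then have "real (h + 1) \<le> 2 * hr j" using hr_big by simp
    also have "\<dots> \<le> 2 * (17 / 16 * (Q / 2 ^ j) * ((57 + 4 * real j) * y))"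
    proof -
      have "1 / s \<le> 17 / 16 * (Q / 2 ^ j)" using s_ge s Q1 by (simp add: field_simps)
      then have "1 / s * L \<le> 17 / 16 * (Q / 2 ^ j) * ((57 + 4 * real j) * y)"
        using L_le L Q1 by (intro mult_mono) auto
      then have "L / s \<le> 17 / 16 * (Q / 2 ^ j) * ((57 + 4 * real j) * y)"
        by (simp only: times_divide_eq_left mult_1)
      then show ?thesis unfolding hr_eq by (rule mult_left_mono) simp
    qed
    also have "\<dots> = 17 / 8 * (y * Q) * ((57 + 4 * real j) / 2 ^ j)" by simp
    also have "\<dots> \<le> 17 / 8 * (y * Q) * (57 * (3 / 4) ^ j)"
      using y Q1 linear_div_two_power_le[of j] by (intro mult_left_mono) auto
    also have "\<dots> \<le> 130 * (y * Q) * (3 / 4) ^ j"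
      using y Q1 by simp
    finally have "real (h + 1) \<le> 130 * (y * Q) * (3 / 4) ^ j" .
    moreover have "H (Suc j) = h + 1" by (simp add: H_def h_def)
    ultimately show ?thesis using prob kS by simp
  qed
  have prob: "real (k (Suc i)) * real (card {xs \<in> words V d. H i \<le> gap (k i) xs}) \<le> e i * card (words V d)"
    if "i < Suc g" for i
    using that e0 stage by (cases i) auto
  have high: "real (card {t \<in> arborescences V d. \<exists>v\<in>V. (\<Sum>i<Suc g. H i) < depth t v})
      \<le> (\<Sum>i<Suc g. e i) * card (arborescences V d)"
    by (rule card_high_le[of k, OF k_0 k_mono k_last prob])
  have geo: "(\<Sum>i<m. q ^ i) \<le> 1 / (1 - q)" if "0 \<le> q" "q < 1" for q :: real and m :: nat
  proof -
    have "(\<Sum>i<m. q ^ i) = (1 - q ^ m) / (1 - q)" using that by (simp add: sum_gp_strict)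
    also have "\<dots> \<le> 1 / (1 - q)" using that by (intro divide_right_mono) auto
    finally show ?thesis .
  qed
  have sum_e: "(\<Sum>i<Suc g. e i) \<le> 2 * exp (- y)"
  proof -
    have "(\<Sum>i<Suc g. e i) = exp (- y) * (\<Sum>i<Suc g. (1 / 2) ^ i)"
      unfolding e_def by (rule sum_distrib_left[symmetric])
    also have "\<dots> \<le> exp (- y) * 2" using geo[of "1 / 2" "Suc g"] by (intro mult_left_mono) auto
    finally show ?thesis by simp
  qed
  \<comment> \<open>The later stages contribute at most 130 / (1 - 3/4) = 520, so 1203 + 520 stays
    below 2000.\<close>
  have sum_H: "real (\<Sum>i<Suc g. H i) \<le> 2000 * (y * Q)"
  proof -
    have "real (\<Sum>i<Suc g. H i) = real (H 0) + (\<Sum>j<g. real (H (Suc j)))"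
      by (simp only: sum.lessThan_Suc_shift of_nat_add of_nat_sum)
    also have "(\<Sum>j<g. real (H (Suc j))) \<le> (\<Sum>j<g. 130 * (y * Q) * (3 / 4) ^ j)"
      using stage by (intro sum_mono) auto
    also have "\<dots> = 130 * (y * Q) * (\<Sum>j<g. (3 / 4) ^ j)" by (simp add: sum_distrib_left)
    also have "\<dots> \<le> 130 * (y * Q) * 4"
      using geo[of "3 / 4" g] y Q1 by (intro mult_left_mono) auto
    also have "real (H 0) \<le> 1203 * (y * Q)" by (rule H0)
    finally have "real (\<Sum>i<Suc g. H i) \<le> 1203 * (y * Q) + 130 * (y * Q) * 4" by simp
    moreover have "0 \<le> y * Q" using y Q1 by simp
    ultimately show ?thesis by linarith
  qed
  have "{t \<in> arborescences V d. \<exists>v\<in>V. 2000 * y * real N / sqrt S < real (depth t v)}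
      \<subseteq> {t \<in> arborescences V d. \<exists>v\<in>V. (\<Sum>i<Suc g. H i) < depth t v}"
  proof
    fix t assume "t \<in> {t \<in> arborescences V d. \<exists>v\<in>V. 2000 * y * real N / sqrt S < real (depth t v)}"
    then obtain v where v: "t \<in> arborescences V d" "v \<in> V" "2000 * (y * Q) < real (depth t v)"
      by (auto simp: Q_def mult.assoc)
    then have "real (\<Sum>i<Suc g. H i) < real (depth t v)" using sum_H by linarith
    then have "(\<Sum>i<Suc g. H i) < depth t v" by (simp only: of_nat_less_iff)
    then show "t \<in> {t \<in> arborescences V d. \<exists>v\<in>V. (\<Sum>i<Suc g. H i) < depth t v}" using v by blast
  qed
  then have "real (card {t \<in> arborescences V d. \<exists>v\<in>V. 2000 * y * real N / sqrt S < real (depth t v)})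
      \<le> real (card {t \<in> arborescences V d. \<exists>v\<in>V. (\<Sum>i<Suc g. H i) < depth t v})"
    using finite_arborescences by (intro of_nat_mono card_mono) auto
  also note high
  also have "(\<Sum>i<Suc g. e i) * card (arborescences V d) \<le> 2 * exp (- y) * card (arborescences V d)"
    using sum_e by (intro mult_right_mono) auto
  finally show ?thesis .
qed

end

theorem theorem7:
  fixes n :: nat and d :: "nat \<Rightarrow> nat" and x :: real
  assumes "degree_sequence n d"
    and "deg_sigma n d > 0"
    and "x \<ge> 2 ^ 15"
  shows "measure_pmf.prob (pmf_of_set (trees_with_degrees n d))
           {t. real (tree_height t) \<ge> x * sqrt (real n) * (ln (deg_sigma' n d + 1) / deg_sigma n d)}
         < 4 * exp (- x * ln (deg_sigma' n d + 1) / 2 ^ 14)"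
proof -
  interpret degrees "{1..n}" d
    using assms(1) by unfold_locales (auto simp: degree_sequence_def)
  have n: "n = Suc N" using card_V by simp
  have sigma: "deg_sigma n d = sqrt (S / n)" unfolding deg_sigma_def S_def
    by (simp only: times_divide_eq_left mult_1)
  have S: "0 < S" using assms(2) n unfolding sigma by (simp add: zero_less_divide_iff)
  have branching: "real n - real (num_degree n d 1) = branching"
  proof -
    have "card {1..n} = card ({i\<in>{1..n}. d i = 1} \<union> {i\<in>{1..n}. d i \<noteq> 1})"
      by (intro arg_cong[of _ _ card]) auto
    also have "\<dots> = num_degree n d 1 + card {i\<in>{1..n}. d i \<noteq> 1}"
      unfolding num_degree_def by (intro card_Un_disjoint) auto
    finally show ?thesis unfolding branching_def card_atLeastAtMost by simp
  qed
  define s where "s = deg_sigma' n d"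
  have "n / branching * (S / n) = S / branching" using n by simp
  then have s_eq: "s = sqrt (S / branching)"
    unfolding s_def deg_sigma'_def branching using S n by (simp add: sigma)
  have s2: "s\<^sup>2 = S / branching" "0 \<le> s"
    using S branching_pos[OF S] by (simp_all add: s_eq)
  define y where "y = x * ln (s + 1) / 2 ^ 14"
  \<comment> \<open>The value 4/5 fits: its square is below 2/3, and (1 + 4/5)^2 = 3.24 exceeds
    e.\<close>
  have "4 / 5 \<le> s"
  proof (rule power2_le_imp_le)
    have "(4 / 5 :: real)\<^sup>2 \<le> 2 / 3" by (simp add: power2_eq_square)
    also note ratio_ge[OF S]
    finally show "(4 / 5)\<^sup>2 \<le> s\<^sup>2" unfolding s2 .
  qed (rule s2)
  then have "(1 + 4 / 5)\<^sup>2 \<le> (s + 1)\<^sup>2" by (intro power_mono) auto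
  then have "exp 1 \<le> (s + 1)\<^sup>2" using exp_le by (simp add: power2_eq_square)
  then have "ln (exp 1) \<le> ln ((s + 1)\<^sup>2)" using s2 by (intro ln_mono) auto
  then have ln_s: "1 \<le> 2 * ln (s + 1)" using s2 by (simp add: ln_realpow)
  \<comment> \<open>The bound \<open>x \<ge> 2 ^ 15\<close> enters here: \<open>exp y\<close> is
    then at least \<open>(s + 1)\<^sup>2\<close>, which exceeds the \<open>1 + s\<^sup>2\<close>
    required by the union bounds.\<close>
  have y2: "2 * ln (s + 1) \<le> y"
  proof -
    have "2 ^ 15 * ln (s + 1) \<le> x * ln (s + 1)" using assms(3) s2 by (intro mult_right_mono) auto
    then show ?thesis by (simp add: y_def)
  qed
  have y1: "1 \<le> y" using ln_s y2 by linarith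
  have ratio: "1 + S / branching \<le> exp y"
  proof -
    have "1 + s\<^sup>2 \<le> (s + 1)\<^sup>2" using s2 by (simp add: power2_eq_square algebra_simps)
    also have "\<dots> = exp (2 * ln (s + 1))" using s2 by (simp add: exp_double)
    also have "\<dots> \<le> exp y" using y2 by simp
    finally show ?thesis by (simp add: s2)
  qed
  let ?A = "arborescences {1..n} d"
  let ?G = "tree_of_arborescence {1..n}"
  let ?B = "x * sqrt (real n) * (ln (s + 1) / deg_sigma n d)"
  let ?hi = "{t \<in> ?A. \<exists>v\<in>{1..n}. 2000 * y * real N / sqrt S < real (depth t v)}"
  \<comment> \<open>In terms of \<open>y\<close> the threshold is
    \<open>2 ^ 14 * y * n / sqrt S\<close>, strictly above the height bound with 2000, so the weak
    inequality for the height yields the strict one for a depth.\<close>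
  have B: "2000 * y * real N / sqrt S < ?B"
  proof -
    have "?B = 2 ^ 14 * y * (sqrt (real n) * sqrt (real n)) / sqrt S"
      unfolding sigma y_def using S n by (simp add: real_sqrt_divide field_simps del: real_sqrt_mult_self)
    also have "\<dots> = 2 ^ 14 * y * real n / sqrt S" by simp
    finally have B_eq: "?B = 2 ^ 14 * y * real n / sqrt S" .
    have "2000 * y * real N < 2 ^ 14 * y * real n"
    proof -
      have "real N \<le> real n" using n by linarith
      then have "2000 * y * real N \<le> 2000 * y * real n" using y1 by (intro mult_left_mono) auto
      also have "\<dots> < 2 ^ 14 * y * real n" using y1 n by (intro mult_strict_right_mono) auto
      finally show ?thesis .
    qed
    then show ?thesis unfolding B_eq using S by (intro divide_strict_right_mono) auto
  qed
  have T: "trees_with_degrees n d = ?G ` ?A" by (rule trees_with_degrees_eq)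
  have A: "finite ?A" "?A \<noteq> {}"
  proof -
    show "finite ?A" by (rule finite_arborescences)
    have "0 < card (words {1..n} d)"
      using finite_words[of "{1..n}" d] words_nonempty[of "{1..n}" d] by (simp add: card_gt_0_iff)
    then show "?A \<noteq> {}" using card_arborescences by auto
  qed
  have "trees_with_degrees n d \<inter> {t. ?B \<le> real (tree_height t)} \<subseteq> ?G ` ?hi"
  proof
    fix t assume "t \<in> trees_with_degrees n d \<inter> {t. ?B \<le> real (tree_height t)}"
    then obtain r E where t: "t = ?G (r, E)" "(r, E) \<in> ?A" "?B \<le> real (tree_height t)"
      by (auto simp: T)
    then have arb: "arborescence {1..n} r E" by (simp add: arborescences_def)
    have "Max (depth (r, E) ` {1..n}) \<in> depth (r, E) ` {1..n}" using n by (intro Max_in) auto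
    then obtain v where v: "v \<in> {1..n}" "tree_height t = depth (r, E) v"
      unfolding t(1) tree_height_gr[OF arb] by auto
    then have "2000 * y * real N / sqrt S < real (depth (r, E) v)" using B t(3) by linarith
    then show "t \<in> ?G ` ?hi" using t v by blast
  qed
  then have "card (trees_with_degrees n d \<inter> {t. ?B \<le> real (tree_height t)}) \<le> card (?G ` ?hi)"
    using A by (intro card_mono) auto
  also have "\<dots> \<le> card ?hi" using A by (intro card_image_le) auto
  finally have "real (card (trees_with_degrees n d \<inter> {t. ?B \<le> real (tree_height t)})) \<le> real (card ?hi)"
    by (rule of_nat_mono)
  also have "\<dots> \<le> 2 * exp (- y) * real (card ?A)" by (rule card_high_arborescences_le[OF S y1 ratio])
  finally have le: "real (card (trees_with_degrees n d \<inter> {t. ?B \<le> real (tree_height t)}))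
    \<le> 2 * exp (- y) * real (card ?A)" .
  have cardT: "card (trees_with_degrees n d) = card ?A"
    unfolding T by (rule card_image[OF inj_on_tree_of_arborescence])
  have cardA: "0 < real (card ?A)" using A by (simp add: card_gt_0_iff)
  have "measure_pmf.prob (pmf_of_set (trees_with_degrees n d)) {t. ?B \<le> real (tree_height t)}
      = real (card (trees_with_degrees n d \<inter> {t. ?B \<le> real (tree_height t)})) / real (card ?A)"
  proof -
    have "trees_with_degrees n d \<noteq> {}" "finite (trees_with_degrees n d)" using A by (simp_all add: T)
    from measure_pmf_of_set[OF this] show ?thesis by (simp only: cardT)
  qed
  also have "\<dots> \<le> 2 * exp (- y)" using le cardA by (simp add: divide_le_eq)
  also have "\<dots> < 4 * exp (- y)" by simp
  finally show ?thesis by (simp add: s_def y_def)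
qed

end
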